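(* Let $(k^{(p)})_{p\ge1}$ be a sequence of kernels ($k=k^{(p)}$ on $\mathbb{R}^p$) with $\mathbb{E}[k^4(Z_1,Z_2)]<\infty$ for each $p$, and suppose $n/N=\rho+O(1/N^s)$ as $n,m\to\infty$ for some $0<\rho<1$ and $s>0$, where $N=n+m$. Under the alternative $X\ne^dY$, if for some constant $0<\tau\le1$, $$\frac{|\mathcal{E}^k(X,Y)|^{2+2\tau}}{N^\tau(\mathcal{V}_k^2(Z))^{1+\tau}}\to0,\qquad\frac{\mathbb{E}[k^2(Z_1,Z_2)]}{N^s\mathcal{V}_k^2(Z)}\to0,$$ and $$\frac{\mathbb{E}\big[|\tilde k(X_1,X_2)|^{2+2\tau}+|\tilde k(X_1,Y_1)|^{2+2\tau}+|\tilde k(Y_1,Y_2)|^{2+2\tau}\big]}{N^\tau(\mathcal{V}_k^2(Z))^{1+\tau}}\to0,$$ then $\mathcal{V}_{n,m}^{k*}(X,Y)/\mathcal{V}_k^2(Z)\to1$ in probability as $N,p\to\infty$.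
   Context: Kernel: a kernel on $\mathbb{R}^p$ is a symmetric function $k:\mathbb{R}^p\times\mathbb{R}^p\to\mathbb{R}$ satisfying either (a) $k\ge0$, $k(x,y)=0$ iff $x=y$, and for all Borel probability measures $P\ne Q$ with $\int k(z,z_0)\,dP(z)<\infty$ and $\int k(z,z_0)\,dQ(z)<\infty$ for some $z_0$, one has $\int k\,d([P-Q]\times[P-Q])<0$; or (b) $-k$ is the reproducing kernel of an RKHS on $\mathbb{R}^p$ and is characteristic (the mean embedding map on Borel probability measures is injective). It is assumed that $k(x,x)=a_0^k$ is a finite constant not depending on $x$. Sampling: for each $p$, $X,Y$ are random vectors in $\mathbb{R}^p$; $X_1,\dots,X_n$ are i.i.d. copies of $X$, $Y_1,\dots,Y_m$ are i.i.d. copies of $Y$, the two samples are independent. $Z$ equals $X$ with probability $\rho$ and $Y$ with probability $1-\rho$; $Z_1,Z_2,\dots$ are i.i.d. copies of $Z$. Notation: $\tilde k(U,V)=k(U,V)-\mathbb{E}[k(U,V)]$ for each of the pairs $(X_1,X_2),(X_1,Y_1),(Y_1,Y_2)$; $\mathcal{E}^k(X,Y)=2\mathbb{E}[k(X_1,Y_1)]-\mathbb{E}[k(X_1,X_2)]-\mathbb{E}[k(Y_1,Y_2)]$; $\mathcal{V}_k^2(Z)=\mathbb{E}[k^2(Z_1,Z_2)]-2\mathbb{E}[k(Z_1,Z_2)k(Z_1,Z_3)]+(\mathbb{E}[k(Z_1,Z_2)])^2$. Variance estimator: let $W_1,\dots,W_N$ be the pooled sample ($W_s=X_s$ for $s\le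 n$, $W_s=Y_{s-n}$ for $s>n$), $a_{s,t}=k(W_s,W_t)$ for $1\le s,t\le N$, $\tilde a_{\cdot t}=\frac{1}{N-2}\sum_{i=1}^N a_{i,t}$, $\tilde a_{s\cdot}=\frac1{N-2}\sum_{j=1}^Na_{s,j}$, $\tilde a_{\cdot\cdot}=\frac{1}{(N-1)(N-2)}\sum_{i,j=1}^Na_{i,j}$, $A^*_{s,t}=a_{s,t}-\tilde a_{\cdot t}-\tilde a_{s\cdot}+\tilde a_{\cdot\cdot}$, and $\mathcal{V}_{n,m}^{k*}(X,Y)=\frac{1}{N(N-3)}\sum_{s\ne t}(A^*_{s,t})^2-\frac{(a_0^k)^2}{(N-1)(N-3)}$. *)

theory Defs
  imports "HOL-Probability.Probability" "HOL-Library.Landau_Symbols"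
begin

(* The dimension p varies, so the points of R^p are the extensional functions on {..<p}.
   The product sigma-algebra of p copies of the Borel sets of R is the Borel sigma-algebra of R^p.
   The Borel probability measures on R^p are the elements of space (prob_algebra (Rn p)). *)
definition Rn :: "nat \<Rightarrow> (nat \<Rightarrow> real) measure" where
  "Rn p = PiM {..<p} (\<lambda>_. borel)"

definition pair_expectation ::
  "('a \<Rightarrow> 'a \<Rightarrow> real) \<Rightarrow> 'a measure \<Rightarrow> 'a measure \<Rightarrow> real" where
  "pair_expectation k P Q = (\<integral>z. k (fst z) (snd z) \<partial>(P \<Otimes>\<^sub>M Q))"

(* The integral of k with respect to the signed measure [P-Q] x [P-Q]. *)
definition signed_double_integral ::
  "('a \<Rightarrow> 'a \<Rightarrow> real) \<Rightarrow> 'a measure \<Rightarrow> 'a measure \<Rightarrow> real" where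
  "signed_double_integral k P Q =
     pair_expectation k P P - pair_expectation k P Q
     - pair_expectation k Q P + pair_expectation k Q Q"

definition strong_negative_type :: "'a measure \<Rightarrow> ('a \<Rightarrow> 'a \<Rightarrow> real) \<Rightarrow> bool" where
  "strong_negative_type S k \<longleftrightarrow>
     (\<forall>x\<in>space S. \<forall>y\<in>space S. 0 \<le> k x y \<and> (k x y = 0 \<longleftrightarrow> x = y)) \<and>
     (\<forall>P\<in>space (prob_algebra S). \<forall>Q\<in>space (prob_algebra S).
        P \<noteq> Q \<longrightarrow>
        (\<exists>z0\<in>space S. integrable P (\<lambda>z. k z z0) \<and> integrable Q (\<lambda>z. k z z0)) \<longrightarrow>
        signed_double_integral k P Q < 0)"

(* A Hilbert space H of real functions on the set S, with inner product ip, whose reproducing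
   kernel is K.  A function on S is represented by its extension by 0 outside S, so that the
   vector space operations are the pointwise ones. *)
locale rkhs =
  fixes S :: "'a set"
    and H :: "('a \<Rightarrow> real) set"
    and ip :: "('a \<Rightarrow> real) \<Rightarrow> ('a \<Rightarrow> real) \<Rightarrow> real"
    and K :: "'a \<Rightarrow> 'a \<Rightarrow> real"
  assumes supp: "f \<in> H \<Longrightarrow> x \<notin> S \<Longrightarrow> f x = 0"
    and zero: "(\<lambda>_. 0) \<in> H"
    and add: "f \<in> H \<Longrightarrow> g \<in> H \<Longrightarrow> (\<lambda>x. f x + g x) \<in> H"
    and scale: "f \<in> H \<Longrightarrow> (\<lambda>x. c * f x) \<in> H"
    and ip_sym: "f \<in> H \<Longrightarrow> g \<in> H \<Longrightarrow> ip f g = ip g f"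
    and ip_add: "f \<in> H \<Longrightarrow> g \<in> H \<Longrightarrow> h \<in> H \<Longrightarrow> ip (\<lambda>x. f x + g x) h = ip f h + ip g h"
    and ip_scale: "f \<in> H \<Longrightarrow> g \<in> H \<Longrightarrow> ip (\<lambda>x. c * f x) g = c * ip f g"
    and ip_nonneg: "f \<in> H \<Longrightarrow> 0 \<le> ip f f"
    and ip_definite: "f \<in> H \<Longrightarrow> ip f f = 0 \<Longrightarrow> f = (\<lambda>_. 0)"
    and complete: "Metric_space.mcomplete H
          (\<lambda>f g. sqrt (ip (\<lambda>x. f x - g x) (\<lambda>x. f x - g x)))"
    and section_mem: "y \<in> S \<Longrightarrow> (\<lambda>x. if x \<in> S then K x y else 0) \<in> H"
    and reproducing: "f \<in> H \<Longrightarrow> y \<in> S \<Longrightarrow> ip f (\<lambda>x. if x \<in> S then K x y else 0) = f y"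

definition mean_embedding ::
  "'a measure \<Rightarrow> ('a \<Rightarrow> 'a \<Rightarrow> real) \<Rightarrow> 'a measure \<Rightarrow> 'a \<Rightarrow> real" where
  "mean_embedding S K P = (\<lambda>x. if x \<in> space S then \<integral>y. K x y \<partial>P else 0)"

definition characteristic_kernel :: "'a measure \<Rightarrow> ('a \<Rightarrow> 'a \<Rightarrow> real) \<Rightarrow> bool" where
  "characteristic_kernel S K \<longleftrightarrow> inj_on (mean_embedding S K) (space (prob_algebra S))"

(* Joint Borel measurability is what gives the integrals of k their meaning. *)
definition kernel_on :: "'a measure \<Rightarrow> ('a \<Rightarrow> 'a \<Rightarrow> real) \<Rightarrow> bool" where
  "kernel_on S k \<longleftrightarrow>
     (\<lambda>z. k (fst z) (snd z)) \<in> borel_measurable (S \<Otimes>\<^sub>M S) \<and>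
     (\<forall>x\<in>space S. \<forall>y\<in>space S. k x y = k y x) \<and>
     (strong_negative_type S k \<or>
      (\<exists>H ip. rkhs (space S) H ip (\<lambda>x y. - k x y)) \<and> characteristic_kernel S (\<lambda>x y. - k x y))"

(* The law of a random element that has law P with probability r and law Q otherwise. *)
definition mixture :: "real \<Rightarrow> 'a measure \<Rightarrow> 'a measure \<Rightarrow> 'a measure" where
  "mixture r P Q = measure_pmf (bernoulli_pmf r) \<bind> (\<lambda>b. if b then P else Q)"

definition energy ::
  "('a \<Rightarrow> 'a \<Rightarrow> real) \<Rightarrow> 'a measure \<Rightarrow> 'a measure \<Rightarrow> real" where
  "energy k P Q = 2 * pair_expectation k P Q - pair_expectation k P P - pair_expectation k Q Q"

definition kernel_variance :: "('a \<Rightarrow> 'a \<Rightarrow> real) \<Rightarrow> 'a measure \<Rightarrow> real" where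
  "kernel_variance k R =
     pair_expectation (\<lambda>x y. (k x y)^2) R R
     - 2 * (\<integral>z. k (fst z) (fst (snd z)) * k (fst z) (snd (snd z)) \<partial>(R \<Otimes>\<^sub>M (R \<Otimes>\<^sub>M R)))
     + (pair_expectation k R R)^2"

definition centered_abs_moment ::
  "real \<Rightarrow> ('a \<Rightarrow> 'a \<Rightarrow> real) \<Rightarrow> 'a measure \<Rightarrow> 'a measure \<Rightarrow> real" where
  "centered_abs_moment q k P Q =
     pair_expectation (\<lambda>x y. \<bar>k x y - pair_expectation k P Q\<bar> powr q) P Q"

definition pooled :: "nat \<Rightarrow> (nat \<Rightarrow> 'a) \<Rightarrow> (nat \<Rightarrow> 'a) \<Rightarrow> nat \<Rightarrow> 'a" where
  "pooled n x y s = (if s \<le> n then x s else y (s - n))"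

definition centered_entry ::
  "('a \<Rightarrow> 'a \<Rightarrow> real) \<Rightarrow> nat \<Rightarrow> (nat \<Rightarrow> 'a) \<Rightarrow> nat \<Rightarrow> nat \<Rightarrow> real" where
  "centered_entry k N w s t =
     k (w s) (w t)
     - (\<Sum>i=1..N. k (w i) (w t)) / (real N - 2)
     - (\<Sum>j=1..N. k (w s) (w j)) / (real N - 2)
     + (\<Sum>i=1..N. \<Sum>j=1..N. k (w i) (w j)) / ((real N - 1) * (real N - 2))"

definition variance_estimator ::
  "('a \<Rightarrow> 'a \<Rightarrow> real) \<Rightarrow> real \<Rightarrow> nat \<Rightarrow> nat \<Rightarrow> (nat \<Rightarrow> 'a) \<Rightarrow> (nat \<Rightarrow> 'a) \<Rightarrow> real" where
  "variance_estimator k a0 n m x y =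
     (let N = n + m; w = pooled n x y in
        (\<Sum>s=1..N. \<Sum>t\<in>{1..N} - {s}. (centered_entry k N w s t)^2) / (real N * (real N - 3))
        - a0^2 / ((real N - 1) * (real N - 3)))"

definition two_sample ::
  "'w measure \<Rightarrow> 'a measure \<Rightarrow> 'a measure \<Rightarrow> 'a measure \<Rightarrow> nat \<Rightarrow> nat
     \<Rightarrow> (nat \<Rightarrow> 'w \<Rightarrow> 'a) \<Rightarrow> (nat \<Rightarrow> 'w \<Rightarrow> 'a) \<Rightarrow> bool" where
  "two_sample M S P Q n m X Y \<longleftrightarrow>
     prob_space M \<and>
     prob_space.indep_vars M (\<lambda>_. S) (case_sum X Y) ({1..n} <+> {1..m}) \<and>
     (\<forall>j\<in>{1..n}. distr M S (X j) = P) \<and>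
     (\<forall>j\<in>{1..m}. distr M S (Y j) = Q)"

(* The probability space may vary with the index. *)
definition converges_in_prob ::
  "('i \<Rightarrow> 'w measure) \<Rightarrow> ('i \<Rightarrow> 'w \<Rightarrow> real) \<Rightarrow> real \<Rightarrow> 'i filter \<Rightarrow> bool" where
  "converges_in_prob M V c F \<longleftrightarrow>
     (\<forall>\<epsilon>>0. ((\<lambda>i. measure (M i) {\<omega> \<in> space (M i). \<bar>V i \<omega> - c\<bar> > \<epsilon>}) \<longlongrightarrow> 0) F)"

end

theory Submission
  imports Defs
begin

text \<open>
  Let \<open>P\<close>, \<open>Q\<close> and \<open>R\<close> be the laws of \<open>X\<close>, \<open>Y\<close> and \<open>Z\<close>, and let \<open>V\<close> be the kernel variance of \<open>R\<close>. The proof replaces the kernel by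
  its doubly centred version \<open>h x y = k x y - E k(x, Z) - E k(Z, y) + E k(Z, Z')\<close>. On the one hand
  \<open>V = E h(Z, Z')^2\<close> (\<open>kernel_variance_eq\<close>). On the other hand the centring in the estimator annihilates,
  off the diagonal, every matrix of the form \<open>f s + f t\<close>, and the term with \<open>a0\<close> removes exactly the
  contribution of the constant diagonal. Hence the estimator does not change when the values of \<open>k\<close> are
  replaced by those of \<open>h\<close> off the diagonal and by zero on it; it becomes the normalised sum of the squares
  \<open>h(W_s, W_t)^2\<close> over pairs \<open>s \<noteq> t\<close>, corrected by the squares of the row sums and of the total sum
  (\<open>variance_estimator_as_centered_sums\<close>). Every part is then compared with \<open>V\<close> in the mean.

  Each of the two laws is bounded by a multiple of \<open>R\<close>, so \<open>E h^2\<close> is at most a constant times \<open>V\<close>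
  for any pair of groups. The expected sum of squares therefore differs from \<open>N (N - 3) V\<close> by a relative
  error that vanishes when \<open>n / N\<close> tends to \<open>\<rho>\<close>.

  The sum of squares concentrates by truncation at the level \<open>\<delta> N V\<close>. The truncated terms are correlated only
  when the pairs share an index, which bounds the variance by a multiple of \<open>\<delta> N^4 V^2\<close>; the excess over the
  level is controlled by the moment of order \<open>2 + 2 \<tau>\<close> of \<open>h\<close>
  (\<open>bounded_pair_sum_deviation\<close>, \<open>pair_sum_of_squares_deviation\<close>). That moment is bounded by the
  centred moments and the energy in the hypotheses, because \<open>h\<close> is a combination of centred kernels, of their
  conditional means and of a multiple of the energy (\<open>h_moment\<close>).

  The row sums are negligible since, given \<open>W_s = x\<close>, the conditional means of \<open>h(x, X)\<close> and \<open>h(x, Y)\<close>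
  cancel when they are weighted with \<open>\<rho>\<close> and \<open>1 - \<rho>\<close> (\<open>conditional_means_balance\<close>). What remains of a row
  sum has second moment of order \<open>(N + N^2 (n / N - \<rho>)^2) V\<close> (\<open>row_sum_bound\<close>).

  These estimates add up to a bound on the mean of \<open>|estimator / V - 1|\<close> (\<open>variance_ratio_L1_bound\<close>), whose
  limit is a multiple of the square root of \<open>\<delta>\<close>; Markov's inequality finishes the proof. Division by \<open>V\<close> is
  legitimate: \<open>V = 0\<close> would make the kernel additive almost everywhere, so that its integral against
  \<open>(P - Q) \<times> (P - Q)\<close> would vanish, and neither kind of kernel allows this for distinct laws
  (\<open>kernel_variance_pos\<close>).
\<close>

section \<open>Centring a matrix with constant diagonal\<close>

lemma sum_remove_diagonal:
  fixes f :: "'a \<Rightarrow> 'a \<Rightarrow> real"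
  assumes "finite I"
  shows "(\<Sum>s\<in>I. \<Sum>t\<in>I - {s}. f s t) = (\<Sum>s\<in>I. \<Sum>t\<in>I. f s t) - (\<Sum>s\<in>I. f s s)"
  using assms by (simp add: sum_diff1 sum_subtractf)

text \<open>
  The entries of the centred matrix sum to zero off the diagonal. This is why the shift by \<open>d\<close>, which will
  carry the constant diagonal of the kernel matrix, contributes only the separate term \<open>M (M - 1) d^2\<close>.
\<close>

lemma centered_sum_of_squares:
  fixes b :: "'a \<Rightarrow> 'a \<Rightarrow> real"
  assumes I: "finite I" "real (card I) = M" and M: "M > 3"
    and diag: "\<And>s. s \<in> I \<Longrightarrow> b s s = 0"
    and sym: "\<And>s t. s \<in> I \<Longrightarrow> t \<in> I \<Longrightarrow> b s t = b t s"
  defines "r \<equiv> \<lambda>s. \<Sum>t\<in>I. b s t"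
  defines "T \<equiv> \<Sum>s\<in>I. r s"
  defines "B \<equiv> \<lambda>s t. b s t - (r s + r t) / (M - 2) + T / ((M - 1) * (M - 2))"
  shows "(\<Sum>s\<in>I. \<Sum>t\<in>I - {s}. (B s t - d)^2)
       = (\<Sum>s\<in>I. \<Sum>t\<in>I. (b s t)^2) - 2 / (M - 2) * (\<Sum>s\<in>I. (r s)^2)
         + T^2 / ((M - 1) * (M - 2)) + M * (M - 1) * d^2"
proof -
  define \<beta> where "\<beta> = 1 / (M - 2)"
  define \<gamma> where "\<gamma> = T / ((M - 1) * (M - 2)) - d"
  define e where "e = T / ((M - 1) * (M - 2))"
  define R where "R = (\<Sum>s\<in>I. (r s)^2)"
  have rr: "(\<Sum>s\<in>I. b s t) = r t" if "t \<in> I" for t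
    unfolding r_def using sym that by (intro sum.cong) auto
  have br1: "(\<Sum>s\<in>I. \<Sum>t\<in>I. b s t * r s) = R"
    by (simp add: R_def r_def power2_eq_square sum_distrib_right)
  have br2: "(\<Sum>s\<in>I. \<Sum>t\<in>I. b s t * r t) = R"
    by (subst sum.swap)
       (simp add: R_def sum_distrib_right[symmetric] rr power2_eq_square cong: sum.cong)
  have bT: "(\<Sum>s\<in>I. \<Sum>t\<in>I. b s t) = T" by (simp add: T_def r_def)
  have rs: "(\<Sum>s\<in>I. \<Sum>t\<in>I. r s) = M * T" "(\<Sum>s\<in>I. \<Sum>t\<in>I. r t) = M * T"
    by (simp_all add: T_def I sum_distrib_left)
  have rs2: "(\<Sum>s\<in>I. \<Sum>t\<in>I. (r s)^2) = M * R" "(\<Sum>s\<in>I. \<Sum>t\<in>I. (r t)^2) = M * R"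
    by (simp_all add: R_def I sum_distrib_left)
  have rs3: "(\<Sum>s\<in>I. r s * (\<Sum>t\<in>I. r t)) = T^2"
    by (simp add: T_def power2_eq_square sum_distrib_right)
  have expand: "(B s t - d)^2 = (b s t)^2 + \<beta>^2 * ((r s)^2 + (r t)^2 + 2 * (r s * r t)) + \<gamma>^2
      - 2 * \<beta> * (b s t * r s + b s t * r t) + 2 * \<gamma> * b s t - 2 * \<beta> * \<gamma> * (r s + r t)" for s t
  proof -
    have e: "B s t - d = b s t - \<beta> * (r s + r t) + \<gamma>"
      by (simp add: B_def \<beta>_def \<gamma>_def)
    show ?thesis unfolding e by (simp add: power2_eq_square algebra_simps)
  qed
  have full: "(\<Sum>s\<in>I. \<Sum>t\<in>I. (B s t - d)^2) = (\<Sum>s\<in>I. \<Sum>t\<in>I. (b s t)^2)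
      + \<beta>^2 * (M * R + M * R + 2 * T^2) + M^2 * \<gamma>^2
      - 2 * \<beta> * (R + R) + 2 * \<gamma> * T - 2 * \<beta> * \<gamma> * (M * T + M * T)"
    unfolding expand
    by (simp only: sum.distrib sum_subtractf sum_distrib_left[symmetric] br1 br2 bT rs rs2 rs3)
       (simp add: I power2_eq_square)
  have dg: "(\<Sum>s\<in>I. (B s s - d)^2) = \<beta>^2 * (4 * R) + M * \<gamma>^2 - 4 * \<beta> * \<gamma> * T"
  proof -
    have "(\<Sum>s\<in>I. (B s s - d)^2) = (\<Sum>s\<in>I. \<beta>^2 * 4 * (r s)^2 + \<gamma>^2 - 4 * \<beta> * \<gamma> * r s)"
      by (intro sum.cong refl) (simp add: expand diag, simp add: power2_eq_square algebra_simps)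
    also have "\<dots> = \<beta>^2 * (4 * R) + M * \<gamma>^2 - 4 * \<beta> * \<gamma> * T"
      by (simp add: sum.distrib sum_subtractf sum_distrib_left[symmetric] R_def T_def I)
    finally show ?thesis .
  qed
  have nz: "M - 2 \<noteq> 0" "M - 1 \<noteq> 0" using M by auto
  have "(\<Sum>s\<in>I. \<Sum>t\<in>I - {s}. (B s t - d)^2) = (\<Sum>s\<in>I. \<Sum>t\<in>I. (b s t)^2)
      + \<beta>^2 * (2 * (M - 2) * R + 2 * T^2) + M * (M - 1) * \<gamma>^2
      - 4 * \<beta> * R + 2 * \<gamma> * T - 4 * \<beta> * \<gamma> * (M - 1) * T"
    unfolding sum_remove_diagonal[OF I(1)] full dg
    by (simp add: power2_eq_square algebra_simps)
  also have "\<dots> = (\<Sum>s\<in>I. \<Sum>t\<in>I. (b s t)^2) - 2 * \<beta> * R + T * e + M * (M - 1) * d^2"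
  proof -
    have "\<beta> * (M - 2) = 1" "e * (M - 1) = \<beta> * T" "\<gamma> = e - d"
      using nz by (simp_all add: \<beta>_def e_def \<gamma>_def)
    then show ?thesis by algebra
  qed
  finally show ?thesis by (simp add: R_def \<beta>_def e_def power2_eq_square)
qed

text \<open>
  Off the diagonal the values of \<open>k\<close> and \<open>h\<close> differ by an additive matrix, which the centring removes. The
  constant diagonal shifts every centred entry by \<open>- a0 / (N - 1)\<close>, and the squares of these shifts add up to
  the quantity that the estimator subtracts at the end.
\<close>

lemma variance_estimator_as_centered_sums:
  fixes k :: "'a \<Rightarrow> 'a \<Rightarrow> real" and g :: "'a \<Rightarrow> real" and c :: real
  assumes M: "n + m > 3"
    and diag: "\<And>s. s \<in> {1..n+m} \<Longrightarrow> k (pooled n x y s) (pooled n x y s) = a0"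
    and sym: "\<And>s t. s \<in> {1..n+m} \<Longrightarrow> t \<in> {1..n+m} \<Longrightarrow>
        k (pooled n x y s) (pooled n x y t) = k (pooled n x y t) (pooled n x y s)"
  defines "N \<equiv> real (n + m)" and "I \<equiv> {1..n+m}" and "w \<equiv> pooled n x y"
  defines "h \<equiv> \<lambda>u v. k u v - g u - g v + c"
  shows "variance_estimator k a0 n m x y
    = ((\<Sum>s\<in>I. \<Sum>t\<in>I - {s}. (h (w s) (w t))^2)
        - 2 / (N - 2) * (\<Sum>s\<in>I. (\<Sum>t\<in>I - {s}. h (w s) (w t))^2)
        + (\<Sum>s\<in>I. \<Sum>t\<in>I - {s}. h (w s) (w t))^2 / ((N - 1) * (N - 2))) / (N * (N - 3))"
proof -
  define b where "b = (\<lambda>s t. if s = t then 0 else h (w s) (w t))"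
  \<comment> \<open>the additive part of the kernel matrix off the diagonal is \<open>\<alpha> s + \<alpha> t\<close>\<close>
  define \<alpha> where "\<alpha> = (\<lambda>s. g (w s) - c / 2)"
  define A where "A = (\<Sum>s\<in>I. \<alpha> s)"
  define r where "r = (\<lambda>s. \<Sum>t\<in>I. b s t)"
  define T where "T = (\<Sum>s\<in>I. r s)"
  have N: "N > 3" "real (card I) = N" and fI: "finite I" using M by (auto simp: N_def I_def)
  have symk: "k (w s) (w t) = k (w t) (w s)" if "s \<in> I" "t \<in> I" for s t
    using sym that by (simp add: I_def w_def)
  have symb: "b s t = b t s" if "s \<in> I" "t \<in> I" for s t
    using symk that by (simp add: b_def h_def)
  have k_b: "k (w s) (w t) = b s t + \<alpha> s + \<alpha> t + (if s = t then a0 - 2 * \<alpha> s else 0)"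
    if "s \<in> I" "t \<in> I" for s t
    using diag that by (auto simp: b_def h_def \<alpha>_def I_def w_def)
  have row: "(\<Sum>j\<in>I. k (w s) (w j)) = r s + (N - 2) * \<alpha> s + A + a0" if "s \<in> I" for s
  proof -
    have "(\<Sum>j\<in>I. k (w s) (w j))
        = (\<Sum>j\<in>I. b s j + \<alpha> s + \<alpha> j + (if s = j then a0 - 2 * \<alpha> s else 0))"
      using k_b that by (intro sum.cong) auto
    then show ?thesis
      using fI that by (simp add: sum.distrib N r_def A_def algebra_simps)
  qed
  have col: "(\<Sum>i\<in>I. k (w i) (w t)) = r t + (N - 2) * \<alpha> t + A + a0" if "t \<in> I" for t
    using row[OF that] symk that by (simp cong: sum.cong)
  have tot: "(\<Sum>i\<in>I. \<Sum>j\<in>I. k (w i) (w j)) = T + 2 * (N - 1) * A + N * a0"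
    by (simp add: row sum.distrib N T_def sum_distrib_left[symmetric] A_def[symmetric] cong: sum.cong)
       (simp add: algebra_simps)
  have nz: "N - 2 \<noteq> 0" "N - 1 \<noteq> 0" "N - 3 \<noteq> 0" "N \<noteq> 0" using N by auto
  have entry: "centered_entry k (n + m) w s t
      = (b s t - (r s + r t) / (N - 2) + T / ((N - 1) * (N - 2))) - a0 / (N - 1)"
    if "s \<in> I" "t \<in> I - {s}" for s t
  proof -
    have "centered_entry k (n + m) w s t = b s t + \<alpha> s + \<alpha> t
       - (r t + (N - 2) * \<alpha> t + A + a0) / (N - 2) - (r s + (N - 2) * \<alpha> s + A + a0) / (N - 2)
       + (T + 2 * (N - 1) * A + N * a0) / ((N - 1) * (N - 2))"
      using that k_b[of s t] row[of s] col[of t] tot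
      unfolding centered_entry_def I_def N_def by auto
    also have "\<dots> = (b s t - (r s + r t) / (N - 2) + T / ((N - 1) * (N - 2))) - a0 / (N - 1)"
      using nz by (simp add: divide_simps) (simp add: algebra_simps)
    finally show ?thesis .
  qed
  have "(\<Sum>s\<in>I. \<Sum>t\<in>I - {s}. (centered_entry k (n + m) w s t)^2)
     = (\<Sum>s\<in>I. \<Sum>t\<in>I - {s}. ((b s t - (r s + r t) / (N - 2) + T / ((N - 1) * (N - 2))) - a0 / (N - 1))^2)"
    by (intro sum.cong refl) (simp add: entry)
  also have "\<dots> = (\<Sum>s\<in>I. \<Sum>t\<in>I. (b s t)^2) - 2 / (N - 2) * (\<Sum>s\<in>I. (r s)^2)
         + T^2 / ((N - 1) * (N - 2)) + N * (N - 1) * (a0 / (N - 1))^2"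
    unfolding r_def T_def
    by (rule centered_sum_of_squares[OF fI N(2) N(1)]) (use symb in \<open>auto simp: b_def\<close>)
  finally have "(\<Sum>s\<in>I. \<Sum>t\<in>I - {s}. (centered_entry k (n + m) w s t)^2)
     = (\<Sum>s\<in>I. \<Sum>t\<in>I. (b s t)^2) - 2 / (N - 2) * (\<Sum>s\<in>I. (r s)^2)
         + T^2 / ((N - 1) * (N - 2)) + N * (N - 1) * (a0 / (N - 1))^2" .
  moreover have "(\<Sum>s\<in>I. \<Sum>t\<in>I. (b s t)^2) = (\<Sum>s\<in>I. \<Sum>t\<in>I - {s}. (h (w s) (w t))^2)"
  proof (rule sum.cong[OF refl])
    fix s assume "s \<in> I"
    then have "(\<Sum>t\<in>I. (b s t)^2) = (b s s)^2 + (\<Sum>t\<in>I - {s}. (b s t)^2)"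
      by (rule sum.remove[OF fI])
    then show "(\<Sum>t\<in>I. (b s t)^2) = (\<Sum>t\<in>I - {s}. (h (w s) (w t))^2)"
      by (simp add: b_def)
  qed
  moreover have r': "r s = (\<Sum>t\<in>I - {s}. h (w s) (w t))" if "s \<in> I" for s
  proof -
    have "r s = b s s + (\<Sum>t\<in>I - {s}. b s t)"
      unfolding r_def using fI that by (rule sum.remove)
    then show ?thesis by (simp add: b_def)
  qed
  ultimately have *: "(\<Sum>s\<in>I. \<Sum>t\<in>I - {s}. (centered_entry k (n + m) w s t)^2)
     = (\<Sum>s\<in>I. \<Sum>t\<in>I - {s}. (h (w s) (w t))^2)
        - 2 / (N - 2) * (\<Sum>s\<in>I. (\<Sum>t\<in>I - {s}. h (w s) (w t))^2)
        + (\<Sum>s\<in>I. \<Sum>t\<in>I - {s}. h (w s) (w t))^2 / ((N - 1) * (N - 2)) + N * (N - 1) * (a0 / (N - 1))^2"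
    by (simp add: T_def cong: sum.cong)
  have d: "N * (N - 1) * (a0 / (N - 1))^2 / (N * (N - 3)) = a0^2 / ((N - 1) * (N - 3))"
    using nz by (simp add: divide_simps power2_eq_square)
  have "variance_estimator k a0 n m x y
      = (\<Sum>s\<in>I. \<Sum>t\<in>I - {s}. (centered_entry k (n + m) w s t)^2) / (N * (N - 3))
        - a0^2 / ((N - 1) * (N - 3))"
    by (simp only: variance_estimator_def Let_def I_def N_def w_def)
  then show ?thesis
    unfolding * add_divide_distrib d by simp
qed

section \<open>Truncation, powers and conditional means\<close>

lemma excess_le_powr:
  fixes y B \<tau> :: real
  assumes "0 \<le> y" "0 < B" "0 < \<tau>"
  shows "y - min y B \<le> y powr (1 + \<tau>) / B powr \<tau>"
proof (cases "y \<le> B")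
  case False
  then have y: "0 < y" "B < y" using assms by auto
  have "y - min y B \<le> y * 1" using assms y by simp
  also have "\<dots> \<le> y * (y / B) powr \<tau>"
    using y assms by (intro mult_left_mono ge_one_powr_ge_zero) auto
  also have "\<dots> = y powr (1 + \<tau>) / B powr \<tau>"
    using y assms by (simp add: powr_divide powr_add)
  finally show ?thesis .
qed simp

lemma abs_mult_le_sum_squares:
  fixes a b :: real
  shows "\<bar>a * b\<bar> \<le> a^2 + b^2"
proof -
  have "2 * \<bar>a\<bar> * \<bar>b\<bar> \<le> a^2 + b^2" using sum_squares_bound[of "\<bar>a\<bar>" "\<bar>b\<bar>"] by simp
  moreover have "0 \<le> \<bar>a\<bar> * \<bar>b\<bar>" by simp
  ultimately show ?thesis unfolding abs_mult by linarith
qed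

text \<open>
  Jensen's inequality for random variables of either sign needs convexity on the whole line. Away from zero this
  is the convexity of the power on the positive half line, after the triangle inequality; if one of the two points
  is zero, it is \<open>t powr q \<le> t\<close> for \<open>t\<close> between 0 and 1.
\<close>

lemma convex_on_abs_powr:
  fixes q :: real
  assumes q: "1 \<le> q"
  shows "convex_on UNIV (\<lambda>x. \<bar>x\<bar> powr q)"
proof (rule convex_onI)
  have scaled: "(t * x) powr q \<le> t * x powr q" if "0 < t" "t < 1" "0 \<le> x" for t x :: real
  proof -
    have "t powr q \<le> t powr 1" using that q by (intro powr_mono') auto
    then show ?thesis using that by (simp add: powr_mult mult_right_mono)
  qed
  fix t x y :: real assume t: "0 < t" "t < 1"
  have "\<bar>(1 - t) *\<^sub>R x + t *\<^sub>R y\<bar> powr q \<le> ((1 - t) * \<bar>x\<bar> + t * \<bar>y\<bar>) powr q"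
  proof (rule powr_mono2)
    have "\<bar>(1 - t) * x + t * y\<bar> \<le> \<bar>(1 - t) * x\<bar> + \<bar>t * y\<bar>" by (rule abs_triangle_ineq)
    then show "\<bar>(1 - t) *\<^sub>R x + t *\<^sub>R y\<bar> \<le> (1 - t) * \<bar>x\<bar> + t * \<bar>y\<bar>" using t by (simp add: abs_mult)
  qed (use q in auto)
  also have "\<dots> \<le> (1 - t) * \<bar>x\<bar> powr q + t * \<bar>y\<bar> powr q"
  proof (cases "x = 0 \<or> y = 0")
    case True
    then show ?thesis using scaled[of t "\<bar>y\<bar>"] scaled[of "1 - t" "\<bar>x\<bar>"] t q by auto
  next
    case False
    then show ?thesis
      using convex_onD[OF powr_convex[OF q], of t "\<bar>x\<bar>" "\<bar>y\<bar>"] t by simp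
  qed
  finally show "\<bar>(1 - t) *\<^sub>R x + t *\<^sub>R y\<bar> powr q \<le> (1 - t) * \<bar>x\<bar> powr q + t * \<bar>y\<bar> powr q" .
qed simp

lemma abs_le_one_plus_powr:
  fixes x q :: real
  assumes "1 \<le> q"
  shows "\<bar>x\<bar> \<le> 1 + \<bar>x\<bar> powr q"
proof (cases "\<bar>x\<bar> \<le> 1")
  case False
  then have "\<bar>x\<bar> powr 1 \<le> \<bar>x\<bar> powr q" using assms by (intro powr_mono) auto
  then show ?thesis by simp
qed (simp add: add_increasing2)

lemma (in prob_space) integrable_of_abs_powr:
  fixes g :: "'a \<Rightarrow> real"
  assumes "1 \<le> q" and g: "g \<in> borel_measurable M" and gq: "integrable M (\<lambda>x. \<bar>g x\<bar> powr q)"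
  shows "integrable M g"
proof (rule Bochner_Integration.integrable_bound[OF _ g])
  show "integrable M (\<lambda>x. 1 + \<bar>g x\<bar> powr q)" using gq by simp
  show "AE x in M. norm (g x) \<le> norm (1 + \<bar>g x\<bar> powr q)"
  proof (rule AE_I2)
    fix x show "norm (g x) \<le> norm (1 + \<bar>g x\<bar> powr q)"
      using abs_le_one_plus_powr[OF assms(1), of "g x"] abs_ge_self[of "1 + \<bar>g x\<bar> powr q"]
      unfolding real_norm_def by linarith
  qed
qed

text \<open>
  Conditional expectations contract the norm of order \<open>q\<close>: Jensen's inequality in the second coordinate, then
  Fubini. The conditional mean need only make sense for almost every \<open>x\<close>.
\<close>

lemma conditional_mean_powr:
  fixes f :: "'a \<times> 'b \<Rightarrow> real"
  assumes "prob_space A" "prob_space B" and q: "1 \<le> q"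
    and f[measurable]: "f \<in> borel_measurable (A \<Otimes>\<^sub>M B)"
    and fq: "integrable (A \<Otimes>\<^sub>M B) (\<lambda>z. \<bar>f z\<bar> powr q)"
  shows "AE x in A. integrable B (\<lambda>y. f (x, y))"
    and "integrable A (\<lambda>x. \<bar>\<integral>y. f (x, y) \<partial>B\<bar> powr q)"
    and "(\<integral>x. \<bar>\<integral>y. f (x, y) \<partial>B\<bar> powr q \<partial>A) \<le> (\<integral>z. \<bar>f z\<bar> powr q \<partial>(A \<Otimes>\<^sub>M B))"
proof -
  interpret A: prob_space A by fact
  interpret B: prob_space B by fact
  interpret AB: pair_prob_space A B ..
  have ae: "AE x in A. integrable B (\<lambda>y. f (x, y)) \<and> integrable B (\<lambda>y. \<bar>f (x, y)\<bar> powr q)"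
    using AB.AE_integrable_fst'[OF fq] AE_space
  proof eventually_elim
    case (elim x)
    then have [measurable]: "(\<lambda>y. f (x, y)) \<in> borel_measurable B" by simp
    show ?case using elim B.integrable_of_abs_powr[OF q, of "\<lambda>y. f (x, y)"] by simp
  qed
  then show "AE x in A. integrable B (\<lambda>y. f (x, y))" by eventually_elim simp
  have le: "AE x in A. \<bar>\<integral>y. f (x, y) \<partial>B\<bar> powr q \<le> (\<integral>y. \<bar>f (x, y)\<bar> powr q \<partial>B)"
    using ae
  proof eventually_elim
    case (elim x)
    then show ?case
      by (intro B.jensens_inequality[where I = UNIV, OF _ _ _ _ convex_on_abs_powr[OF q]]) auto
  qed
  have i2: "integrable A (\<lambda>x. \<integral>y. \<bar>f (x, y)\<bar> powr q \<partial>B)"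
    using AB.integrable_fst'[OF fq] by simp
  show i1: "integrable A (\<lambda>x. \<bar>\<integral>y. f (x, y) \<partial>B\<bar> powr q)"
  proof (rule Bochner_Integration.integrable_bound[OF i2])
    show "AE x in A. norm (\<bar>\<integral>y. f (x, y) \<partial>B\<bar> powr q) \<le> norm (\<integral>y. \<bar>f (x, y)\<bar> powr q \<partial>B)"
      using le by eventually_elim (smt (verit) powr_ge_zero real_norm_def)
  qed measurable
  show "(\<integral>x. \<bar>\<integral>y. f (x, y) \<partial>B\<bar> powr q \<partial>A) \<le> (\<integral>z. \<bar>f z\<bar> powr q \<partial>(A \<Otimes>\<^sub>M B))"
    unfolding AB.integral_fst'[OF fq, symmetric] by (rule integral_mono_AE[OF i1 i2 le])
qed

lemma conditional_mean_square:
  fixes f :: "'a \<times> 'b \<Rightarrow> real"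
  assumes "prob_space A" "prob_space B"
    and "f \<in> borel_measurable (A \<Otimes>\<^sub>M B)" "integrable (A \<Otimes>\<^sub>M B) (\<lambda>z. (f z)^2)"
  shows "AE x in A. integrable B (\<lambda>y. f (x, y))"
    and "integrable A (\<lambda>x. (\<integral>y. f (x, y) \<partial>B)^2)"
    and "(\<integral>x. (\<integral>y. f (x, y) \<partial>B)^2 \<partial>A) \<le> (\<integral>z. (f z)^2 \<partial>(A \<Otimes>\<^sub>M B))"
proof -
  have [simp]: "\<bar>x\<bar> powr 2 = x^2" for x :: real by (simp add: powr_numeral)
  show "AE x in A. integrable B (\<lambda>y. f (x, y))"
    and "integrable A (\<lambda>x. (\<integral>y. f (x, y) \<partial>B)^2)"
    and "(\<integral>x. (\<integral>y. f (x, y) \<partial>B)^2 \<partial>A) \<le> (\<integral>z. (f z)^2 \<partial>(A \<Otimes>\<^sub>M B))"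
    using conditional_mean_powr[OF assms(1,2) _ assms(3), of 2] assms(4) by simp_all
qed

lemma product_integral:
  fixes f :: "'a \<Rightarrow> real" and g :: "'b \<Rightarrow> real"
  assumes "prob_space A" "prob_space B" and f: "integrable A f" and g: "integrable B g"
  shows "(\<integral>z. f (fst z) * g (snd z) \<partial>(A \<Otimes>\<^sub>M B)) = (\<integral>x. f x \<partial>A) * (\<integral>y. g y \<partial>B)"
    and "integrable (A \<Otimes>\<^sub>M B) (\<lambda>z. f (fst z) * g (snd z))"
proof -
  interpret A: prob_space A by fact
  interpret B: prob_space B by fact
  interpret AB: pair_prob_space A B ..
  have [measurable]: "f \<in> borel_measurable A" "g \<in> borel_measurable B" using f g by auto
  show int: "integrable (A \<Otimes>\<^sub>M B) (\<lambda>z. f (fst z) * g (snd z))"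
    by (rule AB.Fubini_integrable) (use f g in \<open>auto simp: abs_mult\<close>)
  show "(\<integral>z. f (fst z) * g (snd z) \<partial>(A \<Otimes>\<^sub>M B)) = (\<integral>x. f x \<partial>A) * (\<integral>y. g y \<partial>B)"
    using AB.integral_fst'[OF int] by simp
qed

lemma integral_fst_function:
  fixes f :: "'a \<Rightarrow> real"
  assumes "prob_space A" "prob_space B" "integrable A f"
  shows "integrable (A \<Otimes>\<^sub>M B) (\<lambda>z. f (fst z))" "(\<integral>z. f (fst z) \<partial>(A \<Otimes>\<^sub>M B)) = (\<integral>x. f x \<partial>A)"
  using product_integral[OF assms(1-3), of "\<lambda>_. 1"] finite_measure.integrable_const[of B "1::real"]
    prob_space.prob_space[OF assms(2)] assms(2) prob_space.finite_measure[OF assms(2)]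
  by auto

lemma integral_snd_function:
  fixes f :: "'b \<Rightarrow> real"
  assumes "prob_space A" "prob_space B" "integrable B f"
  shows "integrable (A \<Otimes>\<^sub>M B) (\<lambda>z. f (snd z))" "(\<integral>z. f (snd z) \<partial>(A \<Otimes>\<^sub>M B)) = (\<integral>x. f x \<partial>B)"
  using product_integral[OF assms(1,2) _ assms(3), of "\<lambda>_. 1"] finite_measure.integrable_const[of A "1::real"]
    prob_space.prob_space[OF assms(1)] prob_space.finite_measure[OF assms(1)]
  by auto

text \<open>
  A crude replacement for Minkowski's inequality: every summand is dominated by the largest one.
\<close>

lemma abs_sum_powr_le:
  fixes a :: "'i \<Rightarrow> real"
  assumes I: "finite I" and q: "0 < q"
  shows "\<bar>\<Sum>i\<in>I. a i\<bar> powr q \<le> real (card I) powr q * (\<Sum>i\<in>I. \<bar>a i\<bar> powr q)"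
proof (cases "I = {}")
  case False
  define m where "m = Max ((\<lambda>i. \<bar>a i\<bar>) ` I)"
  have "m \<in> (\<lambda>i. \<bar>a i\<bar>) ` I" unfolding m_def using I False by (intro Max_in) auto
  then obtain j where j: "j \<in> I" "m = \<bar>a j\<bar>" by blast
  have "\<bar>\<Sum>i\<in>I. a i\<bar> \<le> (\<Sum>i\<in>I. \<bar>a i\<bar>)" by (rule sum_abs)
  also have "\<dots> \<le> real (card I) * m"
    using I by (intro sum_bounded_above) (auto simp: m_def)
  finally have "\<bar>\<Sum>i\<in>I. a i\<bar> powr q \<le> (real (card I) * m) powr q"
    using q by (intro powr_mono2) auto
  also have "\<dots> = real (card I) powr q * \<bar>a j\<bar> powr q" using j by (simp add: powr_mult)
  also have "\<dots> \<le> real (card I) powr q * (\<Sum>i\<in>I. \<bar>a i\<bar> powr q)"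
    using I j(1) by (intro mult_left_mono member_le_sum) auto
  finally show ?thesis .
qed (use q in simp)

section \<open>Mixtures of two probability laws\<close>

locale two_laws =
  fixes S P Q :: "'a measure" and \<rho> :: real
  assumes P_prob: "prob_space P" and Q_prob: "prob_space Q"
    and sets_P [measurable_cong]: "sets P = sets S" and sets_Q [measurable_cong]: "sets Q = sets S"
    and rho_pos: "0 < \<rho>" and rho_less: "\<rho> < 1"
begin

abbreviation R where "R \<equiv> mixture \<rho> P Q"

lemma measurable_mixture_kernel:
  "(\<lambda>b. if b then P else Q) \<in> measurable (measure_pmf (bernoulli_pmf \<rho>)) (subprob_algebra S)"
  using P_prob Q_prob
  by (auto simp: measurable_def space_subprob_algebra sets_P sets_Q prob_space_imp_subprob_space)

lemma sets_R [measurable_cong]: "sets R = sets S"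
  unfolding mixture_def
  by (rule sets_bind[of _ _ S]) (auto simp: sets_P sets_Q)

lemma space_laws: "space P = space S" "space Q = space S" "space R = space S"
  using sets_P sets_Q sets_R by (auto dest: sets_eq_imp_space_eq)

lemma nn_integral_mixture:
  assumes "f \<in> borel_measurable S"
  shows "(\<integral>\<^sup>+x. f x \<partial>R) = ennreal \<rho> * (\<integral>\<^sup>+x. f x \<partial>P) + ennreal (1 - \<rho>) * (\<integral>\<^sup>+x. f x \<partial>Q)"
  unfolding mixture_def
  by (subst nn_integral_bind[OF assms measurable_mixture_kernel])
     (use rho_pos rho_less in \<open>simp add: mult.commute\<close>)

lemma emeasure_mixture:
  assumes "A \<in> sets S"
  shows "emeasure R A = ennreal \<rho> * emeasure P A + ennreal (1 - \<rho>) * emeasure Q A"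
  using nn_integral_mixture[of "indicator A"] assms by (simp add: sets_P sets_Q sets_R)

lemma R_prob: "prob_space R"
proof
  have "ennreal \<rho> + ennreal (1 - \<rho>) = 1"
    using rho_pos rho_less by (simp flip: ennreal_plus)
  then show "emeasure R (space R) = 1"
    using prob_space.emeasure_space_1[OF P_prob] prob_space.emeasure_space_1[OF Q_prob]
    by (simp add: emeasure_mixture space_laws)
qed

text \<open>
  The factor \<open>1 / (\<rho> * (1 - \<rho>))\<close> exceeds both \<open>1 / \<rho>\<close> and \<open>1 / (1 - \<rho>)\<close>, so that one constant serves both
  components of the mixture.
\<close>

lemma nn_integral_le_mixture:
  assumes "f \<in> borel_measurable S" and D: "D = P \<or> D = Q"
  shows "(\<integral>\<^sup>+x. f x \<partial>D) \<le> ennreal (1 / (\<rho> * (1 - \<rho>))) * (\<integral>\<^sup>+x. f x \<partial>R)"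
proof -
  have c: "ennreal (1 / (\<rho> * (1 - \<rho>))) * ennreal a \<ge> 1" if "a = \<rho> \<or> a = 1 - \<rho>" for a
  proof -
    have "1 \<le> 1 / (\<rho> * (1 - \<rho>)) * a"
    proof (cases "a = \<rho>")
      case False
      then have "1 / (\<rho> * (1 - \<rho>)) * a = 1 / \<rho>" using that rho_less by simp
      then show ?thesis using rho_pos rho_less by simp
    qed (use rho_pos rho_less in simp)
    moreover have "ennreal (1 / (\<rho> * (1 - \<rho>))) * ennreal a = ennreal (1 / (\<rho> * (1 - \<rho>)) * a)"
      using rho_pos rho_less by (intro ennreal_mult'[symmetric]) simp
    ultimately show ?thesis by (simp add: ennreal_ge_1)
  qed
  obtain a where a: "a = \<rho> \<or> a = 1 - \<rho>" and le: "ennreal a * (\<integral>\<^sup>+x. f x \<partial>D) \<le> (\<integral>\<^sup>+x. f x \<partial>R)"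
    using D
  proof
    assume "D = P"
    then show ?thesis by (intro that[of \<rho>]) (simp_all add: nn_integral_mixture[OF assms(1)])
  next
    assume "D = Q"
    then show ?thesis by (intro that[of "1 - \<rho>"]) (simp_all add: nn_integral_mixture[OF assms(1)])
  qed
  have "(\<integral>\<^sup>+x. f x \<partial>D) \<le> (ennreal (1 / (\<rho> * (1 - \<rho>))) * ennreal a) * (\<integral>\<^sup>+x. f x \<partial>D)"
    using mult_right_mono[OF c[OF a]] by simp
  also have "\<dots> \<le> ennreal (1 / (\<rho> * (1 - \<rho>))) * (\<integral>\<^sup>+x. f x \<partial>R)"
    unfolding mult.assoc by (rule mult_left_mono[OF le]) simp
  finally show ?thesis .
qed

lemma AE_mixture:
  assumes [measurable]: "Measurable.pred S A"
  shows "(AE x in R. A x) \<longleftrightarrow> (AE x in P. A x) \<and> (AE x in Q. A x)"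
proof -
  define B where "B = {x\<in>space S. \<not> A x}"
  have B: "B \<in> sets S" unfolding B_def by measurable
  have "(AE x in D. A x) \<longleftrightarrow> emeasure D B = 0" if "sets D = sets S" for D
    using that B by (intro AE_iff_measurable) (auto simp: B_def dest: sets_eq_imp_space_eq)
  then show ?thesis
    using rho_pos rho_less by (simp add: sets_P sets_Q sets_R emeasure_mixture[OF B] ennreal_eq_0_iff)
qed

lemma integrable_mixture:
  fixes f :: "'a \<Rightarrow> real"
  assumes "integrable R f"
  shows "integrable P f" "integrable Q f"
proof -
  have [measurable]: "f \<in> borel_measurable S"
    using borel_measurable_integrable[OF assms] by simp
  have fin: "(\<integral>\<^sup>+x. ennreal (norm (f x)) \<partial>D) < \<infinity>" if "D = P \<or> D = Q" for D
    using nn_integral_le_mixture[OF _ that, of "\<lambda>x. ennreal (norm (f x))"] assms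
    by (auto simp: integrable_iff_bounded ennreal_mult_less_top elim!: le_less_trans)
  then show "integrable P f" "integrable Q f"
    by (simp_all add: integrable_iff_bounded)
qed

lemma integral_mixture:
  fixes f :: "'a \<Rightarrow> real"
  assumes f: "integrable R f"
  shows "(\<integral>x. f x \<partial>R) = \<rho> * (\<integral>x. f x \<partial>P) + (1 - \<rho>) * (\<integral>x. f x \<partial>Q)"
proof -
  have [measurable]: "f \<in> borel_measurable S"
    using borel_measurable_integrable[OF f] by simp
  have split: "enn2real (\<integral>\<^sup>+x. ennreal (u x) \<partial>R)
      = \<rho> * enn2real (\<integral>\<^sup>+x. ennreal (u x) \<partial>P) + (1 - \<rho>) * enn2real (\<integral>\<^sup>+x. ennreal (u x) \<partial>Q)"
    if [measurable]: "u \<in> borel_measurable S" and u: "\<forall>x. u x \<le> norm (f x)" for u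
  proof -
    have fin: "(\<integral>\<^sup>+x. ennreal (u x) \<partial>D) < \<top>" if "integrable D f" for D
      using that u by (auto simp: integrable_iff_bounded ennreal_leI
          intro!: le_less_trans[OF nn_integral_mono[of D "\<lambda>x. ennreal (u x)" "\<lambda>x. ennreal (norm (f x))"]])
    show ?thesis
      using fin[OF integrable_mixture(1)[OF f]] fin[OF integrable_mixture(2)[OF f]] rho_pos rho_less
      by (subst nn_integral_mixture)
         (auto simp: enn2real_plus enn2real_mult ennreal_mult_less_top)
  qed
  have dec: "(\<integral>x. f x \<partial>D) = enn2real (\<integral>\<^sup>+x. ennreal (f x) \<partial>D) - enn2real (\<integral>\<^sup>+x. ennreal (- f x) \<partial>D)"
    if "integrable D f" for D
    using that by (rule real_lebesgue_integral_def)
  show ?thesis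
    unfolding dec[OF f] dec[OF integrable_mixture(1)[OF f]] dec[OF integrable_mixture(2)[OF f]]
    using split[of f] split[of "\<lambda>x. - f x"]
    by (simp add: algebra_simps abs_ge_self abs_ge_minus_self)
qed

end

text \<open>
  A product with a mixture is a mixture of products. This turns every statement about integrals against one
  mixture into one about integrals against \<open>R \<Otimes>\<^sub>M R\<close>, by applying it to each coordinate in turn.
\<close>

lemma two_laws_pair_left:
  assumes "two_laws S P Q \<rho>" and "prob_space B" and B: "sets B = sets T"
  shows "two_laws (S \<Otimes>\<^sub>M T) (P \<Otimes>\<^sub>M B) (Q \<Otimes>\<^sub>M B) \<rho>"
    and "mixture \<rho> P Q \<Otimes>\<^sub>M B = mixture \<rho> (P \<Otimes>\<^sub>M B) (Q \<Otimes>\<^sub>M B)"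
proof -
  interpret A: two_laws S P Q \<rho> by fact
  interpret B: prob_space B by fact
  interpret P: prob_space P by (rule A.P_prob)
  interpret Q: prob_space Q by (rule A.Q_prob)
  interpret R: prob_space A.R by (rule A.R_prob)
  note B[measurable_cong]
  have sets: "sets (D \<Otimes>\<^sub>M B) = sets (S \<Otimes>\<^sub>M T)" if "sets D = sets S" for D
    using that B by (rule sets_pair_measure_cong)
  show C: "two_laws (S \<Otimes>\<^sub>M T) (P \<Otimes>\<^sub>M B) (Q \<Otimes>\<^sub>M B) \<rho>"
    by (intro two_laws.intro prob_space_pair A.P_prob A.Q_prob B.prob_space_axioms sets
        A.sets_P A.sets_Q A.rho_pos A.rho_less)
  interpret C: two_laws "S \<Otimes>\<^sub>M T" "P \<Otimes>\<^sub>M B" "Q \<Otimes>\<^sub>M B" \<rho> by (rule C)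
  show "A.R \<Otimes>\<^sub>M B = C.R"
  proof (rule measure_eqI)
    show "sets (A.R \<Otimes>\<^sub>M B) = sets C.R"
      by (simp add: sets A.sets_R C.sets_R)
    fix X assume "X \<in> sets (A.R \<Otimes>\<^sub>M B)"
    then have X[measurable]: "X \<in> sets (S \<Otimes>\<^sub>M T)" by (simp add: sets A.sets_R)
    have XB: "X \<in> sets (S \<Otimes>\<^sub>M B)" using X by (simp add: sets)
    have "emeasure (A.R \<Otimes>\<^sub>M B) X = (\<integral>\<^sup>+x. emeasure B (Pair x -` X) \<partial>A.R)"
      using X by (intro B.emeasure_pair_measure_alt) (simp add: sets A.sets_R)
    also have "\<dots> = ennreal \<rho> * (\<integral>\<^sup>+x. emeasure B (Pair x -` X) \<partial>P)
        + ennreal (1 - \<rho>) * (\<integral>\<^sup>+x. emeasure B (Pair x -` X) \<partial>Q)"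
      by (rule A.nn_integral_mixture[OF B.measurable_emeasure_Pair[OF XB]])
    also have "\<dots> = emeasure C.R X"
      using X by (simp add: C.emeasure_mixture B.emeasure_pair_measure_alt sets A.sets_P A.sets_Q)
    finally show "emeasure (A.R \<Otimes>\<^sub>M B) X = emeasure C.R X" .
  qed
qed

lemma two_laws_pair_right:
  assumes "two_laws S P Q \<rho>" and "prob_space B" and B: "sets B = sets T"
  shows "two_laws (T \<Otimes>\<^sub>M S) (B \<Otimes>\<^sub>M P) (B \<Otimes>\<^sub>M Q) \<rho>"
    and "B \<Otimes>\<^sub>M mixture \<rho> P Q = mixture \<rho> (B \<Otimes>\<^sub>M P) (B \<Otimes>\<^sub>M Q)"
proof -
  interpret A: two_laws S P Q \<rho> by fact
  interpret B: prob_space B by fact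
  interpret P: prob_space P by (rule A.P_prob)
  interpret Q: prob_space Q by (rule A.Q_prob)
  interpret R: prob_space A.R by (rule A.R_prob)
  note B[measurable_cong]
  have sets: "sets (B \<Otimes>\<^sub>M D) = sets (T \<Otimes>\<^sub>M S)" if "sets D = sets S" for D
    using B that by (rule sets_pair_measure_cong)
  show C: "two_laws (T \<Otimes>\<^sub>M S) (B \<Otimes>\<^sub>M P) (B \<Otimes>\<^sub>M Q) \<rho>"
    by (intro two_laws.intro prob_space_pair A.P_prob A.Q_prob B.prob_space_axioms sets
        A.sets_P A.sets_Q A.rho_pos A.rho_less)
  interpret C: two_laws "T \<Otimes>\<^sub>M S" "B \<Otimes>\<^sub>M P" "B \<Otimes>\<^sub>M Q" \<rho> by (rule C)
  show "B \<Otimes>\<^sub>M A.R = C.R"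
  proof (rule measure_eqI)
    show "sets (B \<Otimes>\<^sub>M A.R) = sets C.R"
      by (simp add: sets A.sets_R C.sets_R)
    fix X assume "X \<in> sets (B \<Otimes>\<^sub>M A.R)"
    then have X[measurable]: "X \<in> sets (T \<Otimes>\<^sub>M S)" by (simp add: sets A.sets_R)
    have alt: "emeasure (B \<Otimes>\<^sub>M D) X = (\<integral>\<^sup>+x. emeasure D (Pair x -` X) \<partial>B)"
      and mb: "(\<lambda>x. emeasure D (Pair x -` X)) \<in> borel_measurable B"
      if "sets D = sets S" "prob_space D" for D
    proof -
      interpret D: prob_space D by fact
      have XD: "X \<in> sets (B \<Otimes>\<^sub>M D)" using X that by (simp add: sets)
      show "emeasure (B \<Otimes>\<^sub>M D) X = (\<integral>\<^sup>+x. emeasure D (Pair x -` X) \<partial>B)"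
        by (rule D.emeasure_pair_measure_alt[OF XD])
      show "(\<lambda>x. emeasure D (Pair x -` X)) \<in> borel_measurable B"
        by (rule D.measurable_emeasure_Pair[OF XD])
    qed
    have sec: "Pair x -` X \<in> sets S" for x using X by (rule sets_Pair1)
    show "emeasure (B \<Otimes>\<^sub>M A.R) X = emeasure C.R X"
      using X mb[OF A.sets_P A.P_prob] mb[OF A.sets_Q A.Q_prob]
      by (simp add: C.emeasure_mixture alt A.sets_P A.sets_Q A.sets_R A.P_prob A.Q_prob A.R_prob
          A.emeasure_mixture sec nn_integral_add nn_integral_cmult)
  qed
qed

context two_laws
begin

abbreviation c\<rho> where "c\<rho> \<equiv> 1 / (\<rho> * (1 - \<rho>))"

lemma integral_le_mixture:
  fixes f :: "'a \<Rightarrow> real"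
  assumes f: "integrable R f" "\<And>x. 0 \<le> f x" and D: "D = P \<or> D = Q"
  shows "(\<integral>x. f x \<partial>D) \<le> c\<rho> * (\<integral>x. f x \<partial>R)"
proof -
  define a b where "a = (\<integral>x. f x \<partial>P)" and "b = (\<integral>x. f x \<partial>Q)"
  have ab: "0 \<le> a" "0 \<le> b" using f(2) by (auto simp: a_def b_def intro!: integral_nonneg_AE)
  have "\<rho> * (1 - \<rho>) \<le> \<rho>" "\<rho> * (1 - \<rho>) \<le> 1 - \<rho>"
    using rho_pos rho_less by (auto intro: mult_left_le mult_left_le_one_le)
  then have "\<rho> * (1 - \<rho>) * a \<le> \<rho> * a" "\<rho> * (1 - \<rho>) * b \<le> (1 - \<rho>) * b"
    using ab by (auto intro: mult_right_mono)
  moreover have "0 \<le> \<rho> * a" "0 \<le> (1 - \<rho>) * b" using rho_pos rho_less ab by auto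
  ultimately have "\<rho> * (1 - \<rho>) * (\<integral>x. f x \<partial>D) \<le> (\<integral>x. f x \<partial>R)"
    using D integral_mixture[OF f(1)] by (auto simp: a_def b_def)
  then show ?thesis using rho_pos rho_less by (simp add: field_simps)
qed

lemma two_laws_self: "two_laws S P Q \<rho>"
  by unfold_locales

lemma law_cases_prob: "D = P \<or> D = Q \<Longrightarrow> prob_space D" "D = P \<or> D = Q \<Longrightarrow> sets D = sets S"
  using P_prob Q_prob sets_P sets_Q by auto

lemma pair_of_mixtures:
  assumes D: "D = P \<or> D = Q"
  shows "two_laws (S \<Otimes>\<^sub>M S) (R \<Otimes>\<^sub>M P) (R \<Otimes>\<^sub>M Q) \<rho>" "R \<Otimes>\<^sub>M R = mixture \<rho> (R \<Otimes>\<^sub>M P) (R \<Otimes>\<^sub>M Q)"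
    and "two_laws (S \<Otimes>\<^sub>M S) (P \<Otimes>\<^sub>M D) (Q \<Otimes>\<^sub>M D) \<rho>" "R \<Otimes>\<^sub>M D = mixture \<rho> (P \<Otimes>\<^sub>M D) (Q \<Otimes>\<^sub>M D)"
  using two_laws_pair_right[OF two_laws_self R_prob sets_R]
    two_laws_pair_left[OF two_laws_self law_cases_prob[OF D]] by auto

lemma integrable_pair_mixture:
  fixes f :: "'a \<times> 'a \<Rightarrow> real"
  assumes f: "integrable (R \<Otimes>\<^sub>M R) f" and D: "D = P \<or> D = Q" "D' = P \<or> D' = Q"
  shows "integrable (R \<Otimes>\<^sub>M D') f" "integrable (D \<Otimes>\<^sub>M D') f"
proof -
  interpret A: two_laws "S \<Otimes>\<^sub>M S" "R \<Otimes>\<^sub>M P" "R \<Otimes>\<^sub>M Q" \<rho> by (rule pair_of_mixtures(1)[OF D(2)])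
  interpret B: two_laws "S \<Otimes>\<^sub>M S" "P \<Otimes>\<^sub>M D'" "Q \<Otimes>\<^sub>M D'" \<rho> by (rule pair_of_mixtures(3)[OF D(2)])
  show 1: "integrable (R \<Otimes>\<^sub>M D') f"
    using A.integrable_mixture[of f] f D(2) by (auto simp: pair_of_mixtures(2)[OF D(2)])
  then show "integrable (D \<Otimes>\<^sub>M D') f"
    using B.integrable_mixture[of f] D(1) by (auto simp: pair_of_mixtures(4)[OF D(2)])
qed

lemma integral_pair_mixture:
  fixes f :: "'a \<times> 'a \<Rightarrow> real"
  assumes f: "integrable (R \<Otimes>\<^sub>M R) f"
  shows "(\<integral>z. f z \<partial>(R \<Otimes>\<^sub>M R)) = \<rho>^2 * (\<integral>z. f z \<partial>(P \<Otimes>\<^sub>M P))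
    + \<rho> * (1 - \<rho>) * ((\<integral>z. f z \<partial>(P \<Otimes>\<^sub>M Q)) + (\<integral>z. f z \<partial>(Q \<Otimes>\<^sub>M P)))
    + (1 - \<rho>)^2 * (\<integral>z. f z \<partial>(Q \<Otimes>\<^sub>M Q))"
proof -
  have 1: "(\<integral>z. f z \<partial>(R \<Otimes>\<^sub>M R)) = \<rho> * (\<integral>z. f z \<partial>(R \<Otimes>\<^sub>M P)) + (1 - \<rho>) * (\<integral>z. f z \<partial>(R \<Otimes>\<^sub>M Q))"
    using two_laws.integral_mixture[OF pair_of_mixtures(1), of P f] pair_of_mixtures(2)[of P] f by simp
  have 2: "(\<integral>z. f z \<partial>(R \<Otimes>\<^sub>M D)) = \<rho> * (\<integral>z. f z \<partial>(P \<Otimes>\<^sub>M D)) + (1 - \<rho>) * (\<integral>z. f z \<partial>(Q \<Otimes>\<^sub>M D))"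
    if "D = P \<or> D = Q" for D
    using two_laws.integral_mixture[OF pair_of_mixtures(3)[OF that], of f] pair_of_mixtures(4)[OF that]
      integrable_pair_mixture(1)[OF f that that] by simp
  show ?thesis unfolding 1 by (simp add: 2 power2_eq_square algebra_simps)
qed

lemma integral_pair_le_mixture:
  fixes f :: "'a \<times> 'a \<Rightarrow> real"
  assumes f: "integrable (R \<Otimes>\<^sub>M R) f" "\<And>z. 0 \<le> f z" and D: "D = P \<or> D = Q" "D' = P \<or> D' = Q"
  shows "(\<integral>z. f z \<partial>(D \<Otimes>\<^sub>M D')) \<le> c\<rho>^2 * (\<integral>z. f z \<partial>(R \<Otimes>\<^sub>M R))"
proof -
  have "(\<integral>z. f z \<partial>(D \<Otimes>\<^sub>M D')) \<le> c\<rho> * (\<integral>z. f z \<partial>(R \<Otimes>\<^sub>M D'))"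
    using two_laws.integral_le_mixture[OF pair_of_mixtures(3)[OF D(2)], of f "D \<Otimes>\<^sub>M D'"]
      pair_of_mixtures(4)[OF D(2)] integrable_pair_mixture(1)[OF f(1) D] f(2) D(1) by auto
  also have "\<dots> \<le> c\<rho> * (c\<rho> * (\<integral>z. f z \<partial>(R \<Otimes>\<^sub>M R)))"
    using two_laws.integral_le_mixture[OF pair_of_mixtures(1)[OF D(2)], of f "R \<Otimes>\<^sub>M D'"]
      pair_of_mixtures(2)[OF D(2)] f D(2) rho_pos rho_less by (intro mult_left_mono) auto
  finally show ?thesis by (simp add: power2_eq_square)
qed

lemma AE_pair_mixture:
  assumes A: "Measurable.pred (S \<Otimes>\<^sub>M S) A" and ae: "AE z in R \<Otimes>\<^sub>M R. A z"
    and D: "D = P \<or> D = Q" "D' = P \<or> D' = Q"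
  shows "AE z in D \<Otimes>\<^sub>M D'. A z"
proof -
  have "AE z in mixture \<rho> (R \<Otimes>\<^sub>M P) (R \<Otimes>\<^sub>M Q). A z"
    using ae unfolding pair_of_mixtures(2)[OF D(2)] .
  then have "AE z in R \<Otimes>\<^sub>M D'. A z"
    using two_laws.AE_mixture[OF pair_of_mixtures(1)[OF D(2)] A] D(2) by blast
  then have "AE z in mixture \<rho> (P \<Otimes>\<^sub>M D') (Q \<Otimes>\<^sub>M D'). A z"
    unfolding pair_of_mixtures(4)[OF D(2)] .
  then show ?thesis
    using two_laws.AE_mixture[OF pair_of_mixtures(3)[OF D(2)] A] D(1) by blast
qed

end

section \<open>The doubly centred kernel\<close>

locale two_laws_kernel = two_laws S P Q \<rho>
  for S P Q :: "'a measure" and \<rho> :: real +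
  fixes k :: "'a \<Rightarrow> 'a \<Rightarrow> real"
  assumes k_measurable [measurable]: "(\<lambda>z. k (fst z) (snd z)) \<in> borel_measurable (S \<Otimes>\<^sub>M S)"
    and k_sym: "x \<in> space S \<Longrightarrow> y \<in> space S \<Longrightarrow> k x y = k y x"
    and k_moment4: "integrable (R \<Otimes>\<^sub>M R) (\<lambda>z. (k (fst z) (snd z))^4)"
begin

sublocale R: prob_space R by (rule R_prob)
sublocale RR: pair_prob_space R R ..

text \<open>
  The function \<open>h\<close> is the projection of the kernel onto the functions with vanishing conditional means under \<open>R\<close>;
  its squared norm is the kernel variance.
\<close>

definition g where "g x = (\<integral>y. k x y \<partial>R)"
definition c where "c = pair_expectation k R R"
definition h where "h x y = k x y - g x - g y + c"

lemma k_measurable_compose [measurable (raw)]: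
  assumes "u \<in> measurable M S" "v \<in> measurable M S"
  shows "(\<lambda>x. k (u x) (v x)) \<in> borel_measurable M"
  using measurable_compose[OF measurable_Pair[OF assms] k_measurable] by simp

lemma g_measurable [measurable]: "g \<in> borel_measurable S"
proof -
  have "(\<lambda>z. k (fst z) (snd z)) \<in> borel_measurable (S \<Otimes>\<^sub>M R)" by measurable
  then have "(\<lambda>x. \<integral>y. k (fst (x, y)) (snd (x, y)) \<partial>R) \<in> borel_measurable S"
    by (intro R.borel_measurable_lebesgue_integral) (simp add: split_beta)
  then show ?thesis by (simp add: g_def[abs_def])
qed

lemma h_measurable [measurable]: "(\<lambda>z. h (fst z) (snd z)) \<in> borel_measurable (S \<Otimes>\<^sub>M S)"
  unfolding h_def by measurable

lemma k_square_integrable: "integrable (R \<Otimes>\<^sub>M R) (\<lambda>z. (k (fst z) (snd z))^2)"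
proof (rule RR.square_integrable_imp_integrable)
  show "integrable (R \<Otimes>\<^sub>M R) (\<lambda>z. ((k (fst z) (snd z))^2)^2)"
    using k_moment4 by (simp add: power_mult[symmetric])
qed measurable

lemma k_integrable: "integrable (R \<Otimes>\<^sub>M R) (\<lambda>z. k (fst z) (snd z))"
  by (rule RR.square_integrable_imp_integrable[OF _ k_square_integrable]) measurable

lemma k_section_integrable: "AE x in R. integrable R (k x)"
  and g_square_integrable: "integrable R (\<lambda>x. (g x)^2)"
  using conditional_mean_square[OF R_prob R_prob _ k_square_integrable] by (simp_all add: g_def)

lemma g_integrable: "integrable R g"
  by (rule R.square_integrable_imp_integrable[OF _ g_square_integrable]) measurable

lemma g_integral: "(\<integral>x. g x \<partial>R) = c"
  using RR.integral_fst'[OF k_integrable] by (simp add: g_def[abs_def] c_def pair_expectation_def)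

lemma swap_integral:
  fixes f :: "'a \<Rightarrow> 'a \<Rightarrow> real"
  assumes [measurable]: "(\<lambda>z. f (fst z) (snd z)) \<in> borel_measurable (S \<Otimes>\<^sub>M S)"
    and D: "prob_space D" "prob_space D'" and sD[measurable_cong]: "sets D = sets S" "sets D' = sets S"
    and sym: "\<And>x y. x \<in> space S \<Longrightarrow> y \<in> space S \<Longrightarrow> f x y = f' y x"
  shows "(\<integral>z. f (fst z) (snd z) \<partial>(D \<Otimes>\<^sub>M D')) = (\<integral>z. f' (fst z) (snd z) \<partial>(D' \<Otimes>\<^sub>M D))"
proof -
  interpret D: prob_space D by fact
  interpret D': prob_space D' by fact
  interpret DD: pair_prob_space D D' ..
  have sp: "space D = space S" "space D' = space S" using sD by (auto dest: sets_eq_imp_space_eq)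
  have "(\<integral>z. f (fst z) (snd z) \<partial>(D \<Otimes>\<^sub>M D')) = (\<integral>(x, y). f y x \<partial>(D' \<Otimes>\<^sub>M D))"
    using DD.integral_product_swap[of "\<lambda>z. f (fst z) (snd z)"] by simp
  also have "\<dots> = (\<integral>z. f' (fst z) (snd z) \<partial>(D' \<Otimes>\<^sub>M D))"
    by (intro Bochner_Integration.integral_cong) (auto simp: space_pair_measure sp sym)
  finally show ?thesis .
qed

text \<open>
  Expanding \<open>h^2\<close>, every mixed term reduces to \<open>E g^2\<close> or to \<open>c^2\<close>: conditioning on the shared variable turns
  \<open>E k(Z, Z') g(Z)\<close> into \<open>E g^2\<close>, and the same conditioning evaluates the triple integral in the definition
  of the kernel variance.
\<close>

lemma h_square: "integrable (R \<Otimes>\<^sub>M R) (\<lambda>z. (h (fst z) (snd z))^2)"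
  and kernel_variance_eq: "kernel_variance k R = (\<integral>z. (h (fst z) (snd z))^2 \<partial>(R \<Otimes>\<^sub>M R))"
proof -
  let ?K = "\<lambda>z. k (fst z) (snd z)" and ?A = "\<lambda>z. g (fst z)" and ?B = "\<lambda>z. g (snd z)"
  let ?RR = "R \<Otimes>\<^sub>M R"
  have A: "integrable ?RR ?A" "integral\<^sup>L ?RR ?A = c"
    and A2: "integrable ?RR (\<lambda>z. (?A z)^2)" "(\<integral>z. (?A z)^2 \<partial>?RR) = (\<integral>x. (g x)^2 \<partial>R)"
    using integral_fst_function[OF R_prob R_prob g_integrable]
      integral_fst_function[OF R_prob R_prob g_square_integrable] g_integral by auto
  have B: "integrable ?RR ?B" "integral\<^sup>L ?RR ?B = c"
    and B2: "integrable ?RR (\<lambda>z. (?B z)^2)" "(\<integral>z. (?B z)^2 \<partial>?RR) = (\<integral>x. (g x)^2 \<partial>R)"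
    using integral_snd_function[OF R_prob R_prob g_integrable]
      integral_snd_function[OF R_prob R_prob g_square_integrable] g_integral by auto
  have AB: "integrable ?RR (\<lambda>z. ?A z * ?B z)" "(\<integral>z. ?A z * ?B z \<partial>?RR) = c * c"
    using product_integral[OF R_prob R_prob g_integrable g_integrable] g_integral by auto
  have product: "integrable ?RR (\<lambda>z. u z * v z)"
    if "integrable ?RR (\<lambda>z. (u z)^2)" "integrable ?RR (\<lambda>z. (v z)^2)"
      "u \<in> borel_measurable ?RR" "v \<in> borel_measurable ?RR" for u v :: "'a \<times> 'a \<Rightarrow> real"
  proof (rule Bochner_Integration.integrable_bound)
    show "integrable ?RR (\<lambda>z. (u z)^2 + (v z)^2)" using that by simp
    show "AE z in ?RR. norm (u z * v z) \<le> norm ((u z)^2 + (v z)^2)"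
      by (intro AE_I2) (simp add: abs_mult_le_sum_squares)
  qed (use that in measurable)
  have KA: "integrable ?RR (\<lambda>z. ?K z * ?A z)"
    by (rule product[OF k_square_integrable A2(1)]) measurable
  have KB: "integrable ?RR (\<lambda>z. ?K z * ?B z)"
    by (rule product[OF k_square_integrable B2(1)]) measurable
  have KA': "(\<integral>z. ?K z * ?A z \<partial>?RR) = (\<integral>x. (g x)^2 \<partial>R)"
    using RR.integral_fst'[OF KA] by (simp add: g_def[abs_def] power2_eq_square)
  have KB': "(\<integral>z. ?K z * ?B z \<partial>?RR) = (\<integral>x. (g x)^2 \<partial>R)"
    unfolding KA'[symmetric]
    by (rule swap_integral[of "\<lambda>x y. k x y * g y" R R "\<lambda>x y. k x y * g x"])
       (auto simp: sets_R k_sym intro: R_prob)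
  have expand: "(h (fst z) (snd z))^2 = (?K z)^2 + (?A z)^2 + (?B z)^2 + c^2
      - 2 * (?K z * ?A z) - 2 * (?K z * ?B z) + 2 * c * ?K z + 2 * (?A z * ?B z) - 2 * c * ?A z - 2 * c * ?B z" for z
    by (simp add: h_def power2_eq_square algebra_simps)
  show "integrable ?RR (\<lambda>z. (h (fst z) (snd z))^2)"
    unfolding expand using k_square_integrable k_integrable A A2 B B2 AB KA KB by simp
  have "(\<integral>z. (h (fst z) (snd z))^2 \<partial>?RR) = (\<integral>z. (?K z)^2 \<partial>?RR) - 2 * (\<integral>x. (g x)^2 \<partial>R) + c^2"
    unfolding expand using k_square_integrable k_integrable A A2 B B2 AB KA KB KA' KB'
    by (simp add: RR.prob_space c_def[symmetric, unfolded pair_expectation_def] power2_eq_square)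
  moreover have "(\<integral>z. k (fst z) (fst (snd z)) * k (fst z) (snd (snd z)) \<partial>(R \<Otimes>\<^sub>M ?RR)) = (\<integral>x. (g x)^2 \<partial>R)"
  proof -
    interpret R3: pair_prob_space R ?RR ..
    let ?T = "\<lambda>z. k (fst z) (fst (snd z)) * k (fst z) (snd (snd z))"
    have sq: "integrable ?RR (\<lambda>z. (\<bar>?K z\<bar>)^2)" using k_square_integrable by simp
    have ae: "AE x in R. (\<integral>y. ?T (x, y) \<partial>?RR) = (g x)^2 \<and> integrable ?RR (\<lambda>y. ?T (x, y))
        \<and> (\<integral>y. norm (?T (x, y)) \<partial>?RR) = (\<integral>y. \<bar>k x y\<bar> \<partial>R)^2"
      using k_section_integrable
    proof eventually_elim
      case (elim x)
      have "integrable R (\<lambda>y. \<bar>k x y\<bar>)" using elim by simp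
      from product_integral[OF R_prob R_prob this this] product_integral[OF R_prob R_prob elim elim]
      show ?case by (simp add: g_def power2_eq_square abs_mult)
    qed
    have "integrable R (\<lambda>x. (\<integral>y. \<bar>k x y\<bar> \<partial>R)^2)"
      using conditional_mean_square(2)[OF R_prob R_prob _ sq] by simp
    then have "integrable (R \<Otimes>\<^sub>M ?RR) ?T"
    proof (intro R3.Fubini_integrable)
      assume *: "integrable R (\<lambda>x. (\<integral>y. \<bar>k x y\<bar> \<partial>R)^2)"
      have "AE x in R. (\<integral>y. norm (?T (x, y)) \<partial>?RR) = (\<integral>y. \<bar>k x y\<bar> \<partial>R)^2"
        using ae by eventually_elim simp
      then show "integrable R (\<lambda>x. \<integral>y. norm (?T (x, y)) \<partial>?RR)"
      proof (intro integrable_cong_AE_imp[OF *])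
        assume "AE x in R. (\<integral>y. norm (?T (x, y)) \<partial>?RR) = (\<integral>y. \<bar>k x y\<bar> \<partial>R)^2"
        then show "AE x in R. (\<integral>y. \<bar>k x y\<bar> \<partial>R)^2 = (\<integral>y. norm (?T (x, y)) \<partial>?RR)"
          by eventually_elim simp
      qed measurable
      show "AE x in R. integrable ?RR (\<lambda>y. ?T (x, y))" using ae by eventually_elim simp
    qed measurable
    from R3.integral_fst'[OF this]
    have "(\<integral>z. ?T z \<partial>(R \<Otimes>\<^sub>M ?RR)) = (\<integral>x. (\<integral>y. ?T (x, y) \<partial>?RR) \<partial>R)" by simp
    also have "\<dots> = (\<integral>x. (g x)^2 \<partial>R)"
    proof (rule integral_cong_AE)
      show "AE x in R. (\<integral>y. ?T (x, y) \<partial>?RR) = (g x)^2" using ae by eventually_elim simp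
    qed measurable
    finally show ?thesis .
  qed
  ultimately show "kernel_variance k R = (\<integral>z. (h (fst z) (snd z))^2 \<partial>?RR)"
    by (simp add: kernel_variance_def pair_expectation_def c_def)
qed

lemma h_square_pair:
  assumes D: "D = P \<or> D = Q" "D' = P \<or> D' = Q"
  shows "integrable (D \<Otimes>\<^sub>M D') (\<lambda>z. (h (fst z) (snd z))^2)"
    and "(\<integral>z. (h (fst z) (snd z))^2 \<partial>(D \<Otimes>\<^sub>M D')) \<le> c\<rho>^2 * kernel_variance k R"
  using integrable_pair_mixture(2)[OF h_square D] integral_pair_le_mixture[OF h_square _ D]
  by (simp_all add: kernel_variance_eq)

text \<open>
  The centring makes the conditional mean of \<open>h\<close> under the mixture vanish. For samples of sizes close to
  \<open>\<rho> N\<close> and \<open>(1 - \<rho>) N\<close> this makes the row sums small.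
\<close>

lemma conditional_means_balance:
  assumes D: "D = P \<or> D = Q"
  shows "AE x in D. \<rho> * (\<integral>y. h x y \<partial>P) + (1 - \<rho>) * (\<integral>y. h x y \<partial>Q) = 0"
proof -
  have ae: "AE x in R. \<rho> * (\<integral>y. h x y \<partial>P) + (1 - \<rho>) * (\<integral>y. h x y \<partial>Q) = 0"
    using k_section_integrable
  proof eventually_elim
    case (elim x)
    have "integrable R (h x)" unfolding h_def using elim g_integrable by simp
    then have "\<rho> * (\<integral>y. h x y \<partial>P) + (1 - \<rho>) * (\<integral>y. h x y \<partial>Q) = (\<integral>y. h x y \<partial>R)"
      by (rule integral_mixture[symmetric])
    also have "\<dots> = 0"
      unfolding h_def using elim g_integrable g_integral by (simp add: R.prob_space g_def[symmetric])
    finally show ?case .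
  qed
  interpret P: prob_space P by (rule P_prob)
  interpret Q: prob_space Q by (rule Q_prob)
  have "Measurable.pred S (\<lambda>x. \<rho> * (\<integral>y. h x y \<partial>P) + (1 - \<rho>) * (\<integral>y. h x y \<partial>Q) = 0)"
    by measurable
  from AE_mixture[OF this] ae D show ?thesis by auto
qed

end

section \<open>Moments of the doubly centred kernel\<close>

lemma abs_powr_diff_le_fourth_powers:
  fixes a b q :: real
  assumes "0 \<le> q" "q \<le> 4"
  shows "\<bar>a - b\<bar> powr q \<le> 1 + 8 * (a^4 + b^4)"
proof -
  have sq: "(x - y)^2 \<le> 2 * (x^2 + y^2)" "(x + y)^2 \<le> 2 * (x^2 + y^2)" for x y :: real
    using zero_le_power2[of "x + y"] zero_le_power2[of "x - y"]
    by (simp_all add: power2_eq_square algebra_simps)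
  have "((a - b)^2)^2 \<le> (2 * (a^2 + b^2))^2" by (rule power_mono[OF sq(1)]) simp
  also have "\<dots> = 4 * (a^2 + b^2)^2" by (simp only: power_mult_distrib) simp
  also have "\<dots> \<le> 4 * (2 * ((a^2)^2 + (b^2)^2))" by (intro mult_left_mono sq(2)) simp
  finally have four: "(a - b)^4 \<le> 8 * (a^4 + b^4)" by (simp add: power_mult[symmetric])
  show ?thesis
  proof (cases "\<bar>a - b\<bar> \<le> 1")
    case True
    then have "\<bar>a - b\<bar> powr q \<le> 1" using assms by (simp add: powr_le1)
    then show ?thesis by (rule order_trans) simp
  next
    case False
    then have "\<bar>a - b\<bar> powr q \<le> \<bar>a - b\<bar> powr 4" using assms by (intro powr_mono) auto
    also have "\<bar>a - b\<bar> powr 4 = (a - b)^4" using False by (simp add: powr_numeral)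
    finally show ?thesis using four by linarith
  qed
qed

lemma sum_six:
  fixes F :: "'b \<Rightarrow> real"
  shows "(\<Sum>i\<in>{..<6}. F ([a, b, c, d, e, f] ! i)) = F a + F b + F c + F d + F e + F f"
proof -
  have "{..<6::nat} = {0, 1, 2, 3, 4, 5}" by auto
  then show ?thesis by simp
qed

context two_laws_kernel
begin

lemma pair_expectation_swap: "pair_expectation k Q P = pair_expectation k P Q"
  unfolding pair_expectation_def
  by (rule swap_integral[OF k_measurable Q_prob P_prob sets_Q sets_P]) (rule k_sym)

lemma centered_abs_moment_swap: "centered_abs_moment q k Q P = centered_abs_moment q k P Q"
  unfolding centered_abs_moment_def pair_expectation_swap
  by (subst (1 3) pair_expectation_def)
     (rule swap_integral[OF _ Q_prob P_prob sets_Q sets_P], measurable, simp add: k_sym)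

lemma centered_moment_integrable:
  assumes D: "D = P \<or> D = Q" "D' = P \<or> D' = Q" and q: "0 \<le> q" "q \<le> 4"
  shows "integrable (D \<Otimes>\<^sub>M D') (\<lambda>z. \<bar>k (fst z) (snd z) - b\<bar> powr q)"
proof -
  interpret D: prob_space D by (rule law_cases_prob(1)[OF D(1)])
  interpret D': prob_space D' by (rule law_cases_prob(1)[OF D(2)])
  interpret DD: pair_prob_space D D' ..
  note [measurable_cong] = law_cases_prob(2)[OF D(1)] law_cases_prob(2)[OF D(2)]
  show ?thesis
  proof (rule Bochner_Integration.integrable_bound)
    show "integrable (D \<Otimes>\<^sub>M D') (\<lambda>z. 1 + 8 * ((k (fst z) (snd z))^4 + b^4))"
      using integrable_pair_mixture(2)[OF k_moment4 D] by simp
    show "AE z in D \<Otimes>\<^sub>M D'. norm (\<bar>k (fst z) (snd z) - b\<bar> powr q) \<le> norm (1 + 8 * ((k (fst z) (snd z))^4 + b^4))"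
      using abs_powr_diff_le_fourth_powers[OF q] by (intro AE_I2) simp
  qed measurable
qed

text \<open>
  With \<open>f A B\<close> the kernel centred at its own mean under \<open>A \<Otimes>\<^sub>M B\<close> and \<open>u A B\<close> its conditional mean given the first
  variable, \<open>h\<close> is on \<open>D \<Otimes>\<^sub>M D'\<close> the sum of \<open>f D D'\<close>, four terms \<open>u\<close> with coefficients of modulus at most one,
  and a constant. Centring the constant function of the pair of laws produces \<open>(1 - \<rho>)^2\<close>, \<open>\<rho>^2\<close> or
  \<open>\<rho> * (1 - \<rho>)\<close> times the energy up to sign, whence the bound on the constant. The conditional means have moments
  no larger than those of \<open>f\<close>, so each of the five random terms is bounded by the sum of the three centred moments.
\<close>

lemma h_moment:
  assumes D: "D = P \<or> D = Q" "D' = P \<or> D' = Q" and q: "1 \<le> q" "q \<le> 4"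
  defines "S3 \<equiv> centered_abs_moment q k P P + centered_abs_moment q k P Q + centered_abs_moment q k Q Q"
  shows "integrable (D \<Otimes>\<^sub>M D') (\<lambda>z. \<bar>h (fst z) (snd z)\<bar> powr q)"
    and "(\<integral>z. \<bar>h (fst z) (snd z)\<bar> powr q \<partial>(D \<Otimes>\<^sub>M D')) \<le> 6 powr q * (5 * S3 + \<bar>energy k P Q\<bar> powr q)"
proof -
  interpret P: prob_space P by (rule P_prob)
  interpret Q: prob_space Q by (rule Q_prob)
  have moment_nonneg: "0 \<le> centered_abs_moment q k A B" for A B
    unfolding centered_abs_moment_def pair_expectation_def by (intro integral_nonneg_AE) auto
  have moment_le: "centered_abs_moment q k A B \<le> S3" if "A = P \<or> A = Q" "B = P \<or> B = Q" for A B
    using that moment_nonneg[of P P] moment_nonneg[of P Q] moment_nonneg[of Q Q] centered_abs_moment_swap[of q]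
    unfolding S3_def by auto
  define f where "f = (\<lambda>A B x y. k x y - pair_expectation k A B)"
  define u where "u = (\<lambda>A B x. \<integral>y. f A B x y \<partial>B)"
  have u: "integrable A (\<lambda>x. \<bar>u A B x\<bar> powr q)" "(\<integral>x. \<bar>u A B x\<bar> powr q \<partial>A) \<le> S3"
    if AB: "A = P \<or> A = Q" "B = P \<or> B = Q" for A B
  proof -
    interpret A: prob_space A by (rule law_cases_prob(1)[OF AB(1)])
    interpret B: prob_space B by (rule law_cases_prob(1)[OF AB(2)])
    note [measurable_cong] = law_cases_prob(2)[OF AB(1)] law_cases_prob(2)[OF AB(2)]
    have m: "(\<lambda>z. f A B (fst z) (snd z)) \<in> borel_measurable (A \<Otimes>\<^sub>M B)" unfolding f_def by measurable
    have i: "integrable (A \<Otimes>\<^sub>M B) (\<lambda>z. \<bar>f A B (fst z) (snd z)\<bar> powr q)"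
      unfolding f_def using q by (intro centered_moment_integrable AB) auto
    note c = conditional_mean_powr[OF A.prob_space_axioms B.prob_space_axioms q(1) m i]
    show "integrable A (\<lambda>x. \<bar>u A B x\<bar> powr q)" using c(2) by (simp add: u_def)
    have "(\<integral>x. \<bar>u A B x\<bar> powr q \<partial>A) \<le> centered_abs_moment q k A B"
      using c(3) by (simp add: u_def f_def centered_abs_moment_def pair_expectation_def)
    then show "(\<integral>x. \<bar>u A B x\<bar> powr q \<partial>A) \<le> S3" using moment_le[OF AB] by linarith
  qed
  interpret D: prob_space D by (rule law_cases_prob(1)[OF D(1)])
  interpret D': prob_space D' by (rule law_cases_prob(1)[OF D(2)])
  interpret DD: pair_prob_space D D' ..
  note [measurable_cong] = law_cases_prob(2)[OF D(1)] law_cases_prob(2)[OF D(2)]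
  define r where "r = pair_expectation k D D' - \<rho> * pair_expectation k D P - (1 - \<rho>) * pair_expectation k D Q
     - \<rho> * pair_expectation k D' P - (1 - \<rho>) * pair_expectation k D' Q + c"
  define a where "a = (\<lambda>z i. [f D D' (fst z) (snd z), - \<rho> * u D P (fst z), - (1 - \<rho>) * u D Q (fst z),
     - \<rho> * u D' P (snd z), - (1 - \<rho>) * u D' Q (snd z), r] ! i)"
  define b where "b = (\<lambda>z. \<bar>f D D' (fst z) (snd z)\<bar> powr q + \<bar>u D P (fst z)\<bar> powr q + \<bar>u D Q (fst z)\<bar> powr q
     + \<bar>u D' P (snd z)\<bar> powr q + \<bar>u D' Q (snd z)\<bar> powr q + \<bar>energy k P Q\<bar> powr q)"
  have c_split: "c = \<rho>^2 * pair_expectation k P P + 2 * \<rho> * (1 - \<rho>) * pair_expectation k P Q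
      + (1 - \<rho>)^2 * pair_expectation k Q Q"
    using integral_pair_mixture[OF k_integrable] pair_expectation_swap
    by (simp add: c_def pair_expectation_def)
  have r_le: "\<bar>r\<bar> \<le> \<bar>energy k P Q\<bar>"
  proof -
    have "r = (1 - \<rho>)^2 * (- energy k P Q) \<or> r = \<rho>^2 * (- energy k P Q)
        \<or> r = - (\<rho> * (1 - \<rho>)) * (- energy k P Q)"
      using D unfolding r_def c_split energy_def
      by (auto simp: pair_expectation_swap power2_eq_square algebra_simps)
    moreover have "\<bar>w * (- energy k P Q)\<bar> \<le> \<bar>energy k P Q\<bar>" if "\<bar>w\<bar> \<le> 1" for w
      using that by (simp add: abs_mult mult_left_le_one_le)
    moreover have "\<bar>(1 - \<rho>)^2\<bar> \<le> 1" "\<bar>\<rho>^2\<bar> \<le> 1" "\<bar>- (\<rho> * (1 - \<rho>))\<bar> \<le> 1"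
      using rho_pos rho_less by (auto simp: power_le_one abs_mult intro!: mult_le_one)
    ultimately show ?thesis by metis
  qed
  have g_split: "AE x in A. g x = \<rho> * (u A P x + pair_expectation k A P) + (1 - \<rho>) * (u A Q x + pair_expectation k A Q)"
    if A: "A = P \<or> A = Q" for A
  proof -
    have "Measurable.pred S (\<lambda>x. integrable R (k x))" by measurable
    from AE_mixture[OF this] k_section_integrable A have "AE x in A. integrable R (k x)" by blast
    then show ?thesis
    proof eventually_elim
      case (elim x)
      from integral_mixture[OF elim] integrable_mixture[OF elim] show ?case
        by (simp add: g_def u_def f_def P.prob_space Q.prob_space)
    qed
  qed
  have um: "u A B \<in> borel_measurable S" if "B = P \<or> B = Q" for A B
    using that unfolding u_def f_def by auto
  have a_sum: "(\<Sum>i\<in>{..<6}. a z i) = f D D' (fst z) (snd z) + - \<rho> * u D P (fst z)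
      + - (1 - \<rho>) * u D Q (fst z) + - \<rho> * u D' P (snd z) + - (1 - \<rho>) * u D' Q (snd z) + r" for z
    unfolding a_def by (rule sum_six[where F = "\<lambda>x. x"])
  have h_split: "AE z in D \<Otimes>\<^sub>M D'. h (fst z) (snd z) = (\<Sum>i\<in>{..<6}. a z i)"
  proof (rule DD.AE_pair_measure)
    show "AE x in D. AE y in D'. h (fst (x, y)) (snd (x, y)) = (\<Sum>i\<in>{..<6}. a (x, y) i)"
      using g_split[OF D(1)]
    proof eventually_elim
      case x: (elim x)
      show ?case using g_split[OF D(2)]
      proof eventually_elim
        case (elim y)
        show ?case
          unfolding fst_conv snd_conv h_def x elim a_sum
          by (simp add: r_def f_def algebra_simps)
      qed
    qed
    have [measurable]: "u D P \<in> borel_measurable S" "u D Q \<in> borel_measurable S"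
      "u D' P \<in> borel_measurable S" "u D' Q \<in> borel_measurable S" using um by auto
    have [measurable]: "(\<lambda>z. f D D' (fst z) (snd z)) \<in> borel_measurable (S \<Otimes>\<^sub>M S)"
      unfolding f_def by measurable
    have "Measurable.pred (D \<Otimes>\<^sub>M D') (\<lambda>z. h (fst z) (snd z) = f D D' (fst z) (snd z) + - \<rho> * u D P (fst z)
      + - (1 - \<rho>) * u D Q (fst z) + - \<rho> * u D' P (snd z) + - (1 - \<rho>) * u D' Q (snd z) + r)"
      by measurable
    then show "{z \<in> space (D \<Otimes>\<^sub>M D'). h (fst z) (snd z) = (\<Sum>i\<in>{..<6}. a z i)} \<in> sets (D \<Otimes>\<^sub>M D')"
      unfolding pred_def a_sum .
  qed
  have a_le: "(\<Sum>i\<in>{..<6}. \<bar>a z i\<bar> powr q) \<le> b z" for z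
  proof -
    have w: "\<bar>w * v\<bar> powr q \<le> \<bar>v\<bar> powr q" if "\<bar>w\<bar> \<le> 1" for w v :: real
      using that q by (intro powr_mono2) (auto simp: abs_mult mult_left_le_one_le)
    have "\<bar>r\<bar> powr q \<le> \<bar>energy k P Q\<bar> powr q" using r_le q by (intro powr_mono2) auto
    moreover have "\<bar>- \<rho>\<bar> \<le> 1" "\<bar>- (1 - \<rho>)\<bar> \<le> 1" using rho_pos rho_less by auto
    moreover have "(\<Sum>i\<in>{..<6}. \<bar>a z i\<bar> powr q) = \<bar>f D D' (fst z) (snd z)\<bar> powr q + \<bar>- \<rho> * u D P (fst z)\<bar> powr q
      + \<bar>- (1 - \<rho>) * u D Q (fst z)\<bar> powr q + \<bar>- \<rho> * u D' P (snd z)\<bar> powr q + \<bar>- (1 - \<rho>) * u D' Q (snd z)\<bar> powr q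
      + \<bar>r\<bar> powr q"
      unfolding a_def by (rule sum_six[where F = "\<lambda>x. \<bar>x\<bar> powr q"])
    ultimately show ?thesis
      unfolding b_def by (simp only:) (intro add_mono w order_refl)
  qed
  have h_le: "AE z in D \<Otimes>\<^sub>M D'. \<bar>h (fst z) (snd z)\<bar> powr q \<le> 6 powr q * b z"
    using h_split
  proof eventually_elim
    case (elim z)
    have "\<bar>h (fst z) (snd z)\<bar> powr q \<le> 6 powr q * (\<Sum>i\<in>{..<6}. \<bar>a z i\<bar> powr q)"
      unfolding elim using abs_sum_powr_le[of "{..<6::nat}" q "a z"] q by simp
    also have "\<dots> \<le> 6 powr q * b z" by (intro mult_left_mono a_le) simp
    finally show ?case .
  qed
  note probs = D.prob_space_axioms D'.prob_space_axioms
  have PQ: "P = P \<or> P = Q" "Q = P \<or> Q = Q" by auto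
  note us = integral_fst_function[OF probs u(1)[OF D(1) PQ(1)]] integral_fst_function[OF probs u(1)[OF D(1) PQ(2)]]
    integral_snd_function[OF probs u(1)[OF D(2) PQ(1)]] integral_snd_function[OF probs u(1)[OF D(2) PQ(2)]]
  have fi: "integrable (D \<Otimes>\<^sub>M D') (\<lambda>z. \<bar>f D D' (fst z) (snd z)\<bar> powr q)"
    unfolding f_def using q by (intro centered_moment_integrable D) auto
  have f_le: "(\<integral>z. \<bar>f D D' (fst z) (snd z)\<bar> powr q \<partial>(D \<Otimes>\<^sub>M D')) \<le> S3"
    using moment_le[OF D] by (simp add: f_def centered_abs_moment_def pair_expectation_def)
  have bi: "integrable (D \<Otimes>\<^sub>M D') b" unfolding b_def using us fi by simp
  have b_int: "(\<integral>z. b z \<partial>(D \<Otimes>\<^sub>M D')) \<le> 5 * S3 + \<bar>energy k P Q\<bar> powr q"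
    unfolding b_def using us fi f_le u(2)[OF D(1) PQ(1)] u(2)[OF D(1) PQ(2)] u(2)[OF D(2) PQ(1)] u(2)[OF D(2) PQ(2)]
    by (simp add: DD.prob_space)
  show hi: "integrable (D \<Otimes>\<^sub>M D') (\<lambda>z. \<bar>h (fst z) (snd z)\<bar> powr q)"
  proof (rule Bochner_Integration.integrable_bound)
    show "integrable (D \<Otimes>\<^sub>M D') (\<lambda>z. 6 powr q * b z)" using bi by simp
    show "AE z in D \<Otimes>\<^sub>M D'. norm (\<bar>h (fst z) (snd z)\<bar> powr q) \<le> norm (6 powr q * b z)"
      using h_le by eventually_elim (simp add: abs_of_nonneg)
  qed measurable
  have "(\<integral>z. \<bar>h (fst z) (snd z)\<bar> powr q \<partial>(D \<Otimes>\<^sub>M D')) \<le> (\<integral>z. 6 powr q * b z \<partial>(D \<Otimes>\<^sub>M D'))"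
    using hi bi h_le by (intro integral_mono_AE) auto
  also have "\<dots> \<le> 6 powr q * (5 * S3 + \<bar>energy k P Q\<bar> powr q)"
    using b_int by simp
  finally show "(\<integral>z. \<bar>h (fst z) (snd z)\<bar> powr q \<partial>(D \<Otimes>\<^sub>M D')) \<le> 6 powr q * (5 * S3 + \<bar>energy k P Q\<bar> powr q)" .
qed

text \<open>
  If the kernel variance vanishes, then \<open>k x y = g x + g y - c\<close> almost everywhere, and the signed measure
  \<open>P - Q\<close>, having total mass zero, integrates an additive function of two variables to zero.
\<close>

lemma signed_double_integral_zero:
  assumes V: "kernel_variance k R = 0"
  shows "signed_double_integral k P Q = 0"
proof -
  have "AE z in R \<Otimes>\<^sub>M R. (h (fst z) (snd z))^2 = 0"
    using integral_nonneg_eq_0_iff_AE[OF h_square] V by (simp add: kernel_variance_eq)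
  then have ae: "AE z in R \<Otimes>\<^sub>M R. k (fst z) (snd z) = g (fst z) + g (snd z) - c"
    by eventually_elim (simp add: h_def)
  have m: "Measurable.pred (S \<Otimes>\<^sub>M S) (\<lambda>z. k (fst z) (snd z) = g (fst z) + g (snd z) - c)" by measurable
  have split: "pair_expectation k D D' = (\<integral>x. g x \<partial>D) + (\<integral>x. g x \<partial>D') - c"
    if D: "D = P \<or> D = Q" "D' = P \<or> D' = Q" for D D'
  proof -
    interpret D: prob_space D by (rule law_cases_prob(1)[OF D(1)])
    interpret D': prob_space D' by (rule law_cases_prob(1)[OF D(2)])
    interpret DD: pair_prob_space D D' ..
    note [measurable_cong] = law_cases_prob(2)[OF D(1)] law_cases_prob(2)[OF D(2)]
    have gi: "integrable D g" "integrable D' g" using integrable_mixture[OF g_integrable] D by auto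
    have "pair_expectation k D D' = (\<integral>z. g (fst z) + g (snd z) - c \<partial>(D \<Otimes>\<^sub>M D'))"
      unfolding pair_expectation_def by (rule integral_cong_AE[OF _ _ AE_pair_mixture[OF m ae D]]) measurable
    also have "\<dots> = (\<integral>x. g x \<partial>D) + (\<integral>x. g x \<partial>D') - c"
      using integral_fst_function[OF D.prob_space_axioms D'.prob_space_axioms gi(1)]
        integral_snd_function[OF D.prob_space_axioms D'.prob_space_axioms gi(2)]
      by (simp add: DD.prob_space)
    finally show ?thesis .
  qed
  show ?thesis unfolding signed_double_integral_def by (simp add: split)
qed

end

section \<open>Sums over pairs of independent observations\<close>

locale independent_sample = prob_space M
  for M :: "'w measure" +
  fixes S :: "'a measure" and W :: "nat \<Rightarrow> 'w \<Rightarrow> 'a" and N :: nat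
  assumes indep_sample: "indep_vars (\<lambda>_. S) W {1..N}"
begin

definition law where "law s = distr M S (W s)"

abbreviation I where "I \<equiv> {1..N}"

lemma W_measurable [measurable]: "s \<in> I \<Longrightarrow> W s \<in> measurable M S"
  using indep_sample by (auto simp: indep_vars_def)

lemma sets_law [simp, measurable_cong]: "sets (law s) = sets S"
  by (simp add: law_def)

lemma space_law [simp]: "space (law s) = space S"
  by (simp add: law_def)

lemma law_prob: "s \<in> I \<Longrightarrow> prob_space (law s)"
  unfolding law_def by (rule prob_space_distr) (rule W_measurable)

lemma indep_groups:
  assumes "A \<inter> B = {}" "A \<subseteq> I" "B \<subseteq> I"
    and f: "f \<in> measurable (PiM A (\<lambda>_. S)) T" and g: "g \<in> measurable (PiM B (\<lambda>_. S)) U"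
  shows "indep_var T (\<lambda>\<omega>. f (\<lambda>i\<in>A. W i \<omega>)) U (\<lambda>\<omega>. g (\<lambda>i\<in>B. W i \<omega>))"
  using indep_var_compose[OF indep_var_restrict[OF indep_sample assms(1-3)] f g]
  by (simp add: comp_def)

text \<open>
  Independence of two disjoint groups of observations in the form of a product law. The functions \<open>f\<close> and \<open>g\<close> may
  take values in different types, which is what the law of a single observation next to a pair requires.
\<close>

lemma distr_groups:
  assumes AB: "A \<inter> B = {}" "A \<subseteq> I" "B \<subseteq> I"
    and f: "f \<in> measurable (PiM A (\<lambda>_. S)) T" and g: "g \<in> measurable (PiM B (\<lambda>_. S)) U"
  shows "distr M (T \<Otimes>\<^sub>M U) (\<lambda>\<omega>. (f (\<lambda>i\<in>A. W i \<omega>), g (\<lambda>i\<in>B. W i \<omega>)))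
    = distr M T (\<lambda>\<omega>. f (\<lambda>i\<in>A. W i \<omega>)) \<Otimes>\<^sub>M distr M U (\<lambda>\<omega>. g (\<lambda>i\<in>B. W i \<omega>))"
proof -
  let ?A = "\<lambda>\<omega>. \<lambda>i\<in>A. W i \<omega>" and ?B = "\<lambda>\<omega>. \<lambda>i\<in>B. W i \<omega>"
  have A: "?A \<in> measurable M (PiM A (\<lambda>_. S))" and B: "?B \<in> measurable M (PiM B (\<lambda>_. S))"
    using AB by (auto intro!: measurable_restrict)
  have fA: "distr M T (\<lambda>\<omega>. f (?A \<omega>)) = distr (distr M (PiM A (\<lambda>_. S)) ?A) T f"
    by (subst distr_distr[OF f A]) (simp add: comp_def)
  have gB: "distr M U (\<lambda>\<omega>. g (?B \<omega>)) = distr (distr M (PiM B (\<lambda>_. S)) ?B) U g"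
    by (subst distr_distr[OF g B]) (simp add: comp_def)
  have sf: "sigma_finite_measure (distr M U (\<lambda>\<omega>. g (?B \<omega>)))"
    by (intro prob_space_imp_sigma_finite prob_space_distr measurable_compose[OF B g])
  have "distr M T (\<lambda>\<omega>. f (?A \<omega>)) \<Otimes>\<^sub>M distr M U (\<lambda>\<omega>. g (?B \<omega>))
    = distr (distr M (PiM A (\<lambda>_. S)) ?A \<Otimes>\<^sub>M distr M (PiM B (\<lambda>_. S)) ?B) (T \<Otimes>\<^sub>M U) (\<lambda>(x, y). (f x, g y))"
    unfolding fA gB by (rule pair_measure_distr) (use f g sf in \<open>simp_all add: gB\<close>)
  also have "distr M (PiM A (\<lambda>_. S)) ?A \<Otimes>\<^sub>M distr M (PiM B (\<lambda>_. S)) ?B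
      = distr M (PiM A (\<lambda>_. S) \<Otimes>\<^sub>M PiM B (\<lambda>_. S)) (\<lambda>\<omega>. (?A \<omega>, ?B \<omega>))"
    using indep_var_restrict[OF indep_sample AB] unfolding indep_var_distribution_eq by simp
  also have "distr \<dots> (T \<Otimes>\<^sub>M U) (\<lambda>(x, y). (f x, g y))
      = distr M (T \<Otimes>\<^sub>M U) (\<lambda>\<omega>. (f (?A \<omega>), g (?B \<omega>)))"
    using f g A B by (subst distr_distr) (auto simp: comp_def)
  finally show ?thesis ..
qed

lemma distr_pair:
  assumes "s \<in> I" "t \<in> I" "s \<noteq> t"
  shows "distr M (S \<Otimes>\<^sub>M S) (\<lambda>\<omega>. (W s \<omega>, W t \<omega>)) = law s \<Otimes>\<^sub>M law t"
  using distr_groups[of "{s}" "{t}" "\<lambda>w. w s" S "\<lambda>w. w t" S] assms by (simp add: law_def)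

lemma distr_triple:
  assumes "s \<in> I" "t \<in> I" "u \<in> I" "s \<noteq> t" "s \<noteq> u" "t \<noteq> u"
  shows "distr M (S \<Otimes>\<^sub>M (S \<Otimes>\<^sub>M S)) (\<lambda>\<omega>. (W s \<omega>, (W t \<omega>, W u \<omega>))) = law s \<Otimes>\<^sub>M (law t \<Otimes>\<^sub>M law u)"
  using distr_groups[of "{s}" "{t, u}" "\<lambda>w. w s" S "\<lambda>w. (w t, w u)" "S \<Otimes>\<^sub>M S"] assms
  unfolding distr_pair[OF assms(2,3,6), symmetric] by (simp add: law_def)

lemma pair_measurable:
  assumes [measurable]: "f \<in> borel_measurable (S \<Otimes>\<^sub>M S)" "s \<in> I" "t \<in> I"
  shows "(\<lambda>\<omega>. f (W s \<omega>, W t \<omega>)) \<in> borel_measurable M"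
  by measurable

lemma pair_transfer:
  fixes f :: "'a \<times> 'a \<Rightarrow> real"
  assumes st: "s \<in> I" "t \<in> I" "s \<noteq> t" and f: "f \<in> borel_measurable (S \<Otimes>\<^sub>M S)"
  shows "(\<integral>\<omega>. f (W s \<omega>, W t \<omega>) \<partial>M) = (\<integral>z. f z \<partial>(law s \<Otimes>\<^sub>M law t))"
    and "integrable M (\<lambda>\<omega>. f (W s \<omega>, W t \<omega>)) \<longleftrightarrow> integrable (law s \<Otimes>\<^sub>M law t) f"
  using st f unfolding distr_pair[OF st, symmetric]
  by (auto simp: integral_distr integrable_distr_eq)

lemma uncorrelated_disjoint_pairs:
  fixes f g :: "'a \<times> 'a \<Rightarrow> real"
  assumes f: "f \<in> borel_measurable (S \<Otimes>\<^sub>M S)" and g: "g \<in> borel_measurable (S \<Otimes>\<^sub>M S)"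
    and I: "s \<in> I" "t \<in> I" "u \<in> I" "v \<in> I" and disj: "{s, t} \<inter> {u, v} = {}"
    and int: "integrable M (\<lambda>\<omega>. f (W s \<omega>, W t \<omega>))" "integrable M (\<lambda>\<omega>. g (W u \<omega>, W v \<omega>))"
  shows "(\<integral>\<omega>. f (W s \<omega>, W t \<omega>) * g (W u \<omega>, W v \<omega>) \<partial>M)
    = (\<integral>\<omega>. f (W s \<omega>, W t \<omega>) \<partial>M) * (\<integral>\<omega>. g (W u \<omega>, W v \<omega>) \<partial>M)"
proof -
  have "indep_var borel (\<lambda>\<omega>. (\<lambda>w. f (w s, w t)) (\<lambda>i\<in>{s, t}. W i \<omega>))
      borel (\<lambda>\<omega>. (\<lambda>w. g (w u, w v)) (\<lambda>i\<in>{u, v}. W i \<omega>))"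
    using I disj by (intro indep_groups measurable_compose[OF _ f] measurable_compose[OF _ g]) auto
  then show ?thesis using int by (intro indep_var_lebesgue_integral) auto
qed

definition pairs where "pairs = (SIGMA s:I. I - {s})"

lemma pairsD: "e \<in> pairs \<Longrightarrow> fst e \<in> I \<and> snd e \<in> I \<and> fst e \<noteq> snd e"
  by (auto simp: pairs_def)

lemma finite_pairs: "finite pairs"
  by (simp add: pairs_def)

lemma sum_pairs: "(\<Sum>s\<in>I. \<Sum>t\<in>I - {s}. f s t) = (\<Sum>e\<in>pairs. f (fst e) (snd e))"
  unfolding pairs_def by (simp add: sum.Sigma split_beta)

lemma card_pairs_le: "real (card pairs) \<le> (real N)^2"
proof -
  have "card pairs \<le> card (I \<times> I)" by (intro card_mono) (auto simp: pairs_def)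
  then have "card pairs \<le> N * N" by (simp add: card_cartesian_product)
  then show ?thesis by (metis of_nat_le_iff of_nat_mult power2_eq_square)
qed

text \<open>
  One of the two entries of a meeting pair is one of the two entries of \<open>e\<close>, and the other one is free.
\<close>

lemma card_meeting_pairs_le:
  assumes "e \<in> pairs"
  shows "real (card {e'\<in>pairs. {fst e, snd e} \<inter> {fst e', snd e'} \<noteq> {}}) \<le> 4 * real N"
proof -
  let ?A = "{fst e, snd e}"
  have "card {e'\<in>pairs. ?A \<inter> {fst e', snd e'} \<noteq> {}} \<le> card (?A \<times> I \<union> I \<times> ?A)"
    by (intro card_mono) (auto simp: pairs_def)
  also have "\<dots> \<le> card (?A \<times> I) + card (I \<times> ?A)" by (rule card_Un_le)
  also have "\<dots> \<le> 2 * N + N * 2"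
    by (intro add_mono) (simp_all add: card_cartesian_product card_insert_if)
  finally have "card {e'\<in>pairs. ?A \<inter> {fst e', snd e'} \<noteq> {}} \<le> 4 * N" by linarith
  from of_nat_mono[OF this, where 'a = real] show ?thesis by linarith
qed

text \<open>
  In the variance of the sum, pairs without a common index do not contribute, and each of the at most
  \<open>4 N^3\<close> remaining covariances is bounded by \<open>E f^2 \<le> B E f\<close>.
\<close>

lemma bounded_pair_sum_deviation:
  fixes f :: "'a \<times> 'a \<Rightarrow> real"
  assumes f: "f \<in> borel_measurable (S \<Otimes>\<^sub>M S)"
    and bnd: "\<And>z. 0 \<le> f z" "\<And>z. f z \<le> B"
    and mean: "\<And>e. e \<in> pairs \<Longrightarrow> (\<integral>\<omega>. f (W (fst e) \<omega>, W (snd e) \<omega>) \<partial>M) \<le> \<beta>" and \<beta>: "0 \<le> \<beta>"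
  defines "F \<equiv> \<lambda>e \<omega>. f (W (fst e) \<omega>, W (snd e) \<omega>)"
  shows "(\<integral>\<omega>. \<bar>\<Sum>e\<in>pairs. F e \<omega> - expectation (F e)\<bar> \<partial>M) \<le> sqrt (4 * (real N)^3 * (B * \<beta>))"
proof -
  have B: "0 \<le> B" using bnd[of undefined] by linarith
  have Fm[measurable]: "F e \<in> borel_measurable M" if "e \<in> pairs" for e
    unfolding F_def using pairsD[OF that] by (intro pair_measurable[OF f]) auto
  have Fi: "integrable M (F e)" if "e \<in> pairs" for e
    using bnd by (intro integrable_const_bound[of _ B] Fm[OF that] AE_I2) (simp add: F_def)
  define D where "D = (\<lambda>e \<omega>. F e \<omega> - expectation (F e))"
  have Fe: "0 \<le> expectation (F e)" "expectation (F e) \<le> \<beta>" "expectation (F e) \<le> B" if "e \<in> pairs" for e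
    using mean[OF that] bnd integral_le_const[OF Fi[OF that], of B]
    by (auto simp: F_def intro!: integral_nonneg_AE)
  have Dm[measurable]: "D e \<in> borel_measurable M" if "e \<in> pairs" for e
    unfolding D_def using that by measurable
  have Db: "\<bar>D e \<omega>\<bar> \<le> B" if "e \<in> pairs" for e \<omega>
    using bnd(1)[of "(W (fst e) \<omega>, W (snd e) \<omega>)"] bnd(2)[of "(W (fst e) \<omega>, W (snd e) \<omega>)"] Fe[OF that]
    by (auto simp: D_def F_def abs_le_iff)
  have DDi: "integrable M (\<lambda>\<omega>. D e \<omega> * D e' \<omega>)" if "e \<in> pairs" "e' \<in> pairs" for e e'
  proof (rule integrable_const_bound[of _ "B * B"])
    show "AE x in M. norm (D e x * D e' x) \<le> B * B"
      using Db that B by (intro AE_I2) (auto simp: abs_mult simp del: split_paired_All intro!: mult_mono Db)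
  qed (use that in measurable)
  have D2: "expectation (\<lambda>\<omega>. D e \<omega> * D e \<omega>) \<le> B * \<beta>" if "e \<in> pairs" for e
  proof -
    have F2: "integrable M (\<lambda>\<omega>. F e \<omega> * F e \<omega>)"
    proof (rule integrable_const_bound[of _ "B * B"])
      show "AE x in M. norm (F e x * F e x) \<le> B * B"
        using bnd B by (intro AE_I2) (auto simp: abs_mult F_def intro!: mult_mono)
    qed (use that in measurable)
    have "expectation (\<lambda>\<omega>. D e \<omega> * D e \<omega>)
        = expectation (\<lambda>\<omega>. F e \<omega> * F e \<omega> - 2 * expectation (F e) * F e \<omega> + expectation (F e) ^ 2)"
      by (intro Bochner_Integration.integral_cong) (auto simp: D_def power2_eq_square algebra_simps)
    also have "\<dots> = expectation (\<lambda>\<omega>. F e \<omega> * F e \<omega>) - (expectation (F e))^2"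
      using F2 Fi[OF that] by (simp add: prob_space power2_eq_square)
    also have "\<dots> \<le> expectation (\<lambda>\<omega>. F e \<omega> * F e \<omega>)" by simp
    also have "\<dots> \<le> expectation (\<lambda>\<omega>. B * F e \<omega>)"
      using F2 Fi[OF that] bnd by (intro integral_mono) (auto simp: F_def intro!: mult_right_mono)
    also have "\<dots> \<le> B * \<beta>" using Fe[OF that] B by (auto intro!: mult_left_mono)
    finally show ?thesis .
  qed
  have B\<beta>: "0 \<le> B * \<beta>" using B \<beta> by simp
  have cross: "expectation (\<lambda>\<omega>. D e \<omega> * D e' \<omega>)
      \<le> (if {fst e, snd e} \<inter> {fst e', snd e'} \<noteq> {} then B * \<beta> else 0)"
    if e: "e \<in> pairs" "e' \<in> pairs" for e e'
  proof (cases "{fst e, snd e} \<inter> {fst e', snd e'} = {}")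
    case True
    have D0: "expectation (D e) = 0" if "e \<in> pairs" for e
      unfolding D_def using Fi[OF that] by (simp add: prob_space)
    let ?f = "\<lambda>e z. f z - expectation (F e)"
    have "expectation (\<lambda>\<omega>. D e \<omega> * D e' \<omega>) = expectation (D e) * expectation (D e')"
      unfolding D_def F_def
      using pairsD[OF e(1)] pairsD[OF e(2)] True f Fi[OF e(1)] Fi[OF e(2)]
      by (intro uncorrelated_disjoint_pairs[of "?f e" "?f e'", unfolded F_def]) (auto simp: F_def)
    then show ?thesis using True D0 e by simp
  next
    case False
    have "expectation (\<lambda>\<omega>. D e \<omega> * D e' \<omega>)
        \<le> expectation (\<lambda>\<omega>. (D e \<omega> * D e \<omega> + D e' \<omega> * D e' \<omega>) / 2)"
    proof (rule integral_mono)
      fix \<omega> show "D e \<omega> * D e' \<omega> \<le> (D e \<omega> * D e \<omega> + D e' \<omega> * D e' \<omega>) / 2"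
        using sum_squares_bound[of "D e \<omega>" "D e' \<omega>"] by (simp add: power2_eq_square)
    qed (use DDi e in auto)
    also have "\<dots> = (expectation (\<lambda>\<omega>. D e \<omega> * D e \<omega>) + expectation (\<lambda>\<omega>. D e' \<omega> * D e' \<omega>)) / 2"
      using DDi e by simp
    also have "\<dots> \<le> B * \<beta>" using D2[OF e(1)] D2[OF e(2)] by simp
    finally show ?thesis using False by simp
  qed
  define Z where "Z = (\<lambda>\<omega>. \<Sum>e\<in>pairs. D e \<omega>)"
  have Zm[measurable]: "Z \<in> borel_measurable M"
    unfolding Z_def by (intro borel_measurable_sum Dm)
  have Z2e: "(Z \<omega>)^2 = (\<Sum>e\<in>pairs. \<Sum>e'\<in>pairs. D e \<omega> * D e' \<omega>)" for \<omega>
    by (simp add: Z_def power2_eq_square sum_product)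
  have Z2i: "integrable M (\<lambda>\<omega>. (Z \<omega>)^2)"
    unfolding Z2e by (intro Bochner_Integration.integrable_sum DDi)
  have "expectation (\<lambda>\<omega>. (Z \<omega>)^2) = (\<Sum>e\<in>pairs. \<Sum>e'\<in>pairs. expectation (\<lambda>\<omega>. D e \<omega> * D e' \<omega>))"
    unfolding Z2e
    by (simp add: Bochner_Integration.integral_sum Bochner_Integration.integrable_sum DDi)
  also have "\<dots> \<le> (\<Sum>e\<in>pairs. \<Sum>e'\<in>pairs.
      if {fst e, snd e} \<inter> {fst e', snd e'} \<noteq> {} then B * \<beta> else 0)"
    by (intro sum_mono cross)
  also have "\<dots> = (\<Sum>e\<in>pairs. real (card {e'\<in>pairs. {fst e, snd e} \<inter> {fst e', snd e'} \<noteq> {}}) * (B * \<beta>))"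
    by (simp add: sum.If_cases finite_pairs Int_def)
  also have "\<dots> \<le> (\<Sum>e\<in>pairs. 4 * real N * (B * \<beta>))"
    by (intro sum_mono mult_right_mono card_meeting_pairs_le B\<beta>)
  also have "\<dots> = real (card pairs) * (4 * real N * (B * \<beta>))" by simp
  also have "\<dots> \<le> (real N)^2 * (4 * real N * (B * \<beta>))"
    by (intro mult_right_mono card_pairs_le) (use B\<beta> in auto)
  also have "\<dots> = 4 * (real N)^3 * (B * \<beta>)" by (simp add: power3_eq_cube power2_eq_square)
  finally have Z2: "expectation (\<lambda>\<omega>. (Z \<omega>)^2) \<le> 4 * (real N)^3 * (B * \<beta>)" .
  have Zi: "integrable M (\<lambda>\<omega>. \<bar>Z \<omega>\<bar>)"
    using square_integrable_imp_integrable[OF Zm] Z2i by simp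
  have "(expectation (\<lambda>\<omega>. \<bar>Z \<omega>\<bar>))^2 \<le> expectation (\<lambda>\<omega>. (Z \<omega>)^2)"
    using variance_positive[of "\<lambda>\<omega>. \<bar>Z \<omega>\<bar>"] variance_eq[OF Zi] Z2i by simp
  then have "expectation (\<lambda>\<omega>. \<bar>Z \<omega>\<bar>) \<le> sqrt (4 * (real N)^3 * (B * \<beta>))"
    using Z2 by (intro real_le_rsqrt) linarith
  then show ?thesis by (simp add: Z_def D_def)
qed


text \<open>
  A weak law under a moment of order \<open>1 + \<tau>\<close> of the squares. The part of \<open>h^2\<close> below the level \<open>B\<close> is handled
  through its variance, the excess above \<open>B\<close> through its mean. Discarding the excess on a set of small
  probability would not do: there are \<open>N^2\<close> pairs, too many for a union bound under this moment condition.
\<close>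

lemma pair_sum_of_squares_deviation:
  fixes h :: "'a \<times> 'a \<Rightarrow> real"
  assumes h: "h \<in> borel_measurable (S \<Otimes>\<^sub>M S)" and \<tau>: "0 < \<tau>" and B: "0 < B"
  defines "H \<equiv> \<lambda>e \<omega>. (h (W (fst e) \<omega>, W (snd e) \<omega>))^2"
  assumes Hi: "\<And>e. e \<in> pairs \<Longrightarrow> integrable M (H e)"
    and H\<beta>: "\<And>e. e \<in> pairs \<Longrightarrow> expectation (H e) \<le> \<beta>" and \<beta>: "0 \<le> \<beta>"
    and Hti: "\<And>e. e \<in> pairs \<Longrightarrow> integrable M (\<lambda>\<omega>. H e \<omega> powr (1 + \<tau>))"
    and HL: "\<And>e. e \<in> pairs \<Longrightarrow> expectation (\<lambda>\<omega>. H e \<omega> powr (1 + \<tau>)) \<le> L" and L: "0 \<le> L"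
  shows "(\<integral>\<omega>. \<bar>\<Sum>e\<in>pairs. H e \<omega> - expectation (H e)\<bar> \<partial>M)
    \<le> sqrt (4 * (real N)^3 * (B * \<beta>)) + 2 * (real N)^2 * (L / B powr \<tau>)"
proof -
  define f where "f = (\<lambda>z. min ((h z)^2) B)"
  define F where "F = (\<lambda>e \<omega>. f (W (fst e) \<omega>, W (snd e) \<omega>))"
  define G where "G = (\<lambda>e \<omega>. H e \<omega> - F e \<omega>)"
  have f[measurable]: "f \<in> borel_measurable (S \<Otimes>\<^sub>M S)" unfolding f_def using h by simp
  have FH: "F e \<omega> = min (H e \<omega>) B" for e \<omega> by (simp add: F_def f_def H_def)
  have H0: "0 \<le> H e \<omega>" for e \<omega> by (simp add: H_def)
  have Fm: "F e \<in> borel_measurable M" if "e \<in> pairs" for e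
    unfolding F_def using pairsD[OF that] by (intro pair_measurable[OF f]) auto
  have Fi: "integrable M (F e)" if "e \<in> pairs" for e
  proof (rule Bochner_Integration.integrable_bound[OF Hi[OF that] Fm[OF that]])
    show "AE x in M. norm (F e x) \<le> norm (H e x)" using H0 B by (auto simp: FH)
  qed
  have Gi: "integrable M (G e)" if "e \<in> pairs" for e
    unfolding G_def using Hi[OF that] Fi[OF that] by simp
  have G0: "0 \<le> G e \<omega>" for e \<omega> by (simp add: G_def FH)
  have GL: "expectation (G e) \<le> L / B powr \<tau>" if "e \<in> pairs" for e
  proof -
    have "expectation (G e) \<le> expectation (\<lambda>\<omega>. H e \<omega> powr (1 + \<tau>) / B powr \<tau>)"
      using Gi[OF that] Hti[OF that]
      by (intro integral_mono) (auto simp: G_def FH intro: excess_le_powr[OF H0 B \<tau>])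
    also have "\<dots> \<le> L / B powr \<tau>"
      using HL[OF that] B by (simp add: divide_right_mono)
    finally show ?thesis .
  qed
  have Fdev: "(\<integral>\<omega>. \<bar>\<Sum>e\<in>pairs. F e \<omega> - expectation (F e)\<bar> \<partial>M) \<le> sqrt (4 * (real N)^3 * (B * \<beta>))"
    unfolding F_def
  proof (rule bounded_pair_sum_deviation[OF f _ _ _ \<beta>])
    fix e assume e: "e \<in> pairs"
    have "expectation (F e) \<le> expectation (H e)"
      using Fi[OF e] Hi[OF e] by (intro integral_mono) (auto simp: FH)
    then show "(\<integral>\<omega>. f (W (fst e) \<omega>, W (snd e) \<omega>) \<partial>M) \<le> \<beta>"
      using H\<beta>[OF e] by (simp add: F_def)
  qed (use B in \<open>auto simp: f_def\<close>)
  have Gdev: "(\<integral>\<omega>. (\<Sum>e\<in>pairs. \<bar>G e \<omega> - expectation (G e)\<bar>) \<partial>M) \<le> 2 * (real N)^2 * (L / B powr \<tau>)"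
  proof -
    have "(\<integral>\<omega>. (\<Sum>e\<in>pairs. \<bar>G e \<omega> - expectation (G e)\<bar>) \<partial>M)
        = (\<Sum>e\<in>pairs. expectation (\<lambda>\<omega>. \<bar>G e \<omega> - expectation (G e)\<bar>))"
      using Gi by (intro Bochner_Integration.integral_sum) auto
    also have "\<dots> \<le> (\<Sum>e\<in>pairs. 2 * (L / B powr \<tau>))"
    proof (rule sum_mono)
      fix e assume e: "e \<in> pairs"
      have eg: "0 \<le> expectation (G e)" using G0 by (intro integral_nonneg_AE) auto
      have "expectation (\<lambda>\<omega>. \<bar>G e \<omega> - expectation (G e)\<bar>) \<le> expectation (\<lambda>\<omega>. G e \<omega> + expectation (G e))"
      proof (rule integral_mono)
        fix \<omega> show "\<bar>G e \<omega> - expectation (G e)\<bar> \<le> G e \<omega> + expectation (G e)"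
          using G0[of e \<omega>] eg by linarith
      qed (use Gi[OF e] in auto)
      also have "\<dots> = 2 * expectation (G e)" using Gi[OF e] by (simp add: prob_space)
      also have "\<dots> \<le> 2 * (L / B powr \<tau>)" using GL[OF e] by linarith
      finally show "expectation (\<lambda>\<omega>. \<bar>G e \<omega> - expectation (G e)\<bar>) \<le> 2 * (L / B powr \<tau>)" .
    qed
    also have "\<dots> = real (card pairs) * (2 * (L / B powr \<tau>))" by simp
    also have "\<dots> \<le> (real N)^2 * (2 * (L / B powr \<tau>))"
      using L by (intro mult_right_mono card_pairs_le) auto
    finally show ?thesis by (simp add: mult_ac)
  qed
  have sp: "(\<Sum>e\<in>pairs. H e \<omega> - expectation (H e))
      = (\<Sum>e\<in>pairs. F e \<omega> - expectation (F e)) + (\<Sum>e\<in>pairs. G e \<omega> - expectation (G e))" for \<omega>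
    unfolding sum.distrib[symmetric]
  proof (rule sum.cong[OF refl])
    fix e assume e: "e \<in> pairs"
    have "expectation (G e) = expectation (H e) - expectation (F e)"
      unfolding G_def using Hi[OF e] Fi[OF e] by simp
    then show "H e \<omega> - expectation (H e) = F e \<omega> - expectation (F e) + (G e \<omega> - expectation (G e))"
      by (simp add: G_def)
  qed
  have "(\<integral>\<omega>. \<bar>\<Sum>e\<in>pairs. H e \<omega> - expectation (H e)\<bar> \<partial>M)
      \<le> (\<integral>\<omega>. \<bar>\<Sum>e\<in>pairs. F e \<omega> - expectation (F e)\<bar> + (\<Sum>e\<in>pairs. \<bar>G e \<omega> - expectation (G e)\<bar>) \<partial>M)"
  proof (rule integral_mono)
    fix \<omega> show "\<bar>\<Sum>e\<in>pairs. H e \<omega> - expectation (H e)\<bar>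
      \<le> \<bar>\<Sum>e\<in>pairs. F e \<omega> - expectation (F e)\<bar> + (\<Sum>e\<in>pairs. \<bar>G e \<omega> - expectation (G e)\<bar>)"
      unfolding sp using sum_abs[of "\<lambda>e. G e \<omega> - expectation (G e)" pairs] by linarith
  qed (use Hi Fi Gi in auto)
  also have "\<dots> = (\<integral>\<omega>. \<bar>\<Sum>e\<in>pairs. F e \<omega> - expectation (F e)\<bar> \<partial>M)
      + (\<integral>\<omega>. (\<Sum>e\<in>pairs. \<bar>G e \<omega> - expectation (G e)\<bar>) \<partial>M)"
    using Fi Gi by (intro Bochner_Integration.integral_add) auto
  finally show ?thesis using Fdev Gdev by linarith
qed

text \<open>
  Given \<open>W s = x\<close> the entries of row \<open>s\<close> are independent, so a product of two different entries integrates to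
  the product \<open>u t x * u t' x\<close> of their conditional means.
\<close>

lemma row_sum_second_moment:
  fixes h :: "'a \<times> 'a \<Rightarrow> real"
  assumes h[measurable]: "h \<in> borel_measurable (S \<Otimes>\<^sub>M S)" and s: "s \<in> I"
    and h2: "\<And>t. t \<in> I - {s} \<Longrightarrow> integrable (law s \<Otimes>\<^sub>M law t) (\<lambda>z. (h z)^2)"
  defines "u \<equiv> \<lambda>t x. \<integral>y. h (x, y) \<partial>law t"
  shows "integrable M (\<lambda>\<omega>. (\<Sum>t\<in>I - {s}. h (W s \<omega>, W t \<omega>))^2)" (is ?int)
    and "(\<integral>\<omega>. (\<Sum>t\<in>I - {s}. h (W s \<omega>, W t \<omega>))^2 \<partial>M)
      \<le> (\<Sum>t\<in>I - {s}. \<integral>z. (h z)^2 \<partial>(law s \<Otimes>\<^sub>M law t)) + (\<integral>x. (\<Sum>t\<in>I - {s}. u t x)^2 \<partial>law s)" (is ?bound)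
proof -
  define J where "J = I - {s}"
  have J: "t \<in> I" "s \<noteq> t" "finite J" if "t \<in> J" for t using that by (auto simp: J_def)
  interpret L: prob_space "law s" by (rule law_prob[OF s])
  have hm[measurable]: "(\<lambda>\<omega>. h (W s \<omega>, W t \<omega>)) \<in> borel_measurable M" if "t \<in> J" for t
    using s J[OF that] by (intro pair_measurable[OF h]) auto
  have h2m: "(\<lambda>z. (h z)^2) \<in> borel_measurable (S \<Otimes>\<^sub>M S)" by measurable
  have H2: "integrable M (\<lambda>\<omega>. (h (W s \<omega>, W t \<omega>))^2)" if "t \<in> J" for t
    using h2[of t] that pair_transfer(2)[OF s J(1,2)[OF that] h2m] by (simp add: J_def)
  have HHi: "integrable M (\<lambda>\<omega>. h (W s \<omega>, W t \<omega>) * h (W s \<omega>, W t' \<omega>))"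
    if t: "t \<in> J" "t' \<in> J" for t t'
  proof (rule Bochner_Integration.integrable_bound)
    show "integrable M (\<lambda>\<omega>. (h (W s \<omega>, W t \<omega>))^2 + (h (W s \<omega>, W t' \<omega>))^2)"
      using H2 t by simp
    show "AE \<omega> in M. norm (h (W s \<omega>, W t \<omega>) * h (W s \<omega>, W t' \<omega>))
        \<le> norm ((h (W s \<omega>, W t \<omega>))^2 + (h (W s \<omega>, W t' \<omega>))^2)"
      by (intro AE_I2) (simp add: abs_mult_le_sum_squares)
  qed (use t in measurable)
  have sq: "(\<Sum>t\<in>J. a t)^2 = (\<Sum>t\<in>J. \<Sum>t'\<in>J. a t * a t')" for a :: "nat \<Rightarrow> real"
    by (simp add: power2_eq_square sum_product)
  show ?int
    unfolding J_def[symmetric] sq by (intro Bochner_Integration.integrable_sum HHi)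
  have U: "integrable (law s) (\<lambda>x. (u t x)^2)" "(\<integral>x. (u t x)^2 \<partial>law s) \<le> (\<integral>z. (h z)^2 \<partial>(law s \<Otimes>\<^sub>M law t))"
    and Uae: "AE x in law s. integrable (law t) (\<lambda>y. h (x, y))"
    if t: "t \<in> J" for t
  proof -
    interpret T: prob_space "law t" by (rule law_prob[OF J(1)[OF t]])
    note c = conditional_mean_square[OF L.prob_space_axioms T.prob_space_axioms, of h]
    show "integrable (law s) (\<lambda>x. (u t x)^2)" "(\<integral>x. (u t x)^2 \<partial>law s) \<le> (\<integral>z. (h z)^2 \<partial>(law s \<Otimes>\<^sub>M law t))"
      "AE x in law s. integrable (law t) (\<lambda>y. h (x, y))"
      unfolding u_def using c h2[of t] t by (simp_all add: J_def)
  qed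
  have um[measurable]: "u t \<in> borel_measurable S" if "t \<in> J" for t
  proof -
    interpret T: prob_space "law t" by (rule law_prob[OF J(1)[OF that]])
    show ?thesis unfolding u_def by measurable
  qed
  have uui: "integrable (law s) (\<lambda>x. u t x * u t' x)" if t: "t \<in> J" "t' \<in> J" for t t'
  proof (rule Bochner_Integration.integrable_bound)
    show "integrable (law s) (\<lambda>x. (u t x)^2 + (u t' x)^2)" using U t by simp
    show "AE x in law s. norm (u t x * u t' x) \<le> norm ((u t x)^2 + (u t' x)^2)"
      by (intro AE_I2) (simp add: abs_mult_le_sum_squares)
  qed (use t in measurable)
  have cross: "(\<integral>\<omega>. h (W s \<omega>, W t \<omega>) * h (W s \<omega>, W t' \<omega>) \<partial>M) = (\<integral>x. u t x * u t' x \<partial>law s)"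
    if t: "t \<in> J" "t' \<in> J" and ne: "t \<noteq> t'" for t t'
  proof -
    interpret T: prob_space "law t" by (rule law_prob[OF J(1)[OF t(1)]])
    interpret T': prob_space "law t'" by (rule law_prob[OF J(1)[OF t(2)]])
    interpret TT: pair_prob_space "law t" "law t'" ..
    interpret ST: pair_prob_space "law s" "law t \<Otimes>\<^sub>M law t'" ..
    let ?k = "\<lambda>z. h (fst z, fst (snd z)) * h (fst z, snd (snd z))"
    have kd: "law s \<Otimes>\<^sub>M (law t \<Otimes>\<^sub>M law t')
        = distr M (S \<Otimes>\<^sub>M (S \<Otimes>\<^sub>M S)) (\<lambda>\<omega>. (W s \<omega>, (W t \<omega>, W t' \<omega>)))"
      using distr_triple[OF s J(1)[OF t(1)] J(1)[OF t(2)] J(2)[OF t(1)] J(2)[OF t(2)] ne] ..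
    have Wm: "(\<lambda>\<omega>. (W s \<omega>, (W t \<omega>, W t' \<omega>))) \<in> measurable M (S \<Otimes>\<^sub>M (S \<Otimes>\<^sub>M S))"
      using s J[OF t(1)] J[OF t(2)] by measurable
    have km: "?k \<in> borel_measurable (S \<Otimes>\<^sub>M (S \<Otimes>\<^sub>M S))" by measurable
    have ki: "integrable (law s \<Otimes>\<^sub>M (law t \<Otimes>\<^sub>M law t')) ?k"
      unfolding kd integrable_distr_eq[OF Wm km] using HHi[OF t] by simp
    have "(\<integral>\<omega>. h (W s \<omega>, W t \<omega>) * h (W s \<omega>, W t' \<omega>) \<partial>M) = (\<integral>z. ?k z \<partial>(law s \<Otimes>\<^sub>M (law t \<Otimes>\<^sub>M law t')))"
      unfolding kd integral_distr[OF Wm km] by simp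
    also have "\<dots> = (\<integral>x. (\<integral>y. ?k (x, y) \<partial>(law t \<Otimes>\<^sub>M law t')) \<partial>law s)"
      using ST.integral_fst'[OF ki] by simp
    also have "\<dots> = (\<integral>x. u t x * u t' x \<partial>law s)"
    proof (rule integral_cong_AE)
      show "AE x in law s. (\<integral>y. ?k (x, y) \<partial>(law t \<Otimes>\<^sub>M law t')) = u t x * u t' x"
        using Uae[OF t(1)] Uae[OF t(2)] AE_space
      proof eventually_elim
        case (elim x)
        then have [measurable]: "(\<lambda>y. h (x, y)) \<in> borel_measurable S" by simp
        show ?case
          unfolding u_def using product_integral[OF T.prob_space_axioms T'.prob_space_axioms elim(1,2)] by simp
      qed
      show "(\<lambda>x. \<integral>y. ?k (x, y) \<partial>(law t \<Otimes>\<^sub>M law t')) \<in> borel_measurable (law s)"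
        by measurable
    qed (use t in measurable)
    finally show ?thesis .
  qed
  have "(\<integral>\<omega>. (\<Sum>t\<in>J. h (W s \<omega>, W t \<omega>))^2 \<partial>M)
      = (\<Sum>t\<in>J. \<Sum>t'\<in>J. \<integral>\<omega>. h (W s \<omega>, W t \<omega>) * h (W s \<omega>, W t' \<omega>) \<partial>M)"
    unfolding sq by (simp add: HHi)
  also have "\<dots> \<le> (\<Sum>t\<in>J. \<Sum>t'\<in>J. (if t = t' then \<integral>z. (h z)^2 \<partial>(law s \<Otimes>\<^sub>M law t) else 0)
      + (\<integral>x. u t x * u t' x \<partial>law s))"
  proof (intro sum_mono)
    fix t t' assume t: "t \<in> J" "t' \<in> J"
    show "(\<integral>\<omega>. h (W s \<omega>, W t \<omega>) * h (W s \<omega>, W t' \<omega>) \<partial>M)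
      \<le> (if t = t' then \<integral>z. (h z)^2 \<partial>(law s \<Otimes>\<^sub>M law t) else 0) + (\<integral>x. u t x * u t' x \<partial>law s)"
    proof (cases "t = t'")
      case True
      have "0 \<le> (\<integral>x. u t x * u t x \<partial>law s)" by (intro integral_nonneg_AE) auto
      then show ?thesis
        using True pair_transfer(1)[OF s J(1,2)[OF t(1)] h2m] by (simp add: power2_eq_square)
    qed (use cross[OF t] in simp)
  qed
  also have "\<dots> = (\<Sum>t\<in>J. \<integral>z. (h z)^2 \<partial>(law s \<Otimes>\<^sub>M law t)) + (\<integral>x. (\<Sum>t\<in>J. u t x)^2 \<partial>law s)"
  proof -
    have "(\<integral>x. (\<Sum>t\<in>J. u t x)^2 \<partial>law s) = (\<Sum>t\<in>J. \<Sum>t'\<in>J. \<integral>x. u t x * u t' x \<partial>law s)"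
      unfolding sq by (simp add: uui)
    moreover have "finite J" by (simp add: J_def)
    ultimately show ?thesis by (simp add: sum.distrib)
  qed
  finally show ?bound by (simp add: J_def)
qed

end

section \<open>Positivity of the kernel variance\<close>

text \<open>
  For \<open>u = f\<close> the second claim turns \<open>ip f f\<close> into the quadratic form of the kernel at the points \<open>x i\<close>, so that
  positivity of the inner product becomes positive semidefiniteness of the kernel.
\<close>

lemma (in rkhs) kernel_combination:
  fixes a :: "'i \<Rightarrow> real"
  assumes "finite I" and x: "\<And>i. i \<in> I \<Longrightarrow> x i \<in> S"
  defines "f \<equiv> (\<lambda>y. \<Sum>i\<in>I. a i * (if y \<in> S then K y (x i) else 0))"
  shows "f \<in> H \<and> (\<forall>u\<in>H. ip u f = (\<Sum>i\<in>I. a i * u (x i)))"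
  using assms(1) x unfolding f_def
proof (induction I)
  case empty
  have "ip (\<lambda>_. 0) u = 0" if "u \<in> H" for u
    using ip_scale[OF zero that, of 0] by simp
  then show ?case using zero ip_sym[OF _ zero] by simp
next
  case (insert i I)
  let ?K = "\<lambda>y. if y \<in> S then K y (x i) else 0"
  let ?f = "\<lambda>y. \<Sum>i\<in>I. a i * (if y \<in> S then K y (x i) else 0)"
  have f: "?f \<in> H" "\<And>u. u \<in> H \<Longrightarrow> ip u ?f = (\<Sum>i\<in>I. a i * u (x i))"
    using insert by auto
  have "?K \<in> H" using insert.prems by (auto intro: section_mem)
  then have K: "?K \<in> H" "(\<lambda>y. a i * ?K y) \<in> H"
    by (auto intro: scale)
  have "ip u (\<lambda>y. a i * ?K y + ?f y) = a i * u (x i) + (\<Sum>i\<in>I. a i * u (x i))" if u: "u \<in> H" for u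
  proof -
    have "ip u (\<lambda>y. a i * ?K y + ?f y) = ip (\<lambda>y. a i * ?K y + ?f y) u"
      by (rule ip_sym[OF u add[OF K(2) f(1)]])
    also have "\<dots> = a i * ip ?K u + ip ?f u"
      using ip_add[OF K(2) f(1) u] ip_scale[OF K(1) u] by simp
    also have "ip ?K u = u (x i)"
      using ip_sym[OF K(1) u] reproducing[OF u, of "x i"] insert.prems by simp
    also have "ip ?f u = (\<Sum>i\<in>I. a i * u (x i))" using ip_sym[OF f(1) u] f(2)[OF u] by simp
    finally show ?thesis .
  qed
  with add[OF K(2) f(1)] show ?case using insert.hyps by simp
qed

lemma (in rkhs) kernel_positive_semidefinite:
  fixes a :: "'i \<Rightarrow> real"
  assumes "finite I" and x: "\<And>i. i \<in> I \<Longrightarrow> x i \<in> S"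
  shows "0 \<le> (\<Sum>i\<in>I. \<Sum>j\<in>I. a i * a j * K (x i) (x j))"
proof -
  define f where "f = (\<lambda>y. \<Sum>i\<in>I. a i * (if y \<in> S then K y (x i) else 0))"
  have f: "f \<in> H" "ip f f = (\<Sum>i\<in>I. a i * f (x i))"
    unfolding f_def using kernel_combination[of I x a] assms by blast+
  have "ip f f = (\<Sum>i\<in>I. \<Sum>j\<in>I. a i * a j * K (x i) (x j))"
    unfolding f(2) by (simp add: f_def x sum_distrib_left mult_ac cong: sum.cong)
  then show ?thesis using ip_nonneg[OF f(1)] by simp
qed

lemma sum_two_groups:
  fixes f :: "bool \<Rightarrow> real"
  shows "(\<Sum>t\<in>{1..n+m}. f (t \<le> n)) = real n * f True + real m * f False"
proof -
  have "(\<Sum>t\<in>{1..n+m}. f (t \<le> n)) = (\<Sum>t\<in>{1..n}. f (t \<le> n)) + (\<Sum>t\<in>{n+1..n+m}. f (t \<le> n))"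
    by (rule sum.ub_add_nat) simp
  also have "\<dots> = (\<Sum>t\<in>{1..n}. f True) + (\<Sum>t\<in>{n+1..n+m}. f False)"
    by (intro arg_cong2[where f = "(+)"] sum.cong) auto
  finally show ?thesis by simp
qed

lemma sum_pairs_two_groups:
  fixes f :: "bool \<Rightarrow> bool \<Rightarrow> real"
  shows "(\<Sum>s\<in>{1..n+m}. \<Sum>t\<in>{1..n+m} - {s}. f (s \<le> n) (t \<le> n))
    = real n * (real n - 1) * f True True + real n * real m * (f True False + f False True)
      + real m * (real m - 1) * f False False"
  unfolding sum_remove_diagonal[OF finite_atLeastAtMost] sum_two_groups
    sum_two_groups[where f = "\<lambda>b. real n * f b True + real m * f b False"] sum_two_groups[where f = "\<lambda>b. f b b"]
  by (simp add: algebra_simps)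

text \<open>
  Besides describing the pooled sample, this locale serves to realise independent samples of any size from two
  given laws, through the product measure.
\<close>

locale two_group_sample = independent_sample M S W "n + m"
  for M :: "'w measure" and S :: "'a measure" and W :: "nat \<Rightarrow> 'w \<Rightarrow> 'a" and n m :: nat +
  fixes P Q :: "'a measure"
  assumes law_group: "s \<in> {1..n+m} \<Longrightarrow> law s = (if s \<le> n then P else Q)"

lemma two_group_sample_PiM:
  fixes P Q S :: "'a measure"
  assumes P: "prob_space P" "sets P = sets S" and Q: "prob_space Q" "sets Q = sets S" and nm: "0 < n + m"
  shows "two_group_sample (PiM {1..n+m} (\<lambda>i. if i \<le> n then P else Q)) S (\<lambda>i \<omega>. \<omega> i) n m P Q"
proof -
  let ?L = "\<lambda>i. if i \<le> n then P else Q" and ?I = "{1..n+m}"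
  let ?M = "PiM ?I ?L"
  have L: "prob_space (?L i)" for i using P Q by simp
  interpret M: prob_space ?M by (intro prob_space_PiM L)
  have [measurable_cong]: "sets (?L i) = sets S" for i using P Q by simp
  have comp: "(\<lambda>\<omega>. \<omega> i) \<in> measurable ?M S" if "i \<in> ?I" for i
    using that by measurable
  have distr: "distr ?M S (\<lambda>\<omega>. \<omega> i) = ?L i" if "i \<in> ?I" for i
  proof -
    have "distr ?M S (\<lambda>\<omega>. \<omega> i) = distr ?M (?L i) (\<lambda>\<omega>. \<omega> i)"
      using P Q by (intro distr_cong) auto
    also have "\<dots> = ?L i" using that by (intro distr_PiM_component L)
    finally show ?thesis .
  qed
  have "M.indep_vars (\<lambda>_. S) (\<lambda>i \<omega>. \<omega> i) ?I"
  proof (subst M.indep_vars_iff_distr_eq_PiM')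
    have sets: "sets (\<Pi>\<^sub>M i\<in>?I. S) = sets ?M" using P Q by (intro sets_PiM_cong) auto
    have "distr ?M (\<Pi>\<^sub>M i\<in>?I. S) (\<lambda>x. \<lambda>i\<in>?I. x i) = distr ?M ?M (\<lambda>x. x)"
      by (intro distr_cong sets) (auto simp: space_PiM intro!: extensional_restrict[symmetric] dest: PiE_restrict)
    also have "\<dots> = ?M" by (rule distr_id2) simp
    also have "\<dots> = (\<Pi>\<^sub>M i\<in>?I. distr ?M S (\<lambda>\<omega>. \<omega> i))"
      by (intro PiM_cong distr[symmetric]) auto
    finally show "distr ?M (\<Pi>\<^sub>M i\<in>?I. S) (\<lambda>x. \<lambda>i\<in>?I. x i) = (\<Pi>\<^sub>M i\<in>?I. distr ?M S (\<lambda>\<omega>. \<omega> i))" .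
  qed (use nm comp in auto)
  then interpret independent_sample ?M S "\<lambda>i \<omega>. \<omega> i" "n + m"
    by unfold_locales
  show ?thesis
    by unfold_locales (unfold law_def, rule distr)
qed

lemma (in prob_space) expectation_affine:
  fixes f g :: "'a \<Rightarrow> real"
  assumes "integrable M f" "integrable M g"
  shows "expectation (\<lambda>\<omega>. a + b * f \<omega> + (c + g \<omega>)) = a + b * expectation f + (c + expectation g)"
  using assms by (simp add: prob_space)

text \<open>
  In terms of mean embeddings, the squared distance of the embeddings of \<open>P\<close> and \<open>Q\<close> is the signed double
  integral, so they agree if it vanishes. The proof avoids constructing the embeddings. Positive
  semidefiniteness at \<open>n\<close> points from \<open>P\<close> with weight 1, \<open>n\<close> points from \<open>Q\<close> with weight -1 and the point
  \<open>x0\<close> with weight \<open>t n\<close> gives, after taking expectations and dividing by \<open>n^2\<close>, the inequality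
  \<open>0 \<le> t^2 b + 2 t \<Delta> + d / n\<close>, where \<open>\<Delta>\<close> is the difference of the two integrals in question. The limit in
  \<open>n\<close> followed by the choice of a suitable \<open>t\<close> of the opposite sign forces \<open>\<Delta> = 0\<close>.
\<close>

lemma sections_agree_if_signed_double_integral_zero:
  fixes K :: "'a \<Rightarrow> 'a \<Rightarrow> real"
  assumes "rkhs (space S) H ip K"
    and Km: "(\<lambda>z. K (fst z) (snd z)) \<in> borel_measurable (S \<Otimes>\<^sub>M S)"
    and sym: "\<And>x y. x \<in> space S \<Longrightarrow> y \<in> space S \<Longrightarrow> K x y = K y x"
    and diag: "\<And>x. x \<in> space S \<Longrightarrow> K x x = b"
    and P: "prob_space P" "sets P = sets S" and Q: "prob_space Q" "sets Q = sets S"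
    and sdi: "signed_double_integral K P Q = 0"
    and x0: "x0 \<in> space S"
  shows "(\<integral>y. K x0 y \<partial>P) = (\<integral>y. K x0 y \<partial>Q)"
proof -
  interpret rkhs "space S" H ip K by fact
  have bound: "\<bar>K x y\<bar> \<le> b" if "x \<in> space S" "y \<in> space S" for x y
  proof -
    have "0 \<le> (\<Sum>i\<in>UNIV. \<Sum>j\<in>UNIV. (if i then 1 else w) * (if j then 1 else w)
        * K (if i then x else y) (if j then x else y))" for w
      using that by (intro kernel_positive_semidefinite) auto
    from this[of 1] this[of "-1"] show ?thesis
      using sym[OF that] diag[OF that(1)] diag[OF that(2)] by (simp add: UNIV_bool)
  qed
  define \<Delta> where "\<Delta> = (\<integral>y. K x0 y \<partial>P) - (\<integral>y. K x0 y \<partial>Q)"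
  define d where "d = 2 * b - pair_expectation K P P - pair_expectation K Q Q"
  have key: "0 \<le> real n * (t^2 * b + 2 * t * \<Delta>) + d" if n: "0 < n" for n :: nat and t :: real
  proof -
    let ?M = "PiM {1..n+n} (\<lambda>i. if i \<le> n then P else Q)"
    interpret two_group_sample ?M S "\<lambda>i \<omega>. \<omega> i" n n P Q
      using n by (intro two_group_sample_PiM P Q) simp
    define \<epsilon> where "\<epsilon> = (\<lambda>i. if i \<le> n then 1 else - 1 :: real)"
    have \<epsilon>2: "\<epsilon> i * \<epsilon> i = 1" for i by (simp add: \<epsilon>_def)
    have W: "\<omega> i \<in> space S" if "\<omega> \<in> space ?M" "i \<in> I" for \<omega> i
      using measurable_space[OF W_measurable[OF that(2)] that(1)] .
    have Km': "(\<lambda>y. K x0 y) \<in> borel_measurable S"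
      using measurable_compose[OF measurable_Pair1'[OF x0] Km] by simp
    have Ki: "integrable ?M (\<lambda>\<omega>. K x0 (\<omega> i))" if "i \<in> I" for i
      using bound[OF x0 W[OF _ that]] measurable_compose[OF W_measurable[OF that] Km']
      by (intro integrable_const_bound[of _ b]) auto
    have KKi: "integrable ?M (\<lambda>\<omega>. K (\<omega> i) (\<omega> j))" if "i \<in> I" "j \<in> I" for i j
      using bound[OF W[OF _ that(1)] W[OF _ that(2)]] pair_measurable[OF Km that]
      by (intro integrable_const_bound[of _ b]) auto
    have pos: "0 \<le> (t * n)^2 * b + 2 * (t * n) * (\<Sum>i\<in>I. \<epsilon> i * K x0 (\<omega> i))
        + (2 * n * b + (\<Sum>s\<in>I. \<Sum>t\<in>I - {s}. \<epsilon> s * \<epsilon> t * K (\<omega> s) (\<omega> t)))"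
      if \<omega>: "\<omega> \<in> space ?M" for \<omega>
    proof -
      \<comment> \<open>the index 0 does not occur in the sample and stands for the additional point \<open>x0\<close>\<close>
      define a where "a = (\<lambda>i. if i = 0 then t * n else \<epsilon> i)"
      define x where "x = (\<lambda>i. if i = 0 then x0 else \<omega> i)"
      have xS: "x i \<in> space S" if "i \<in> insert 0 I" for i using that x0 W[OF \<omega>] by (auto simp: x_def)
      have "0 \<le> (\<Sum>i\<in>insert 0 I. \<Sum>j\<in>insert 0 I. a i * a j * K (x i) (x j))"
        using xS by (intro kernel_positive_semidefinite) auto
      also have "\<dots> = (t * n)^2 * b + (\<Sum>j\<in>I. t * n * (\<epsilon> j * K x0 (\<omega> j)))
          + ((\<Sum>i\<in>I. t * n * (\<epsilon> i * K x0 (\<omega> i))) + (\<Sum>i\<in>I. \<Sum>j\<in>I. \<epsilon> i * \<epsilon> j * K (\<omega> i) (\<omega> j)))"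
      proof -
        have e: "(\<Sum>j\<in>insert 0 I. a i * a j * K (x i) (x j))
            = a i * (t * n) * K (x i) x0 + (\<Sum>j\<in>I. a i * \<epsilon> j * K (x i) (\<omega> j))" for i
          by (simp add: a_def x_def)
        have "(\<Sum>i\<in>I. a i * (t * n) * K (x i) x0 + (\<Sum>j\<in>I. a i * \<epsilon> j * K (x i) (\<omega> j)))
            = (\<Sum>i\<in>I. t * n * (\<epsilon> i * K x0 (\<omega> i)) + (\<Sum>j\<in>I. \<epsilon> i * \<epsilon> j * K (\<omega> i) (\<omega> j)))"
          using sym[OF x0 W[OF \<omega>]] by (intro sum.cong) (auto simp: a_def x_def)
        then show ?thesis
          unfolding e using diag[OF x0]
          by (simp add: a_def x_def sum.distrib power2_eq_square mult_ac)
      qed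
      also have "(\<Sum>i\<in>I. \<Sum>j\<in>I. \<epsilon> i * \<epsilon> j * K (\<omega> i) (\<omega> j))
          = 2 * n * b + (\<Sum>s\<in>I. \<Sum>t\<in>I - {s}. \<epsilon> s * \<epsilon> t * K (\<omega> s) (\<omega> t))"
      proof -
        have "(\<Sum>s\<in>I. \<epsilon> s * \<epsilon> s * K (\<omega> s) (\<omega> s)) = (\<Sum>s\<in>I. b)"
          using diag[OF W[OF \<omega>]] by (intro sum.cong) (auto simp: \<epsilon>2)
        then show ?thesis by (simp add: sum_remove_diagonal)
      qed
      finally show ?thesis by (simp add: sum_distrib_left[symmetric] algebra_simps)
    qed
    have E1: "expectation (\<lambda>\<omega>. K x0 (\<omega> i)) = (\<integral>y. K x0 y \<partial>(if i \<le> n then P else Q))" if "i \<in> I" for i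
      by (simp only: law_group[OF that, symmetric] law_def integral_distr[OF W_measurable[OF that] Km'])
    have E2: "expectation (\<lambda>\<omega>. K (\<omega> s) (\<omega> t))
        = pair_expectation K (if s \<le> n then P else Q) (if t \<le> n then P else Q)"
      if "s \<in> I" "t \<in> I - {s}" for s t
    proof -
      have t: "t \<in> I" "s \<noteq> t" using that by auto
      show ?thesis
        unfolding law_group[OF that(1), symmetric] law_group[OF t(1), symmetric] pair_expectation_def
        using pair_transfer(1)[OF that(1) t Km] by simp
    qed
    have "0 \<le> expectation (\<lambda>\<omega>. (t * n)^2 * b + 2 * (t * n) * (\<Sum>i\<in>I. \<epsilon> i * K x0 (\<omega> i))
        + (2 * n * b + (\<Sum>s\<in>I. \<Sum>t\<in>I - {s}. \<epsilon> s * \<epsilon> t * K (\<omega> s) (\<omega> t))))"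
      by (intro integral_nonneg_AE AE_I2 pos)
    also have "\<dots> = (t * n)^2 * b + 2 * (t * n) * (\<Sum>i\<in>I. \<epsilon> i * expectation (\<lambda>\<omega>. K x0 (\<omega> i)))
        + (2 * n * b + (\<Sum>s\<in>I. \<Sum>t\<in>I - {s}. \<epsilon> s * \<epsilon> t * expectation (\<lambda>\<omega>. K (\<omega> s) (\<omega> t))))"
    proof -
      define A where "A = (\<lambda>\<omega>. \<Sum>i\<in>I. \<epsilon> i * K x0 (\<omega> i))"
      define B where "B = (\<lambda>\<omega>. \<Sum>s\<in>I. \<Sum>t\<in>I - {s}. \<epsilon> s * \<epsilon> t * K (\<omega> s) (\<omega> t))"
      have KKi': "integrable ?M (\<lambda>\<omega>. \<epsilon> s * \<epsilon> t * K (\<omega> s) (\<omega> t))" if "s \<in> I" "t \<in> I - {s}" for s t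
        using KKi[of s t] that by (intro integrable_mult_right) blast
      have Ai: "integrable ?M A"
        unfolding A_def by (intro Bochner_Integration.integrable_sum integrable_mult_right Ki)
      have Bi: "integrable ?M B"
        unfolding B_def by (intro Bochner_Integration.integrable_sum KKi')
      have EA: "expectation A = (\<Sum>i\<in>I. \<epsilon> i * expectation (\<lambda>\<omega>. K x0 (\<omega> i)))"
        unfolding A_def
        by (subst Bochner_Integration.integral_sum) (intro integrable_mult_right Ki, simp, simp)
      have EB: "expectation B = (\<Sum>s\<in>I. \<Sum>t\<in>I - {s}. \<epsilon> s * \<epsilon> t * expectation (\<lambda>\<omega>. K (\<omega> s) (\<omega> t)))"
      proof -
        have "expectation B = (\<Sum>s\<in>I. expectation (\<lambda>\<omega>. \<Sum>t\<in>I - {s}. \<epsilon> s * \<epsilon> t * K (\<omega> s) (\<omega> t)))"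
          unfolding B_def by (intro Bochner_Integration.integral_sum Bochner_Integration.integrable_sum KKi')
        also have "\<dots> = (\<Sum>s\<in>I. \<Sum>t\<in>I - {s}. expectation (\<lambda>\<omega>. \<epsilon> s * \<epsilon> t * K (\<omega> s) (\<omega> t)))"
          by (rule sum.cong[OF refl], rule Bochner_Integration.integral_sum, rule KKi')
        finally show ?thesis by simp
      qed
      have "expectation (\<lambda>\<omega>. (t * n)^2 * b + 2 * (t * n) * A \<omega> + (2 * n * b + B \<omega>))
          = (t * n)^2 * b + 2 * (t * n) * expectation A + (2 * n * b + expectation B)"
        by (rule expectation_affine[OF Ai Bi])
      then show ?thesis unfolding EA EB unfolding A_def B_def .
    qed
    also have "(\<Sum>i\<in>I. \<epsilon> i * expectation (\<lambda>\<omega>. K x0 (\<omega> i))) = real n * \<Delta>"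
    proof -
      let ?f = "\<lambda>g. (if g then 1 else -1) * (\<integral>y. K x0 y \<partial>(if g then P else Q))"
      have "(\<Sum>i\<in>I. \<epsilon> i * expectation (\<lambda>\<omega>. K x0 (\<omega> i))) = (\<Sum>i\<in>I. ?f (i \<le> n))"
      proof (rule sum.cong[OF refl])
        fix i assume i: "i \<in> I"
        show "\<epsilon> i * expectation (\<lambda>\<omega>. K x0 (\<omega> i)) = ?f (i \<le> n)"
          unfolding E1[OF i] by (simp add: \<epsilon>_def)
      qed
      also have "\<dots> = real n * ?f True + real n * ?f False" by (rule sum_two_groups)
      also have "\<dots> = real n * \<Delta>" by (simp add: \<Delta>_def algebra_simps)
      finally show ?thesis .
    qed
    also have "(\<Sum>s\<in>I. \<Sum>t\<in>I - {s}. \<epsilon> s * \<epsilon> t * expectation (\<lambda>\<omega>. K (\<omega> s) (\<omega> t)))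
        = - real n * (pair_expectation K P P + pair_expectation K Q Q)"
    proof -
      let ?f = "\<lambda>g g'. (if g then 1 else -1) * (if g' then 1 else -1)
          * pair_expectation K (if g then P else Q) (if g' then P else Q)"
      have "(\<Sum>s\<in>I. \<Sum>t\<in>I - {s}. \<epsilon> s * \<epsilon> t * expectation (\<lambda>\<omega>. K (\<omega> s) (\<omega> t)))
          = (\<Sum>s\<in>I. \<Sum>t\<in>I - {s}. ?f (s \<le> n) (t \<le> n))"
      proof (rule sum.cong[OF refl], rule sum.cong[OF refl])
        fix s t assume st: "s \<in> I" "t \<in> I - {s}"
        show "\<epsilon> s * \<epsilon> t * expectation (\<lambda>\<omega>. K (\<omega> s) (\<omega> t)) = ?f (s \<le> n) (t \<le> n)"
          unfolding E2[OF st] by (simp add: \<epsilon>_def)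
      qed
      also have "\<dots> = real n * (real n - 1) * ?f True True + real n * real n * (?f True False + ?f False True)
          + real n * (real n - 1) * ?f False False"
        by (rule sum_pairs_two_groups)
      also have "\<dots> = real n * real n * signed_double_integral K P Q
          - real n * (pair_expectation K P P + pair_expectation K Q Q)"
        by (simp add: signed_double_integral_def algebra_simps)
      also have "\<dots> = - real n * (pair_expectation K P P + pair_expectation K Q Q)" using sdi by simp
      finally show ?thesis .
    qed
    finally have "0 \<le> real n * (real n * (t^2 * b + 2 * t * \<Delta>) + d)"
      by (simp add: d_def power2_eq_square algebra_simps)
    then show ?thesis using n by (simp add: zero_le_mult_iff)
  qed
  have quad: "0 \<le> t^2 * b + 2 * t * \<Delta>" for t
  proof (rule ccontr)
    assume "\<not> 0 \<le> t^2 * b + 2 * t * \<Delta>"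
    then have neg: "0 < - (t^2 * b + 2 * t * \<Delta>)" by simp
    obtain N :: nat where N: "d < real N * - (t^2 * b + 2 * t * \<Delta>)"
      using ex_less_of_nat_mult[OF neg] by blast
    have "real N * - (t^2 * b + 2 * t * \<Delta>) \<le> real (Suc N) * - (t^2 * b + 2 * t * \<Delta>)"
      using neg by (intro mult_right_mono) auto
    then show False using N key[of "Suc N" t] by linarith
  qed
  have b: "0 \<le> b" using bound[OF x0 x0] by linarith
  have "\<Delta> = 0"
  proof (rule ccontr)
    assume \<Delta>: "\<Delta> \<noteq> 0"
    \<comment> \<open>the denominator \<open>b + 1\<close> covers the case \<open>b = 0\<close>\<close>
    define t where "t = - \<Delta> / (b + 1)"
    have tb: "t * (b + 1) = - \<Delta>" using b by (simp add: t_def)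
    have "(t^2 * b + 2 * t * \<Delta>) * (b + 1)^2 = (t * (b + 1))^2 * b + 2 * (t * (b + 1)) * \<Delta> * (b + 1)"
      by (simp add: power2_eq_square algebra_simps)
    also have "\<dots> = - (\<Delta>^2 * (b + 2))" unfolding tb by (simp add: power2_eq_square algebra_simps)
    also have "\<dots> < 0" using \<Delta> b by (simp add: mult_pos_pos)
    finally have "(t^2 * b + 2 * t * \<Delta>) * (b + 1)^2 < 0" .
    moreover have "0 \<le> (t^2 * b + 2 * t * \<Delta>) * (b + 1)^2" using quad by (intro mult_nonneg_nonneg) auto
    ultimately show False by linarith
  qed
  then show ?thesis by (simp add: \<Delta>_def)
qed

context two_laws_kernel
begin

text \<open>
  If the variance were zero, the signed double integral of \<open>k\<close> would vanish. Strong negative type makes it negative;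
  for a characteristic kernel it forces the mean embeddings of the two laws, hence the laws, to coincide. The
  point \<open>z0\<close> required by strong negative type exists because almost every section of \<open>k\<close> is integrable.
\<close>

lemma kernel_variance_pos:
  assumes ker: "kernel_on S k" and diag: "\<And>x. x \<in> space S \<Longrightarrow> k x x = a0" and ne: "P \<noteq> Q"
  shows "0 < kernel_variance k R"
proof (rule ccontr)
  assume "\<not> 0 < kernel_variance k R"
  moreover have "0 \<le> kernel_variance k R"
    unfolding kernel_variance_eq by (intro integral_nonneg_AE) auto
  ultimately have sdi: "signed_double_integral k P Q = 0"
    by (intro signed_double_integral_zero) simp
  have alg: "P \<in> space (prob_algebra S)" "Q \<in> space (prob_algebra S)"
    using P_prob Q_prob sets_P sets_Q by (auto simp: space_prob_algebra)
  have "strong_negative_type S k \<or>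
      (\<exists>H ip. rkhs (space S) H ip (\<lambda>x y. - k x y)) \<and> characteristic_kernel S (\<lambda>x y. - k x y)"
    using ker by (simp add: kernel_on_def)
  then show False
  proof
    assume snt: "strong_negative_type S k"
    have "AE z in R. z \<in> space S \<and> integrable R (k z)"
      using k_section_integrable AE_space by eventually_elim (simp add: space_laws)
    then have "\<exists>z0. z0 \<in> space S \<and> integrable R (k z0)"
      by (rule eventually_happens'[OF R.ae_filter_bot])
    then obtain z0 where z0: "z0 \<in> space S" "integrable R (k z0)" by blast
    have "integrable D (\<lambda>z. k z z0)" if "D = P \<or> D = Q" for D
    proof -
      have "integrable D (k z0)" using integrable_mixture[OF z0(2)] that by auto
      moreover have "integrable D (k z0) \<longleftrightarrow> integrable D (\<lambda>z. k z z0)"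
        using that z0(1) by (intro Bochner_Integration.integrable_cong) (auto simp: space_laws k_sym)
      ultimately show ?thesis by simp
    qed
    then have "signed_double_integral k P Q < 0"
      using snt alg ne z0(1) unfolding strong_negative_type_def by blast
    then show False using sdi by simp
  next
    assume b: "(\<exists>H ip. rkhs (space S) H ip (\<lambda>x y. - k x y)) \<and> characteristic_kernel S (\<lambda>x y. - k x y)"
    then obtain H ip where H: "rkhs (space S) H ip (\<lambda>x y. - k x y)" by blast
    have "signed_double_integral (\<lambda>x y. - k x y) P Q = 0"
      using sdi by (simp add: signed_double_integral_def pair_expectation_def)
    then have "(\<integral>y. - k x y \<partial>P) = (\<integral>y. - k x y \<partial>Q)" if "x \<in> space S" for x
      using that by (intro sections_agree_if_signed_double_integral_zero[OF H, where b = "- a0"])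
        (auto simp: k_sym diag P_prob Q_prob sets_P sets_Q)
    then have "mean_embedding S (\<lambda>x y. - k x y) P = mean_embedding S (\<lambda>x y. - k x y) Q"
      unfolding mean_embedding_def by fastforce
    then have "P = Q"
      using b alg unfolding characteristic_kernel_def by (auto dest: inj_onD)
    then show False using ne by simp
  qed
qed

section \<open>Mean deviation of the estimator\<close>

text \<open>
  The diagonal part of the second moment contributes at most \<open>c\<rho>^2 * N * V\<close>. By the balance of the conditional means,
  the sum of the conditional means over the whole sample is \<open>N e (u P - u Q)\<close> with \<open>e = n / N - \<rho>\<close>, and omitting
  the entry \<open>s\<close> itself costs one more term \<open>u (law s)\<close>.
\<close>

lemma row_sum_bound:
  fixes n m :: nat
  assumes "two_group_sample M S W n m P Q" and s: "s \<in> {1..n+m}"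
  defines "V \<equiv> kernel_variance k R" and "N \<equiv> real (n + m)"
  defines "e \<equiv> real n / N - \<rho>"
  shows "integrable M (\<lambda>\<omega>. (\<Sum>t\<in>{1..n+m} - {s}. h (W s \<omega>) (W t \<omega>))^2)"
    and "(\<integral>\<omega>. (\<Sum>t\<in>{1..n+m} - {s}. h (W s \<omega>) (W t \<omega>))^2 \<partial>M) \<le> c\<rho>^2 * V * (3 * N + 8 * N^2 * e^2)"
proof -
  interpret two_group_sample M S W n m P Q by fact
  let ?h = "\<lambda>z. h (fst z) (snd z)"
  have law: "law t = P \<or> law t = Q" if "t \<in> I" for t using law_group[OF that] by auto
  have hm: "?h \<in> borel_measurable (S \<Otimes>\<^sub>M S)" by (rule h_measurable)
  have h2: "integrable (law s \<Otimes>\<^sub>M law t) (\<lambda>z. (?h z)^2)" if "t \<in> I - {s}" for t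
    using that by (intro h_square_pair(1) law s) auto
  note rs = row_sum_second_moment[OF hm s h2]
  show "integrable M (\<lambda>\<omega>. (\<Sum>t\<in>I - {s}. h (W s \<omega>) (W t \<omega>))^2)"
    using rs(1) by simp
  define u where "u = (\<lambda>D x. \<integral>y. h x y \<partial>D)"
  define CV where "CV = c\<rho>^2 * V"
  have N: "1 \<le> N" using s by (auto simp: N_def)
  have Nnm: "N = real n + real m" by (simp add: N_def)
  have ui: "integrable (law s) (\<lambda>x. (u D x)^2)" and u2: "(\<integral>x. (u D x)^2 \<partial>law s) \<le> CV"
    if D: "D = P \<or> D = Q" for D
  proof -
    note [measurable_cong] = law_cases_prob(2)[OF D]
    have "?h \<in> borel_measurable (law s \<Otimes>\<^sub>M D)" by measurable
    note c = conditional_mean_square[OF law_prob[OF s] law_cases_prob(1)[OF D] this h_square_pair(1)[OF law[OF s] D]]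
    show "integrable (law s) (\<lambda>x. (u D x)^2)" using c(2) by (simp add: u_def)
    show "(\<integral>x. (u D x)^2 \<partial>law s) \<le> CV"
      using c(3) h_square_pair(2)[OF law[OF s] D] by (simp add: u_def CV_def V_def)
  qed
  have sum_u: "(\<Sum>t\<in>I - {s}. u (law t) x) = real n * u P x + real m * u Q x - u (law s) x" for x
  proof -
    have "(\<Sum>t\<in>I. u (law t) x) = (\<Sum>t\<in>I. u (if t \<le> n then P else Q) x)"
      by (intro sum.cong refl) (simp add: law_group)
    also have "\<dots> = real n * u P x + real m * u Q x"
      using sum_two_groups[of "\<lambda>b. u (if b then P else Q) x" n m] by simp
    finally show ?thesis using sum_diff1[of I "\<lambda>t. u (law t) x" s] s by simp
  qed
  have ae: "AE x in law s. (\<Sum>t\<in>I - {s}. u (law t) x)^2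
      \<le> 4 * N^2 * e^2 * ((u P x)^2 + (u Q x)^2) + 2 * (u (law s) x)^2"
    using conditional_means_balance[OF law[OF s]]
  proof eventually_elim
    case (elim x)
    then have bal: "\<rho> * u P x + (1 - \<rho>) * u Q x = 0" by (simp add: u_def)
    have Ne: "N * e = real n - N * \<rho>" using N by (simp add: e_def field_simps)
    have "real n * u P x + real m * u Q x = N * e * (u P x - u Q x)"
      using bal Ne Nnm by algebra
    then have eq: "(\<Sum>t\<in>I - {s}. u (law t) x) = N * e * (u P x - u Q x) - u (law s) x"
      unfolding sum_u by (simp only:)
    have diff: "(a - b)^2 \<le> 2 * a^2 + 2 * b^2" for a b :: real
      using zero_le_power2[of "a + b"] by (simp add: power2_eq_square algebra_simps)
    have "(\<Sum>t\<in>I - {s}. u (law t) x)^2 \<le> 2 * ((N * e)^2 * (u P x - u Q x)^2) + 2 * (u (law s) x)^2"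
      unfolding eq using diff[of "N * e * (u P x - u Q x)" "u (law s) x"] by (simp add: power_mult_distrib)
    also have "\<dots> \<le> 2 * ((N * e)^2 * (2 * (u P x)^2 + 2 * (u Q x)^2)) + 2 * (u (law s) x)^2"
      by (intro add_right_mono mult_left_mono diff) auto
    finally show ?case by (simp add: power_mult_distrib algebra_simps)
  qed
  have PQ: "P = P \<or> P = Q" "Q = P \<or> Q = Q" by auto
  have "(\<integral>x. (\<Sum>t\<in>I - {s}. u (law t) x)^2 \<partial>law s)
      \<le> (\<integral>x. 4 * N^2 * e^2 * ((u P x)^2 + (u Q x)^2) + 2 * (u (law s) x)^2 \<partial>law s)"
  proof (rule integral_mono_AE')
    show "integrable (law s) (\<lambda>x. 4 * N^2 * e^2 * ((u P x)^2 + (u Q x)^2) + 2 * (u (law s) x)^2)"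
      using ui[OF PQ(1)] ui[OF PQ(2)] ui[OF law[OF s]] by simp
  qed (use ae in auto)
  also have "\<dots> = 4 * N^2 * e^2 * ((\<integral>x. (u P x)^2 \<partial>law s) + (\<integral>x. (u Q x)^2 \<partial>law s)) + 2 * (\<integral>x. (u (law s) x)^2 \<partial>law s)"
    using ui[OF PQ(1)] ui[OF PQ(2)] ui[OF law[OF s]] by simp
  also have "\<dots> \<le> 4 * N^2 * e^2 * (CV + CV) + 2 * CV"
    by (intro add_mono mult_left_mono u2 PQ law s) auto
  finally have second: "(\<integral>x. (\<Sum>t\<in>I - {s}. u (law t) x)^2 \<partial>law s) \<le> 8 * N^2 * e^2 * CV + 2 * CV" by simp
  have CV0: "0 \<le> CV"
    unfolding CV_def V_def kernel_variance_eq by (intro mult_nonneg_nonneg integral_nonneg_AE) auto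
  have "(\<Sum>t\<in>I - {s}. \<integral>z. (?h z)^2 \<partial>(law s \<Otimes>\<^sub>M law t)) \<le> (\<Sum>t\<in>I - {s}. CV)"
    unfolding CV_def V_def by (intro sum_mono h_square_pair(2) law s) auto
  also have "\<dots> = real (card (I - {s})) * CV" by simp
  also have "\<dots> \<le> N * CV"
    using CV0 card_mono[of I "I - {s}"] by (intro mult_right_mono) (auto simp: N_def)
  finally have first: "(\<Sum>t\<in>I - {s}. \<integral>z. (?h z)^2 \<partial>(law s \<Otimes>\<^sub>M law t)) \<le> N * CV" .
  have "(\<integral>\<omega>. (\<Sum>t\<in>I - {s}. h (W s \<omega>) (W t \<omega>))^2 \<partial>M) \<le> N * CV + (8 * N^2 * e^2 * CV + 2 * CV)"
    using rs(2) first second by (simp add: u_def)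
  also have "\<dots> \<le> CV * (3 * N + 8 * N^2 * e^2)"
    using mult_right_mono[OF N CV0] by (simp add: algebra_simps)
  finally show "(\<integral>\<omega>. (\<Sum>t\<in>I - {s}. h (W s \<omega>) (W t \<omega>))^2 \<partial>M) \<le> c\<rho>^2 * V * (3 * N + 8 * N^2 * e^2)"
    by (simp add: CV_def)
qed

text \<open>
  The three summands of the bound are the fluctuation of the sum of squares after truncation at \<open>\<delta> N V\<close>, the bias
  of its mean, and the contribution of the row sums and the total sum. The square of the total sum needs no
  separate treatment, since by Cauchy-Schwarz it is at most \<open>N\<close> times the sum of the squared row sums.
\<close>

lemma variance_ratio_L1_bound:
  fixes n m :: nat and \<delta> \<tau> :: real
  assumes "two_group_sample M S W n m P Q"
  defines "V \<equiv> kernel_variance k R" and "N \<equiv> real (n + m)" and "I \<equiv> {1..n+m}"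
  defines "e \<equiv> real n / N - \<rho>" and "C \<equiv> c\<rho>^2"
  assumes V: "0 < V" and N: "3 < n + m" and \<delta>: "0 < \<delta>" and \<tau>: "0 < \<tau>" "\<tau> \<le> 1"
  defines "L \<equiv> 6 powr (2 + 2 * \<tau>) * (5 * (centered_abs_moment (2 + 2 * \<tau>) k P P
      + centered_abs_moment (2 + 2 * \<tau>) k P Q + centered_abs_moment (2 + 2 * \<tau>) k Q Q)
      + \<bar>energy k P Q\<bar> powr (2 + 2 * \<tau>))"
  defines "U \<equiv> \<lambda>\<omega>. ((\<Sum>s\<in>I. \<Sum>t\<in>I - {s}. (h (W s \<omega>) (W t \<omega>))^2)
        - 2 / (N - 2) * (\<Sum>s\<in>I. (\<Sum>t\<in>I - {s}. h (W s \<omega>) (W t \<omega>))^2)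
        + (\<Sum>s\<in>I. \<Sum>t\<in>I - {s}. h (W s \<omega>) (W t \<omega>))^2 / ((N - 1) * (N - 2))) / (N * (N - 3))"
  shows "integrable M (\<lambda>\<omega>. \<bar>U \<omega> / V - 1\<bar>)"
    and "(\<integral>\<omega>. \<bar>U \<omega> / V - 1\<bar> \<partial>M) \<le>
      (2 * N^2 * (sqrt (\<delta> * C) + L / (N powr \<tau> * V powr (1 + \<tau>)) / \<delta> powr \<tau>)
       + C * (\<bar>real n * (real n - 1) - N * (N - 3) * \<rho>^2\<bar>
              + 2 * \<bar>real n * real m - N * (N - 3) * (\<rho> * (1 - \<rho>))\<bar>
              + \<bar>real m * (real m - 1) - N * (N - 3) * (1 - \<rho>)^2\<bar>)
       + (2 / (N - 2) + N / ((N - 1) * (N - 2))) * (N * (C * (3 * N + 8 * N^2 * e^2)))) / (N * (N - 3))"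
      (is "_ \<le> ?bound")
proof -
  interpret two_group_sample M S W n m P Q by fact
  let ?h = "\<lambda>z. h (fst z) (snd z)"
  have law: "law t = P \<or> law t = Q" if "t \<in> I" for t using law_group that by (auto simp: I_def)
  have hm: "?h \<in> borel_measurable (S \<Otimes>\<^sub>M S)" by (rule h_measurable)
  have pI: "fst p \<in> I" "snd p \<in> I" "fst p \<noteq> snd p" if "p \<in> pairs" for p
    using pairsD[OF that] by (auto simp: I_def)
  have N3: "3 < N" using N by (simp add: N_def)
  have C0: "0 \<le> C" by (simp add: C_def)
  define H where "H = (\<lambda>p \<omega>. (?h (W (fst p) \<omega>, W (snd p) \<omega>))^2)"
  define r where "r = (\<lambda>s \<omega>. \<Sum>t\<in>I - {s}. h (W s \<omega>) (W t \<omega>))"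
  define S2 where "S2 = (\<lambda>\<omega>. \<Sum>s\<in>I. (r s \<omega>)^2)"
  define E2 where "E2 = (\<lambda>D D'. \<integral>z. (?h z)^2 \<partial>(D \<Otimes>\<^sub>M D'))"
  have h2m: "(\<lambda>z. (?h z)^2) \<in> borel_measurable (S \<Otimes>\<^sub>M S)" using hm by measurable
  have Hi: "integrable M (H p)" and HE: "expectation (H p) = E2 (law (fst p)) (law (snd p))" if "p \<in> pairs" for p
  proof -
    note t = pair_transfer[OF pI(1,2,3)[OF that, unfolded I_def] h2m]
    show "integrable M (H p)"
      unfolding H_def using t(2) h_square_pair(1)[OF law law, OF pI(1,2)[OF that]] by blast
    show "expectation (H p) = E2 (law (fst p)) (law (snd p))"
      unfolding H_def E2_def by (rule t(1))
  qed
  have E2_le: "E2 D D' \<le> C * V" and E2_nonneg: "0 \<le> E2 D D'"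
    if "D = P \<or> D = Q" "D' = P \<or> D' = Q" for D D'
    using h_square_pair(2)[OF that] by (auto simp: E2_def C_def V_def intro!: integral_nonneg_AE)
  have CV: "0 \<le> C * V" using C0 V by simp
  have L0: "0 \<le> L"
    unfolding L_def centered_abs_moment_def pair_expectation_def
    by (intro mult_nonneg_nonneg add_nonneg_nonneg integral_nonneg_AE) auto
  \<comment> \<open>at this level the variance bound is \<open>4 \<delta> C (N^2 V)^2\<close>, of the order of the square of the mean, with the small factor \<open>\<delta>\<close>\<close>
  define B where "B = \<delta> * N * V"
  have B: "0 < B" using \<delta> N3 V by (simp add: B_def)
  have hq: "(x^2) powr (1 + \<tau>) = \<bar>x\<bar> powr (2 + 2 * \<tau>)" for x :: real
  proof -
    have "x^2 = \<bar>x\<bar> powr 2" by (simp add: powr_numeral)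
    then show ?thesis by (simp only: powr_powr distrib_left mult_1_right)
  qed
  have hqm: "(\<lambda>z. \<bar>?h z\<bar> powr (2 + 2 * \<tau>)) \<in> borel_measurable (S \<Otimes>\<^sub>M S)" using hm by measurable
  have q: "1 \<le> 2 + 2 * \<tau>" "2 + 2 * \<tau> \<le> 4" using \<tau> by auto
  have Hti: "integrable M (\<lambda>\<omega>. H p \<omega> powr (1 + \<tau>))"
    and HtL: "expectation (\<lambda>\<omega>. H p \<omega> powr (1 + \<tau>)) \<le> L" if "p \<in> pairs" for p
  proof -
    note t = pair_transfer[OF pI(1,2,3)[OF that, unfolded I_def] hqm]
    note mom = h_moment[OF law law q, OF pI(1,2)[OF that]]
    show "integrable M (\<lambda>\<omega>. H p \<omega> powr (1 + \<tau>))"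
      unfolding H_def hq using t(2) mom(1) by blast
    show "expectation (\<lambda>\<omega>. H p \<omega> powr (1 + \<tau>)) \<le> L"
      unfolding H_def hq t(1) L_def by (rule mom(2))
  qed
  have dev: "(\<integral>\<omega>. \<bar>\<Sum>p\<in>pairs. H p \<omega> - expectation (H p)\<bar> \<partial>M)
      \<le> V * (2 * N^2 * (sqrt (\<delta> * C) + L / (N powr \<tau> * V powr (1 + \<tau>)) / \<delta> powr \<tau>))"
  proof -
    have "(\<integral>\<omega>. \<bar>\<Sum>p\<in>pairs. H p \<omega> - expectation (H p)\<bar> \<partial>M)
        \<le> sqrt (4 * (real (n + m))^3 * (B * (C * V))) + 2 * (real (n + m))^2 * (L / B powr \<tau>)"
      unfolding H_def
    proof (rule pair_sum_of_squares_deviation[OF hm \<tau>(1) B])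
      fix p assume p: "p \<in> pairs"
      show "integrable M (\<lambda>\<omega>. (?h (W (fst p) \<omega>, W (snd p) \<omega>))^2)"
        using Hi[OF p] unfolding H_def .
      show "expectation (\<lambda>\<omega>. (?h (W (fst p) \<omega>, W (snd p) \<omega>))^2) \<le> C * V"
        using HE[OF p] E2_le[OF law law, OF pI(1,2)[OF p]] unfolding H_def by linarith
      show "integrable M (\<lambda>\<omega>. ((?h (W (fst p) \<omega>, W (snd p) \<omega>))^2) powr (1 + \<tau>))"
        using Hti[OF p] unfolding H_def .
      show "expectation (\<lambda>\<omega>. ((?h (W (fst p) \<omega>, W (snd p) \<omega>))^2) powr (1 + \<tau>)) \<le> L"
        using HtL[OF p] unfolding H_def .
    qed (rule CV, rule L0)
    also have "sqrt (4 * (real (n + m))^3 * (B * (C * V))) = 2 * N^2 * V * sqrt (\<delta> * C)"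
    proof -
      have "4 * (real (n + m))^3 * (B * (C * V)) = (2 * N^2 * V)^2 * (\<delta> * C)"
        by (simp add: B_def N_def power2_eq_square power3_eq_cube)
      then have "sqrt (4 * (real (n + m))^3 * (B * (C * V))) = \<bar>2 * N^2 * V\<bar> * sqrt (\<delta> * C)"
        by (simp only: real_sqrt_mult[of "(2 * N^2 * V)^2"] real_sqrt_abs)
      moreover have "0 \<le> 2 * N^2 * V" using V by simp
      ultimately show ?thesis by (simp only: abs_of_nonneg)
    qed
    also have "L / B powr \<tau> = V * (L / (N powr \<tau> * V powr (1 + \<tau>)) / \<delta> powr \<tau>)"
      using \<delta> N3 V by (simp add: B_def powr_mult powr_add)
    finally show ?thesis by (simp add: N_def algebra_simps)
  qed
  have mean: "\<bar>(\<Sum>p\<in>pairs. expectation (H p)) - N * (N - 3) * V\<bar> \<le>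
     V * (C * (\<bar>real n * (real n - 1) - N * (N - 3) * \<rho>^2\<bar>
              + 2 * \<bar>real n * real m - N * (N - 3) * (\<rho> * (1 - \<rho>))\<bar>
              + \<bar>real m * (real m - 1) - N * (N - 3) * (1 - \<rho>)^2\<bar>))"
  proof -
    let ?D = "\<lambda>b. if b then P else Q"
    have sumE: "(\<Sum>p\<in>pairs. expectation (H p)) = real n * (real n - 1) * E2 P P
        + real n * real m * (E2 P Q + E2 Q P) + real m * (real m - 1) * E2 Q Q"
    proof -
      have "(\<Sum>p\<in>pairs. expectation (H p)) = (\<Sum>p\<in>pairs. E2 (?D (fst p \<le> n)) (?D (snd p \<le> n)))"
      proof (rule sum.cong[OF refl])
        fix p assume p: "p \<in> pairs"
        show "expectation (H p) = E2 (?D (fst p \<le> n)) (?D (snd p \<le> n))"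
          unfolding HE[OF p] using law_group pI[OF p] by (simp add: I_def)
      qed
      also have "\<dots> = (\<Sum>s\<in>{1..n+m}. \<Sum>t\<in>{1..n+m} - {s}. E2 (?D (s \<le> n)) (?D (t \<le> n)))"
        by (rule sum_pairs[symmetric])
      finally show ?thesis using sum_pairs_two_groups[of "\<lambda>b b'. E2 (?D b) (?D b')" n m] by simp
    qed
    have VE: "V = \<rho>^2 * E2 P P + \<rho> * (1 - \<rho>) * (E2 P Q + E2 Q P) + (1 - \<rho>)^2 * E2 Q Q"
      unfolding V_def kernel_variance_eq E2_def by (rule integral_pair_mixture[OF h_square])
    define d1 d2 d3 where "d1 = real n * (real n - 1) - N * (N - 3) * \<rho>^2"
      and "d2 = real n * real m - N * (N - 3) * (\<rho> * (1 - \<rho>))"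
      and "d3 = real m * (real m - 1) - N * (N - 3) * (1 - \<rho>)^2"
    have "(\<Sum>p\<in>pairs. expectation (H p)) - N * (N - 3) * V
        = d1 * E2 P P + (d2 * E2 P Q + d2 * E2 Q P) + d3 * E2 Q Q"
      unfolding sumE VE d1_def d2_def d3_def by (simp add: algebra_simps)
    also have "\<bar>\<dots>\<bar> \<le> \<bar>d1 * E2 P P\<bar> + (\<bar>d2 * E2 P Q\<bar> + \<bar>d2 * E2 Q P\<bar>) + \<bar>d3 * E2 Q Q\<bar>" by linarith
    also have "\<dots> \<le> \<bar>d1\<bar> * (C * V) + (\<bar>d2\<bar> * (C * V) + \<bar>d2\<bar> * (C * V)) + \<bar>d3\<bar> * (C * V)"
      unfolding abs_mult by (intro add_mono mult_left_mono) (auto simp: E2_nonneg E2_le)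
    finally show ?thesis by (simp add: d1_def d2_def d3_def algebra_simps)
  qed
  have rows: "integrable M (\<lambda>\<omega>. (r s \<omega>)^2)" "expectation (\<lambda>\<omega>. (r s \<omega>)^2) \<le> V * (C * (3 * N + 8 * N^2 * e^2))"
    if "s \<in> I" for s
    using row_sum_bound[OF \<open>two_group_sample M S W n m P Q\<close>, of s] that
    unfolding r_def I_def V_def C_def N_def e_def by (auto simp: mult_ac)
  have S2i: "integrable M S2" unfolding S2_def by (intro Bochner_Integration.integrable_sum rows)
  have S2E: "expectation S2 \<le> V * (N * (C * (3 * N + 8 * N^2 * e^2)))"
  proof -
    have "expectation S2 = (\<Sum>s\<in>I. expectation (\<lambda>\<omega>. (r s \<omega>)^2))"
      unfolding S2_def by (rule Bochner_Integration.integral_sum) (rule rows)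
    also have "\<dots> \<le> (\<Sum>s\<in>I. V * (C * (3 * N + 8 * N^2 * e^2)))" by (intro sum_mono rows)
    also have "\<dots> = N * (V * (C * (3 * N + 8 * N^2 * e^2)))" by (simp add: I_def N_def)
    finally show ?thesis by (simp add: mult_ac)
  qed
  define T where "T = (\<lambda>\<omega>. \<Sum>s\<in>I. r s \<omega>)"
  have T2: "(T \<omega>)^2 \<le> N * S2 \<omega>" for \<omega>
    using sum_squared_le_sum_of_squares[of "\<lambda>s. r s \<omega>" I]
    by (simp add: T_def S2_def I_def N_def mult.commute)
  define a where "a = 2 / (N - 2) + N / ((N - 1) * (N - 2))"
  have a0: "0 \<le> a" using N3 by (simp add: a_def)
  have U_eq: "U \<omega> * (N * (N - 3)) = (\<Sum>p\<in>pairs. H p \<omega>) - 2 / (N - 2) * S2 \<omega> + (T \<omega>)^2 / ((N - 1) * (N - 2))" for \<omega>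
  proof -
    have "(\<Sum>s\<in>I. \<Sum>t\<in>I - {s}. (h (W s \<omega>) (W t \<omega>))^2) = (\<Sum>p\<in>pairs. H p \<omega>)"
      unfolding I_def H_def sum_pairs by simp
    then show ?thesis
      using N3 unfolding U_def by (simp add: S2_def T_def r_def)
  qed
  have point: "\<bar>U \<omega> / V - 1\<bar> \<le> (\<bar>\<Sum>p\<in>pairs. H p \<omega> - expectation (H p)\<bar>
      + \<bar>(\<Sum>p\<in>pairs. expectation (H p)) - N * (N - 3) * V\<bar> + a * S2 \<omega>) / (V * (N * (N - 3)))" for \<omega>
  proof -
    have NN: "0 < N * (N - 3)" using N3 by simp
    have S0: "0 \<le> S2 \<omega>" by (simp add: S2_def sum_nonneg)
    have t: "0 \<le> (T \<omega>)^2 / ((N - 1) * (N - 2))" "(T \<omega>)^2 / ((N - 1) * (N - 2)) \<le> N * S2 \<omega> / ((N - 1) * (N - 2))"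
      using N3 T2[of \<omega>] by (auto intro!: divide_right_mono)
    have u: "0 \<le> 2 / (N - 2) * S2 \<omega>" using N3 S0 by simp
    have aS: "a * S2 \<omega> = 2 / (N - 2) * S2 \<omega> + N * S2 \<omega> / ((N - 1) * (N - 2))"
      by (simp add: a_def algebra_simps)
    have sH: "(\<Sum>p\<in>pairs. H p \<omega> - expectation (H p)) = (\<Sum>p\<in>pairs. H p \<omega>) - (\<Sum>p\<in>pairs. expectation (H p))"
      by (simp add: sum_subtractf)
    have diff: "\<bar>U \<omega> * (N * (N - 3)) - N * (N - 3) * V\<bar>
        \<le> \<bar>\<Sum>p\<in>pairs. H p \<omega> - expectation (H p)\<bar> + \<bar>(\<Sum>p\<in>pairs. expectation (H p)) - N * (N - 3) * V\<bar> + a * S2 \<omega>"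
      unfolding U_eq sH aS using t u by linarith
    have ratio: "U \<omega> / V - 1 = (U \<omega> * (N * (N - 3)) - N * (N - 3) * V) / (V * (N * (N - 3)))"
    proof -
      have "U \<omega> * (N * (N - 3)) - N * (N - 3) * V = (U \<omega> - V) * (N * (N - 3))"
        by (simp add: algebra_simps)
      then have "(U \<omega> * (N * (N - 3)) - N * (N - 3) * V) / (V * (N * (N - 3))) = (U \<omega> - V) / V"
        using NN N3 by simp
      then show ?thesis using V by (simp add: diff_divide_distrib)
    qed
    have D: "0 < V * (N * (N - 3))" using V NN by (rule mult_pos_pos)
    show ?thesis
      unfolding ratio abs_divide abs_of_pos[OF D] by (rule divide_right_mono[OF diff less_imp_le[OF D]])
  qed
  define G where "G = (\<lambda>\<omega>. (\<bar>\<Sum>p\<in>pairs. H p \<omega> - expectation (H p)\<bar>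
      + \<bar>(\<Sum>p\<in>pairs. expectation (H p)) - N * (N - 3) * V\<bar> + a * S2 \<omega>) / (V * (N * (N - 3))))"
  have Gi: "integrable M G"
    unfolding G_def using Hi S2i
    by (intro integrable_divide Bochner_Integration.integrable_add integrable_abs
        Bochner_Integration.integrable_sum Bochner_Integration.integrable_diff integrable_mult_right) auto
  have hWm: "(\<lambda>\<omega>. h (W s \<omega>) (W t \<omega>)) \<in> borel_measurable M" if "s \<in> I" "t \<in> I" for s t
    using pair_measurable[OF hm, of s t] that by (simp add: I_def)
  have Um: "U \<in> borel_measurable M"
    unfolding U_def
    by (intro borel_measurable_divide borel_measurable_add borel_measurable_diff borel_measurable_times
        borel_measurable_power borel_measurable_sum borel_measurable_const hWm) auto
  show Ui: "integrable M (\<lambda>\<omega>. \<bar>U \<omega> / V - 1\<bar>)"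
  proof (rule Bochner_Integration.integrable_bound[OF Gi])
    show "AE \<omega> in M. norm \<bar>U \<omega> / V - 1\<bar> \<le> norm (G \<omega>)"
    proof (rule AE_I2)
      fix \<omega> show "norm \<bar>U \<omega> / V - 1\<bar> \<le> norm (G \<omega>)"
        using point[of \<omega>] abs_ge_self[of "G \<omega>"] unfolding G_def by simp
    qed
  qed (use Um in measurable)
  have "(\<integral>\<omega>. \<bar>U \<omega> / V - 1\<bar> \<partial>M) \<le> (\<integral>\<omega>. G \<omega> \<partial>M)"
    using Ui Gi point by (intro integral_mono) (auto simp: G_def)
  also have "\<dots> = ((\<integral>\<omega>. \<bar>\<Sum>p\<in>pairs. H p \<omega> - expectation (H p)\<bar> \<partial>M)
      + \<bar>(\<Sum>p\<in>pairs. expectation (H p)) - N * (N - 3) * V\<bar> + a * expectation S2) / (V * (N * (N - 3)))"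
    unfolding G_def using Hi S2i by (simp add: prob_space)
  also have "\<dots> \<le> (V * (?bound * (N * (N - 3)))) / (V * (N * (N - 3)))"
  proof (rule divide_right_mono)
    have "a * expectation S2 \<le> V * (a * (N * (C * (3 * N + 8 * N^2 * e^2))))"
      using mult_left_mono[OF S2E a0] by (simp add: mult_ac)
    moreover have "?bound * (N * (N - 3)) = 2 * N^2 * (sqrt (\<delta> * C) + L / (N powr \<tau> * V powr (1 + \<tau>)) / \<delta> powr \<tau>)
       + C * (\<bar>real n * (real n - 1) - N * (N - 3) * \<rho>^2\<bar>
              + 2 * \<bar>real n * real m - N * (N - 3) * (\<rho> * (1 - \<rho>))\<bar>
              + \<bar>real m * (real m - 1) - N * (N - 3) * (1 - \<rho>)^2\<bar>)
       + a * (N * (C * (3 * N + 8 * N^2 * e^2)))"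
      using N3 by (simp add: a_def)
    ultimately show "(\<integral>\<omega>. \<bar>\<Sum>p\<in>pairs. H p \<omega> - expectation (H p)\<bar> \<partial>M)
      + \<bar>(\<Sum>p\<in>pairs. expectation (H p)) - N * (N - 3) * V\<bar> + a * expectation S2 \<le> V * (?bound * (N * (N - 3)))"
      using dev mean by (simp only: distrib_left[of V])
  qed (use V N3 in simp)
  also have "\<dots> = ?bound" using V N3 by simp
  finally show "(\<integral>\<omega>. \<bar>U \<omega> / V - 1\<bar> \<partial>M) \<le> ?bound" .
qed

end

section \<open>Convergence in probability\<close>

lemma (in prob_space) indep_vars_reindex:
  assumes inj: "inj_on f I" and ind: "indep_vars M' X (f ` I)"
  shows "indep_vars (\<lambda>i. M' (f i)) (\<lambda>i. X (f i)) I"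
proof -
  let ?F = "\<lambda>j. {X j -` A \<inter> space M |A. A \<in> sets (M' j)}"
  have rv: "\<forall>j\<in>f ` I. random_variable (M' j) (X j)" and sets: "indep_sets ?F (f ` I)"
    using ind unfolding indep_vars_def2 by auto
  have "indep_sets (\<lambda>i. ?F (f i)) I"
    unfolding indep_sets_def
  proof (intro conjI ballI allI impI)
    fix i assume "i \<in> I" then show "?F (f i) \<subseteq> events"
      using sets unfolding indep_sets_def by blast
  next
    fix J A assume J: "J \<subseteq> I" "J \<noteq> {}" "finite J" and A: "A \<in> Pi J (\<lambda>i. ?F (f i))"
    define A' where "A' = (\<lambda>j. A (the_inv_into J f j))"
    have injJ: "inj_on f J" using inj J(1) by (rule inj_on_subset)
    have A': "A' (f j) = A j" if "j \<in> J" for j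
      using the_inv_into_f_f[OF injJ that] by (simp add: A'_def)
    have "A' \<in> Pi (f ` J) ?F"
    proof (rule Pi_I)
      fix k assume "k \<in> f ` J"
      then obtain j where j: "j \<in> J" and k: "k = f j" by blast
      show "A' k \<in> ?F k" unfolding k A'[OF j] using Pi_mem[OF A j] .
    qed
    then have "prob (\<Inter>j\<in>f ` J. A' j) = (\<Prod>j\<in>f ` J. prob (A' j))"
      using J by (intro indep_setsD[OF sets]) auto
    then show "prob (\<Inter>j\<in>J. A j) = (\<Prod>j\<in>J. prob (A j))"
      using A' by (simp add: prod.reindex[OF injJ])
  qed
  then show ?thesis using rv unfolding indep_vars_def2 by auto
qed

lemma two_sample_pooled:
  assumes ts: "two_sample M S P Q n m X Y"
  shows "two_group_sample M S (\<lambda>s \<omega>. pooled n (\<lambda>j. X j \<omega>) (\<lambda>j. Y j \<omega>) s) n m P Q"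
proof -
  interpret prob_space M using ts by (simp add: two_sample_def)
  let ?W = "\<lambda>s \<omega>. pooled n (\<lambda>j. X j \<omega>) (\<lambda>j. Y j \<omega>) s"
  define f where "f = (\<lambda>s. if s \<le> n then Inl s else Inr (s - n) :: nat + nat)"
  have inj: "inj_on f {1..n+m}" by (auto simp: inj_on_def f_def split: if_splits)
  have img: "f ` {1..n+m} = {1..n} <+> {1..m}"
  proof (intro equalityI subsetI)
    fix z assume z: "z \<in> {1..n} <+> {1..m}"
    show "z \<in> f ` {1..n+m}"
    proof (cases z)
      case (Inl j) then show ?thesis using z by (intro image_eqI[of _ _ j]) (auto simp: f_def)
    next
      case (Inr j) then show ?thesis using z by (intro image_eqI[of _ _ "n + j"]) (auto simp: f_def)
    qed
  qed (auto simp: f_def split: if_splits)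
  have "indep_vars (\<lambda>_. S) (case_sum X Y) (f ` {1..n+m})"
    unfolding img using ts unfolding two_sample_def by blast
  from indep_vars_reindex[OF inj this]
  have "indep_vars (\<lambda>_. S) (\<lambda>s. case_sum X Y (f s)) {1..n+m}" .
  moreover have W: "(\<lambda>s. case_sum X Y (f s)) = ?W"
    by (auto simp: f_def pooled_def fun_eq_iff)
  ultimately interpret independent_sample M S ?W "n + m" by unfold_locales simp
  show ?thesis
  proof unfold_locales
    fix s assume s: "s \<in> {1..n+m}"
    have "law s = distr M S (if s \<le> n then X s else Y (s - n))"
      unfolding law_def by (intro arg_cong[where f = "distr M S"]) (auto simp: pooled_def fun_eq_iff)
    moreover have "distr M S (X s) = P" if "s \<le> n"
      using ts that s by (simp add: two_sample_def)
    moreover have "distr M S (Y (s - n)) = Q" if "\<not> s \<le> n"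
    proof -
      have "s - n \<in> {1..m}" using s that by auto
      then show ?thesis using ts unfolding two_sample_def by blast
    qed
    ultimately show "law s = (if s \<le> n then P else Q)" by simp
  qed
qed

text \<open>
  Dividing numerator and denominator by \<open>N^2\<close> writes the bound as a continuous function of \<open>n / N\<close>, \<open>1 / N\<close> and
  \<open>l\<close>. At \<open>n / N = \<rho>\<close> and \<open>1 / N = 0\<close> the bias and the contribution of the row sums vanish.
\<close>

lemma tendsto_L1_bound:
  fixes F :: "'i filter" and n m :: "'i \<Rightarrow> nat" and \<rho> C A d :: real and l :: "'i \<Rightarrow> real"
  defines "N \<equiv> \<lambda>i. real (n i + m i)"
  assumes n: "filterlim n at_top F" and a: "((\<lambda>i. real (n i) / N i) \<longlongrightarrow> \<rho>) F" and l: "(l \<longlongrightarrow> 0) F" and d: "0 < d"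
  shows "((\<lambda>i. (2 * (N i)^2 * (A + l i / d)
       + C * (\<bar>real (n i) * (real (n i) - 1) - N i * (N i - 3) * \<rho>^2\<bar>
              + 2 * \<bar>real (n i) * real (m i) - N i * (N i - 3) * (\<rho> * (1 - \<rho>))\<bar>
              + \<bar>real (m i) * (real (m i) - 1) - N i * (N i - 3) * (1 - \<rho>)^2\<bar>)
       + (2 / (N i - 2) + N i / ((N i - 1) * (N i - 2)))
          * (N i * (C * (3 * N i + 8 * (N i)^2 * (real (n i) / N i - \<rho>)^2)))) / (N i * (N i - 3))) \<longlongrightarrow> 2 * A) F"
    (is "(?f \<longlongrightarrow> _) F")
proof -
  define x where "x = (\<lambda>i. real (n i) / N i)"
  define y where "y = (\<lambda>i. 1 / N i)"
  have Ninf: "filterlim N at_top F"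
  proof (rule filterlim_at_top_mono)
    show "filterlim (\<lambda>i. real (n i)) at_top F" using n by (rule filterlim_compose[OF filterlim_real_sequentially])
  qed (simp add: N_def)
  have y: "(y \<longlongrightarrow> 0) F"
    unfolding y_def by (rule real_tendsto_divide_at_top[OF tendsto_const Ninf])
  have x: "(x \<longlongrightarrow> \<rho>) F" using a by (simp add: x_def)
  let ?g = "\<lambda>i. (2 * (A + l i / d) + C * (\<bar>x i * (x i - y i) - (1 - 3 * y i) * \<rho>^2\<bar>
      + 2 * \<bar>x i * (1 - x i) - (1 - 3 * y i) * (\<rho> * (1 - \<rho>))\<bar>
      + \<bar>(1 - x i) * (1 - x i - y i) - (1 - 3 * y i) * (1 - \<rho>)^2\<bar>)
      + (2 / (1 - 2 * y i) + 1 / ((1 - y i) * (1 - 2 * y i))) * (C * (3 * y i + 8 * (x i - \<rho>)^2))) / (1 - 3 * y i)"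
  have "(?g \<longlongrightarrow> (2 * (A + 0 / d) + C * (\<bar>\<rho> * (\<rho> - 0) - (1 - 3 * 0) * \<rho>^2\<bar>
      + 2 * \<bar>\<rho> * (1 - \<rho>) - (1 - 3 * 0) * (\<rho> * (1 - \<rho>))\<bar>
      + \<bar>(1 - \<rho>) * (1 - \<rho> - 0) - (1 - 3 * 0) * (1 - \<rho>)^2\<bar>)
      + (2 / (1 - 2 * 0) + 1 / ((1 - 0) * (1 - 2 * 0))) * (C * (3 * 0 + 8 * (\<rho> - \<rho>)^2))) / (1 - 3 * 0)) F"
    by (intro tendsto_intros x y l) (use d in auto)
  then have g: "(?g \<longlongrightarrow> 2 * A) F" by (simp add: power2_eq_square)
  have "\<forall>\<^sub>F i in F. 3 < N i" using Ninf by (auto simp: filterlim_at_top_dense)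
  then have "\<forall>\<^sub>F i in F. ?g i = ?f i"
  proof eventually_elim
    case (elim i)
    define K where "K = N i"
    define u where "u = real (n i) / K"
    have xu: "x i = u" by (simp add: x_def u_def K_def)
    have K: "3 < K" using elim by (simp add: K_def)
    have nK: "real (n i) = u * K" using K by (simp add: u_def)
    have mK: "real (m i) = (1 - u) * K" using nK by (simp add: K_def N_def algebra_simps)
    have yK: "y i = 1 / K" by (simp add: y_def K_def)
    have abs: "\<bar>K^2 * v\<bar> = K^2 * \<bar>v\<bar>" for v by (simp add: abs_mult)
    have 1: "\<bar>real (n i) * (real (n i) - 1) - K * (K - 3) * \<rho>^2\<bar> = K^2 * \<bar>u * (u - 1 / K) - (1 - 3 * (1 / K)) * \<rho>^2\<bar>"
      unfolding abs[symmetric] nK using K by (intro arg_cong[where f = abs]) (simp add: field_simps power2_eq_square)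
    have 2: "\<bar>real (n i) * real (m i) - K * (K - 3) * (\<rho> * (1 - \<rho>))\<bar> = K^2 * \<bar>u * (1 - u) - (1 - 3 * (1 / K)) * (\<rho> * (1 - \<rho>))\<bar>"
      unfolding abs[symmetric] nK mK using K by (intro arg_cong[where f = abs]) (simp add: field_simps power2_eq_square)
    have 3: "\<bar>real (m i) * (real (m i) - 1) - K * (K - 3) * (1 - \<rho>)^2\<bar> = K^2 * \<bar>(1 - u) * (1 - u - 1 / K) - (1 - 3 * (1 / K)) * (1 - \<rho>)^2\<bar>"
      unfolding abs[symmetric] mK using K by (intro arg_cong[where f = abs]) (simp add: field_simps power2_eq_square)
    have 4: "2 / (K - 2) + K / ((K - 1) * (K - 2)) = (2 / (1 - 2 * (1 / K)) + 1 / ((1 - 1 / K) * (1 - 2 * (1 / K)))) / K"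
    proof -
      have "1 - 2 * (1 / K) = (K - 2) / K" "1 - 1 / K = (K - 1) / K" using K by (simp_all add: field_simps)
      then show ?thesis using K by (simp add: divide_simps) (simp add: algebra_simps)
    qed
    have 5: "K * (C * (3 * K + 8 * K^2 * (u - \<rho>)^2)) = K^3 * (C * (3 * (1 / K) + 8 * (u - \<rho>)^2))"
      using K by (simp add: field_simps power2_eq_square power3_eq_cube)
    have 6: "K * (K - 3) = K^2 * (1 - 3 * (1 / K))" using K by (simp add: field_simps power2_eq_square)
    have 7: "v / K * (K^3 * w) = K^2 * (v * w)" for v w
      using K by (simp add: power2_eq_square power3_eq_cube)
    have "?f i = (K^2 * (2 * (A + l i / d)) + C * (K^2 * \<bar>u * (u - 1 / K) - (1 - 3 * (1 / K)) * \<rho>^2\<bar>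
      + 2 * (K^2 * \<bar>u * (1 - u) - (1 - 3 * (1 / K)) * (\<rho> * (1 - \<rho>))\<bar>)
      + K^2 * \<bar>(1 - u) * (1 - u - 1 / K) - (1 - 3 * (1 / K)) * (1 - \<rho>)^2\<bar>)
      + K^2 * ((2 / (1 - 2 * (1 / K)) + 1 / ((1 - 1 / K) * (1 - 2 * (1 / K)))) * (C * (3 * (1 / K) + 8 * (u - \<rho>)^2))))
      / (K^2 * (1 - 3 * (1 / K)))"
      unfolding K_def[symmetric] unfolding u_def[symmetric] unfolding 1 2 3 unfolding 4 5 unfolding 6 7
      by (simp only: mult.assoc mult.left_commute[of "K^2" 2])
    also have "\<dots> = (K^2 * (2 * (A + l i / d) + C * (\<bar>u * (u - 1 / K) - (1 - 3 * (1 / K)) * \<rho>^2\<bar>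
      + 2 * \<bar>u * (1 - u) - (1 - 3 * (1 / K)) * (\<rho> * (1 - \<rho>))\<bar>
      + \<bar>(1 - u) * (1 - u - 1 / K) - (1 - 3 * (1 / K)) * (1 - \<rho>)^2\<bar>)
      + (2 / (1 - 2 * (1 / K)) + 1 / ((1 - 1 / K) * (1 - 2 * (1 / K)))) * (C * (3 * (1 / K) + 8 * (u - \<rho>)^2))))
      / (K^2 * (1 - 3 * (1 / K)))"
      by (simp only: distrib_left mult.left_commute mult.assoc)
    also have "\<dots> = ?g i"
      unfolding yK xu using K by (intro nonzero_mult_divide_mult_cancel_left) simp
    finally show ?case by simp
  qed
  from tendsto_cong[THEN iffD1, OF this g] show ?thesis .
qed

lemma (in two_laws_kernel) variance_estimator_deviation_prob:
  fixes n m :: nat and \<delta> \<tau> :: real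
  assumes ts: "two_sample M S P Q n m X Y" and diag: "\<And>x. x \<in> space S \<Longrightarrow> k x x = a0"
  defines "V \<equiv> kernel_variance k R" and "N \<equiv> real (n + m)" and "C \<equiv> c\<rho>^2"
  assumes V: "0 < V" and N: "3 < n + m" and \<delta>: "0 < \<delta>" and \<tau>: "0 < \<tau>" "\<tau> \<le> 1" and \<epsilon>: "0 < \<epsilon>"
  defines "L \<equiv> 6 powr (2 + 2 * \<tau>) * (5 * (centered_abs_moment (2 + 2 * \<tau>) k P P
      + centered_abs_moment (2 + 2 * \<tau>) k P Q + centered_abs_moment (2 + 2 * \<tau>) k Q Q)
      + \<bar>energy k P Q\<bar> powr (2 + 2 * \<tau>))"
  shows "measure M {\<omega> \<in> space M. \<bar>variance_estimator k a0 n m (\<lambda>j. X j \<omega>) (\<lambda>j. Y j \<omega>) / V - 1\<bar> > \<epsilon>}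
    \<le> (2 * N^2 * (sqrt (\<delta> * C) + L / (N powr \<tau> * V powr (1 + \<tau>)) / \<delta> powr \<tau>)
       + C * (\<bar>real n * (real n - 1) - N * (N - 3) * \<rho>^2\<bar>
              + 2 * \<bar>real n * real m - N * (N - 3) * (\<rho> * (1 - \<rho>))\<bar>
              + \<bar>real m * (real m - 1) - N * (N - 3) * (1 - \<rho>)^2\<bar>)
       + (2 / (N - 2) + N / ((N - 1) * (N - 2))) * (N * (C * (3 * N + 8 * N^2 * (real n / N - \<rho>)^2)))) / (N * (N - 3)) / \<epsilon>"
    (is "_ \<le> ?b / \<epsilon>")
proof -
  let ?W = "\<lambda>s \<omega>. pooled n (\<lambda>j. X j \<omega>) (\<lambda>j. Y j \<omega>) s"
  have tg: "two_group_sample M S ?W n m P Q" by (rule two_sample_pooled[OF ts])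
  interpret two_group_sample M S ?W n m P Q by (rule tg)
  define U where "U = (\<lambda>\<omega>. ((\<Sum>s\<in>I. \<Sum>t\<in>I - {s}. (h (?W s \<omega>) (?W t \<omega>))^2)
        - 2 / (N - 2) * (\<Sum>s\<in>I. (\<Sum>t\<in>I - {s}. h (?W s \<omega>) (?W t \<omega>))^2)
        + (\<Sum>s\<in>I. \<Sum>t\<in>I - {s}. h (?W s \<omega>) (?W t \<omega>))^2 / ((N - 1) * (N - 2))) / (N * (N - 3)))"
  have U_eq: "variance_estimator k a0 n m (\<lambda>j. X j \<omega>) (\<lambda>j. Y j \<omega>) = U \<omega>" if \<omega>: "\<omega> \<in> space M" for \<omega>
  proof -
    have W: "?W s \<omega> \<in> space S" if "s \<in> I" for s
      using measurable_space[OF W_measurable[OF that] \<omega>] .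
    show ?thesis
      unfolding U_def h_def N_def
      by (rule variance_estimator_as_centered_sums) (use N in simp, rule diag[OF W], assumption, rule k_sym[OF W W])
  qed
  have L1: "integrable M (\<lambda>\<omega>. \<bar>U \<omega> / V - 1\<bar>)" "(\<integral>\<omega>. \<bar>U \<omega> / V - 1\<bar> \<partial>M) \<le> ?b"
    unfolding U_def V_def N_def C_def L_def
    by (rule variance_ratio_L1_bound[OF tg V[unfolded V_def] N \<delta> \<tau>])+
  have "measure M {\<omega> \<in> space M. \<bar>variance_estimator k a0 n m (\<lambda>j. X j \<omega>) (\<lambda>j. Y j \<omega>) / V - 1\<bar> > \<epsilon>}
      \<le> measure M {\<omega> \<in> space M. \<bar>U \<omega> / V - 1\<bar> \<ge> \<epsilon>}"
  proof (rule finite_measure_mono)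
    have "(\<lambda>\<omega>. \<bar>U \<omega> / V - 1\<bar>) \<in> borel_measurable M" using L1(1) by (rule borel_measurable_integrable)
    then show "{\<omega> \<in> space M. \<bar>U \<omega> / V - 1\<bar> \<ge> \<epsilon>} \<in> sets M" by measurable
  qed (auto simp: U_eq)
  also have "\<dots> \<le> (\<integral>\<omega>. \<bar>U \<omega> / V - 1\<bar> \<partial>M) / \<epsilon>"
    using L1(1) \<epsilon> by (intro integral_Markov_inequality_measure[of _ _ "{}"]) auto
  also have "\<dots> \<le> ?b / \<epsilon>"
    using \<epsilon> by (intro divide_right_mono L1(2)) simp
  finally show ?thesis .
qed

theorem proposition15:
  fixes k :: "nat \<Rightarrow> (nat \<Rightarrow> real) \<Rightarrow> (nat \<Rightarrow> real) \<Rightarrow> real"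
    and a0 :: "nat \<Rightarrow> real"
    and PX PY PZ :: "nat \<Rightarrow> (nat \<Rightarrow> real) measure"
    and \<rho> s \<tau> :: real
    and F :: "'i filter"
    and n m N p :: "'i \<Rightarrow> nat"
    and M :: "'i \<Rightarrow> 'w measure"
    and X Y :: "'i \<Rightarrow> nat \<Rightarrow> 'w \<Rightarrow> (nat \<Rightarrow> real)"
  assumes kernel: "\<And>d. d \<ge> 1 \<Longrightarrow> kernel_on (Rn d) (k d)"
    and diag: "\<And>d x. d \<ge> 1 \<Longrightarrow> x \<in> space (Rn d) \<Longrightarrow> k d x x = a0 d"
    and law_X: "\<And>d. d \<ge> 1 \<Longrightarrow> PX d \<in> space (prob_algebra (Rn d))"
    and law_Y: "\<And>d. d \<ge> 1 \<Longrightarrow> PY d \<in> space (prob_algebra (Rn d))"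
    and law_Z: "\<And>d. PZ d = mixture \<rho> (PX d) (PY d)"
    and alternative: "\<And>d. d \<ge> 1 \<Longrightarrow> PX d \<noteq> PY d"
    and moment4: "\<And>d. d \<ge> 1 \<Longrightarrow>
          integrable (PZ d \<Otimes>\<^sub>M PZ d) (\<lambda>z. (k d (fst z) (snd z))^4)"
    and rho: "0 < \<rho>" "\<rho> < 1"
    and s: "s > 0"
    and tau: "0 < \<tau>" "\<tau> \<le> 1"
    and N: "\<And>i. N i = n i + m i"
    and n_lim: "filterlim n at_top F"
    and m_lim: "filterlim m at_top F"
    and p_lim: "filterlim p at_top F"
    and ratio: "(\<lambda>i. real (n i) / real (N i) - \<rho>) \<in> O[F](\<lambda>i. 1 / real (N i) powr s)"
    and sample: "\<And>i. two_sample (M i) (Rn (p i)) (PX (p i)) (PY (p i)) (n i) (m i) (X i) (Y i)"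
    and cond1: "((\<lambda>i. \<bar>energy (k (p i)) (PX (p i)) (PY (p i))\<bar> powr (2 + 2 * \<tau>)
            / (real (N i) powr \<tau> * kernel_variance (k (p i)) (PZ (p i)) powr (1 + \<tau>))) \<longlongrightarrow> 0) F"
    and cond2: "((\<lambda>i. pair_expectation (\<lambda>x y. (k (p i) x y)^2) (PZ (p i)) (PZ (p i))
            / (real (N i) powr s * kernel_variance (k (p i)) (PZ (p i)))) \<longlongrightarrow> 0) F"
    and cond3: "((\<lambda>i. (centered_abs_moment (2 + 2 * \<tau>) (k (p i)) (PX (p i)) (PX (p i))
              + centered_abs_moment (2 + 2 * \<tau>) (k (p i)) (PX (p i)) (PY (p i))
              + centered_abs_moment (2 + 2 * \<tau>) (k (p i)) (PY (p i)) (PY (p i)))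
            / (real (N i) powr \<tau> * kernel_variance (k (p i)) (PZ (p i)) powr (1 + \<tau>))) \<longlongrightarrow> 0) F"
  shows "converges_in_prob M
           (\<lambda>i \<omega>. variance_estimator (k (p i)) (a0 (p i)) (n i) (m i)
                    (\<lambda>j. X i j \<omega>) (\<lambda>j. Y i j \<omega>)
                  / kernel_variance (k (p i)) (PZ (p i))) 1 F"
proof -
  have kernel_laws: "two_laws_kernel (Rn d) (PX d) (PY d) \<rho> (k d)" if d: "d \<ge> 1" for d
  proof (intro two_laws_kernel.intro two_laws.intro two_laws_kernel_axioms.intro)
    show "prob_space (PX d)" "sets (PX d) = sets (Rn d)" "prob_space (PY d)" "sets (PY d) = sets (Rn d)"
      using law_X[OF d] law_Y[OF d] by (auto simp: space_prob_algebra)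
    show "(\<lambda>z. k d (fst z) (snd z)) \<in> borel_measurable (Rn d \<Otimes>\<^sub>M Rn d)"
      "\<And>x y. x \<in> space (Rn d) \<Longrightarrow> y \<in> space (Rn d) \<Longrightarrow> k d x y = k d y x"
      using kernel[OF d] by (auto simp: kernel_on_def)
    show "integrable (mixture \<rho> (PX d) (PY d) \<Otimes>\<^sub>M mixture \<rho> (PX d) (PY d)) (\<lambda>z. (k d (fst z) (snd z))^4)"
      using moment4[OF d] by (simp add: law_Z)
  qed (rule rho)+
  define V where "V = (\<lambda>i. kernel_variance (k (p i)) (PZ (p i)))"
  define C where "C = (1 / (\<rho> * (1 - \<rho>)))^2"
  have C: "0 < C" using rho by (simp add: C_def)
  define L where "L = (\<lambda>i. 6 powr (2 + 2 * \<tau>) * (5 * (centered_abs_moment (2 + 2 * \<tau>) (k (p i)) (PX (p i)) (PX (p i))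
      + centered_abs_moment (2 + 2 * \<tau>) (k (p i)) (PX (p i)) (PY (p i))
      + centered_abs_moment (2 + 2 * \<tau>) (k (p i)) (PY (p i)) (PY (p i)))
      + \<bar>energy (k (p i)) (PX (p i)) (PY (p i))\<bar> powr (2 + 2 * \<tau>)))"
  define l where "l = (\<lambda>i. L i / (real (n i + m i) powr \<tau> * V i powr (1 + \<tau>)))"
  have l: "(l \<longlongrightarrow> 0) F"
  proof -
    have "((\<lambda>i. 6 powr (2 + 2 * \<tau>) * (5 * ((centered_abs_moment (2 + 2 * \<tau>) (k (p i)) (PX (p i)) (PX (p i))
              + centered_abs_moment (2 + 2 * \<tau>) (k (p i)) (PX (p i)) (PY (p i))
              + centered_abs_moment (2 + 2 * \<tau>) (k (p i)) (PY (p i)) (PY (p i)))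
            / (real (N i) powr \<tau> * kernel_variance (k (p i)) (PZ (p i)) powr (1 + \<tau>)))
        + \<bar>energy (k (p i)) (PX (p i)) (PY (p i))\<bar> powr (2 + 2 * \<tau>)
            / (real (N i) powr \<tau> * kernel_variance (k (p i)) (PZ (p i)) powr (1 + \<tau>))))
        \<longlongrightarrow> 6 powr (2 + 2 * \<tau>) * (5 * 0 + 0)) F"
      by (intro tendsto_intros cond1 cond3)
    then show ?thesis
      unfolding l_def L_def V_def N
      by (simp only: add_divide_distrib[symmetric] times_divide_eq_right) simp
  qed
  have N_lim: "filterlim (\<lambda>i. real (N i)) at_top F"
  proof (rule filterlim_at_top_mono)
    show "filterlim (\<lambda>i. real (n i)) at_top F"
      by (rule filterlim_compose[OF filterlim_real_sequentially n_lim])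
  qed (simp add: N)
  have ratio_lim: "((\<lambda>i. real (n i) / real (n i + m i)) \<longlongrightarrow> \<rho>) F"
  proof -
    have "((\<lambda>i. real (N i) powr (- s)) \<longlongrightarrow> 0) F"
      using s by (intro tendsto_neg_powr N_lim) simp
    then have "(\<lambda>i. 1 / real (N i) powr s) \<in> o[F](\<lambda>_. 1)"
      by (intro smalloI_tendsto) (simp_all add: powr_minus_divide)
    from landau_o.big_small_trans[OF ratio this]
    have "((\<lambda>i. (real (n i) / real (N i) - \<rho>) / 1) \<longlongrightarrow> 0) F"
      by (rule smalloD_tendsto)
    then have "((\<lambda>i. real (n i) / real (N i) - \<rho>) \<longlongrightarrow> 0) F" by simp
    then show ?thesis unfolding N[symmetric] by (rule LIM_zero_cancel)
  qed
  show ?thesis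
    unfolding converges_in_prob_def
  proof (intro allI impI tendstoI)
    fix \<epsilon> \<eta> :: real assume \<epsilon>: "0 < \<epsilon>" and \<eta>: "0 < \<eta>"
    \<comment> \<open>this makes the limit \<open>2 * sqrt (\<delta> * C)\<close> of the bound equal to \<open>\<eta> * \<epsilon> / 2\<close>\<close>
    define \<delta> where "\<delta> = (\<eta> * \<epsilon> / 4)^2 / C"
    have \<delta>: "0 < \<delta>" using C \<epsilon> \<eta> by (simp add: \<delta>_def)
    have "sqrt (\<delta> * C) = \<eta> * \<epsilon> / 4" using C \<epsilon> \<eta> by (simp add: \<delta>_def)
    moreover have "0 < \<eta> * \<epsilon>" using \<epsilon> \<eta> by simp
    ultimately have small: "2 * sqrt (\<delta> * C) < \<eta> * \<epsilon>" by linarith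
    have "0 < \<delta> powr \<tau>" using \<delta> by simp
    note lim = tendsto_L1_bound[OF n_lim ratio_lim l this, where A = "sqrt (\<delta> * C)" and C = C]
    have "\<forall>\<^sub>F i in F. 1 \<le> p i" "\<forall>\<^sub>F i in F. 4 \<le> n i"
      using p_lim n_lim by (auto simp: filterlim_at_top)
    then show "\<forall>\<^sub>F i in F. dist (measure (M i) {\<omega> \<in> space (M i).
        \<bar>variance_estimator (k (p i)) (a0 (p i)) (n i) (m i) (\<lambda>j. X i j \<omega>) (\<lambda>j. Y i j \<omega>)
          / kernel_variance (k (p i)) (PZ (p i)) - 1\<bar> > \<epsilon>}) 0 < \<eta>"
      using order_tendstoD(2)[OF lim small]
    proof eventually_elim
      case (elim i)
      interpret two_laws_kernel "Rn (p i)" "PX (p i)" "PY (p i)" \<rho> "k (p i)"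
        by (rule kernel_laws[OF elim(1)])
      have pos: "0 < kernel_variance (k (p i)) (mixture \<rho> (PX (p i)) (PY (p i)))"
        by (rule kernel_variance_pos[OF kernel diag alternative]) (use elim(1) in auto)
      have n4: "3 < n i + m i" using elim(2) by simp
      have "measure (M i) {\<omega> \<in> space (M i).
        \<bar>variance_estimator (k (p i)) (a0 (p i)) (n i) (m i) (\<lambda>j. X i j \<omega>) (\<lambda>j. Y i j \<omega>)
          / kernel_variance (k (p i)) (PZ (p i)) - 1\<bar> > \<epsilon>} < \<eta> * \<epsilon> / \<epsilon>"
        using le_less_trans[OF variance_estimator_deviation_prob[OF sample diag[OF elim(1)] pos n4 \<delta> tau \<epsilon>]
            divide_strict_right_mono[OF elim(3)[unfolded l_def L_def V_def C_def law_Z] \<epsilon>]]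
        unfolding law_Z .
      then show ?case using \<epsilon> by simp
    qed
  qed
qed

end
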